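(* Let $A_0$ be a ring with a nonzero divisor $t$ and put $A=A_0[\frac1t]$. Let $B$ be a finite \'etale $A$-algebra. Let $B_0\subset B$ be an $A_0$-subalgebra for which $B=B_0[\frac1t]$. Assume that there exists some $l>0$ such that $\mathrm{Tr}_{B/A}(t^lb)\in A_0$ for every $b\in B_0$. Denote by $\widehat{A_0}$ and $\widehat{B_0}$ the $t$-adic completions of $A_0$ and $B_0$, respectively. Then the natural $A_0$-algebra homomorphism $B_0\otimes_{A_0}\widehat{A_0}\to\widehat{B_0}$ induces an isomorphism $$(B_0\otimes_{A_0}\widehat{A_0})/(0)^{t\text{-sat}}\xrightarrow{\ \cong\ }\widehat{B_0}.$$ In particular, the natural $A$-algebra homomorphism $(B_0\otimes_{A_0}\widehat{A_0})[\frac1t]\to\widehat{B_0}[\frac1t]$ is an isomorphism.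
   Context: All rings are commutative with unity. $\mathrm{Tr}_{B/A}:B\to A$ is the trace map of the finite projective $A$-algebra $B$. $(0)^{t\text{-sat}}$ denotes the $(t)$-saturation of the zero ideal of $B_0\otimes_{A_0}\widehat{A_0}$, i.e. the ideal of all elements annihilated by some power of $t$. *)

theory Defs
  imports "HOL-Algebra.Algebra"
begin

text \<open>
  An algebra over a commutative ring \<open>R\<close> is given by a commutative ring \<open>S\<close> together with a
  structure homomorphism \<open>\<phi> : R \<rightarrow> S\<close>.
\<close>

definition algebra_iso ::
  "('r, 'k) ring_scheme \<Rightarrow> ('r \<Rightarrow> 'a) \<Rightarrow> ('a, 'm) ring_scheme \<Rightarrow> ('r \<Rightarrow> 'b) \<Rightarrow> ('b, 'n) ring_scheme
    \<Rightarrow> ('a \<Rightarrow> 'b) set" where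
  "algebra_iso R \<phi> S \<psi> T = {h \<in> ring_iso S T. \<forall>r\<in>carrier R. h (\<phi> r) = \<psi> r}"

definition nonzero_divisor :: "('a, 'm) ring_scheme \<Rightarrow> 'a \<Rightarrow> bool" where
  "nonzero_divisor R t \<longleftrightarrow>
     t \<in> carrier R \<and> (\<forall>a\<in>carrier R. t \<otimes>\<^bsub>R\<^esub> a = \<zero>\<^bsub>R\<^esub> \<longrightarrow> a = \<zero>\<^bsub>R\<^esub>)"


section \<open>Localization at the powers of an element\<close>

text \<open>The pair \<open>(r, n)\<close> represents the fraction \<open>r / t\<^sup>n\<close>.\<close>

definition loc_rel :: "('a, 'm) ring_scheme \<Rightarrow> 'a \<Rightarrow> (('a \<times> nat) \<times> ('a \<times> nat)) set" where
  "loc_rel R t = {((r, m), (s, n)). r \<in> carrier R \<and> s \<in> carrier R \<and>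
     (\<exists>k::nat. t [^]\<^bsub>R\<^esub> k \<otimes>\<^bsub>R\<^esub> (t [^]\<^bsub>R\<^esub> n \<otimes>\<^bsub>R\<^esub> r) = t [^]\<^bsub>R\<^esub> k \<otimes>\<^bsub>R\<^esub> (t [^]\<^bsub>R\<^esub> m \<otimes>\<^bsub>R\<^esub> s))}"

definition loc_frac :: "('a, 'm) ring_scheme \<Rightarrow> 'a \<Rightarrow> 'a \<Rightarrow> nat \<Rightarrow> ('a \<times> nat) set" where
  "loc_frac R t r n = loc_rel R t `` {(r, n)}"

definition localization :: "('a, 'm) ring_scheme \<Rightarrow> 'a \<Rightarrow> ('a \<times> nat) set ring" where
  "localization R t =
    \<lparr>carrier = {loc_frac R t r n | r n. r \<in> carrier R},
     monoid.mult = (\<lambda>C D. \<Union>(r, m)\<in>C. \<Union>(s, n)\<in>D. loc_frac R t (r \<otimes>\<^bsub>R\<^esub> s) (m + n)),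
     monoid.one = loc_frac R t \<one>\<^bsub>R\<^esub> 0,
     ring.zero = loc_frac R t \<zero>\<^bsub>R\<^esub> 0,
     ring.add = (\<lambda>C D. \<Union>(r, m)\<in>C. \<Union>(s, n)\<in>D.
              loc_frac R t (t [^]\<^bsub>R\<^esub> n \<otimes>\<^bsub>R\<^esub> r \<oplus>\<^bsub>R\<^esub> t [^]\<^bsub>R\<^esub> m \<otimes>\<^bsub>R\<^esub> s) (m + n))\<rparr>"

definition to_loc :: "('a, 'm) ring_scheme \<Rightarrow> 'a \<Rightarrow> 'a \<Rightarrow> ('a \<times> nat) set" where
  "to_loc R t r = loc_frac R t r 0"

text \<open>
  The map \<open>R[1/t] \<rightarrow> S[1/u]\<close>, \<open>r/t\<^sup>n \<mapsto> f(r)/u\<^sup>n\<close>, induced by a homomorphism \<open>f : R \<rightarrow> S\<close> with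
  \<open>f t = u\<close>. As for the library's \<open>FactRing_iso\<close>, an induced map on classes is written with
  \<open>the_elem\<close>: the image of a class is a singleton.
\<close>

definition loc_map ::
  "('b, 'n) ring_scheme \<Rightarrow> 'b \<Rightarrow> ('a \<Rightarrow> 'b) \<Rightarrow> ('a \<times> nat) set \<Rightarrow> ('b \<times> nat) set" where
  "loc_map S u f C = the_elem ((\<lambda>(r, n). loc_frac S u (f r) n) ` C)"


section \<open>Tensor products of algebras\<close>

text \<open>
  The integral monoid ring of the multiplicative monoid \<open>S \<times> T\<close>; its additive group is
  \<open>free_Abelian_group (carrier S \<times> carrier T)\<close>.
\<close>

definition tensor_free ::
  "('a, 'm) ring_scheme \<Rightarrow> ('b, 'n) ring_scheme \<Rightarrow> ('a \<times> 'b \<Rightarrow>\<^sub>0 int) ring" where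
  "tensor_free S T =
    \<lparr>carrier = {p. Poly_Mapping.keys p \<subseteq> carrier S \<times> carrier T},
     monoid.mult = (\<lambda>p q. frag_extend (\<lambda>(a, b). frag_extend
               (\<lambda>(c, d). frag_of (a \<otimes>\<^bsub>S\<^esub> c, b \<otimes>\<^bsub>T\<^esub> d)) q) p),
     monoid.one = frag_of (\<one>\<^bsub>S\<^esub>, \<one>\<^bsub>T\<^esub>),
     ring.zero = 0,
     ring.add = (+)\<rparr>"

definition tensor_rels ::
  "('r, 'k) ring_scheme \<Rightarrow> ('r \<Rightarrow> 'a) \<Rightarrow> ('a, 'm) ring_scheme \<Rightarrow> ('r \<Rightarrow> 'b) \<Rightarrow> ('b, 'n) ring_scheme
    \<Rightarrow> ('a \<times> 'b \<Rightarrow>\<^sub>0 int) set" where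
  "tensor_rels R \<phi> S \<psi> T =
     {frag_of (a \<oplus>\<^bsub>S\<^esub> a', b) - frag_of (a, b) - frag_of (a', b) | a a' b.
        a \<in> carrier S \<and> a' \<in> carrier S \<and> b \<in> carrier T} \<union>
     {frag_of (a, b \<oplus>\<^bsub>T\<^esub> b') - frag_of (a, b) - frag_of (a, b') | a b b'.
        a \<in> carrier S \<and> b \<in> carrier T \<and> b' \<in> carrier T} \<union>
     {frag_of (\<phi> r \<otimes>\<^bsub>S\<^esub> a, b) - frag_of (a, \<psi> r \<otimes>\<^bsub>T\<^esub> b) | r a b.
        r \<in> carrier R \<and> a \<in> carrier S \<and> b \<in> carrier T}"

text \<open>
  The set of relations is stable under multiplication by the basis elements of the monoid ring,
  so the ideal it generates is the subgroup it generates, and the additive group of the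
  quotient is the usual tensor product of \<open>R\<close>-modules.
\<close>

definition tensor_ideal ::
  "('r, 'k) ring_scheme \<Rightarrow> ('r \<Rightarrow> 'a) \<Rightarrow> ('a, 'm) ring_scheme \<Rightarrow> ('r \<Rightarrow> 'b) \<Rightarrow> ('b, 'n) ring_scheme
    \<Rightarrow> ('a \<times> 'b \<Rightarrow>\<^sub>0 int) set" where
  "tensor_ideal R \<phi> S \<psi> T = Idl\<^bsub>tensor_free S T\<^esub> (tensor_rels R \<phi> S \<psi> T)"

definition tensor_product ::
  "('r, 'k) ring_scheme \<Rightarrow> ('r \<Rightarrow> 'a) \<Rightarrow> ('a, 'm) ring_scheme \<Rightarrow> ('r \<Rightarrow> 'b) \<Rightarrow> ('b, 'n) ring_scheme
    \<Rightarrow> ('a \<times> 'b \<Rightarrow>\<^sub>0 int) set ring" where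
  "tensor_product R \<phi> S \<psi> T = tensor_free S T Quot tensor_ideal R \<phi> S \<psi> T"

definition pure_tensor ::
  "('r, 'k) ring_scheme \<Rightarrow> ('r \<Rightarrow> 'a) \<Rightarrow> ('a, 'm) ring_scheme \<Rightarrow> ('r \<Rightarrow> 'b) \<Rightarrow> ('b, 'n) ring_scheme
    \<Rightarrow> 'a \<Rightarrow> 'b \<Rightarrow> ('a \<times> 'b \<Rightarrow>\<^sub>0 int) set" where
  "pure_tensor R \<phi> S \<psi> T a b = tensor_ideal R \<phi> S \<psi> T +>\<^bsub>tensor_free S T\<^esub> frag_of (a, b)"

definition tensor_struct ::
  "('r, 'k) ring_scheme \<Rightarrow> ('r \<Rightarrow> 'a) \<Rightarrow> ('a, 'm) ring_scheme \<Rightarrow> ('r \<Rightarrow> 'b) \<Rightarrow> ('b, 'n) ring_scheme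
    \<Rightarrow> 'r \<Rightarrow> ('a \<times> 'b \<Rightarrow>\<^sub>0 int) set" where
  "tensor_struct R \<phi> S \<psi> T r = pure_tensor R \<phi> S \<psi> T (\<phi> r) \<one>\<^bsub>T\<^esub>"

text \<open>
  The map \<open>a \<otimes> b \<mapsto> f(a) g(b)\<close> into \<open>U\<close> induced by algebra homomorphisms \<open>f : S \<rightarrow> U\<close> and
  \<open>g : T \<rightarrow> U\<close>.
\<close>

definition tensor_lift ::
  "('c, 'k) ring_scheme \<Rightarrow> ('a \<Rightarrow> 'c) \<Rightarrow> ('b \<Rightarrow> 'c) \<Rightarrow> ('a \<times> 'b \<Rightarrow>\<^sub>0 int) set \<Rightarrow> 'c" where
  "tensor_lift U f g C =
     the_elem ((\<lambda>p. \<Oplus>\<^bsub>U\<^esub>x\<in>Poly_Mapping.keys p.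
                  [Poly_Mapping.lookup p x] \<cdot>\<^bsub>U\<^esub> (f (fst x) \<otimes>\<^bsub>U\<^esub> g (snd x))) ` C)"


section \<open>Finite etale algebras and the trace\<close>

text \<open>
  Coordinates exhibiting \<open>B\<close> as a direct summand of \<open>A\<^sup>n\<close>: the maps
  \<open>A\<^sup>n \<rightarrow> B\<close>, \<open>(a\<^sub>i) \<mapsto> \<Sum> a\<^sub>i e\<^sub>i\<close>, and \<open>B \<rightarrow> A\<^sup>n\<close>, \<open>x \<mapsto> (c\<^sub>i(x))\<close>, are \<open>A\<close>-linear and the first is a left
  inverse of the second.
\<close>

definition dual_basis ::
  "('a, 'm) ring_scheme \<Rightarrow> ('a \<Rightarrow> 'b) \<Rightarrow> ('b, 'n) ring_scheme
    \<Rightarrow> nat \<Rightarrow> (nat \<Rightarrow> 'b) \<Rightarrow> (nat \<Rightarrow> 'b \<Rightarrow> 'a) \<Rightarrow> bool" where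
  "dual_basis A \<phi> B n e c \<longleftrightarrow>
     (\<forall>i<n. e i \<in> carrier B \<and> c i \<in> carrier B \<rightarrow> carrier A \<and>
        (\<forall>x\<in>carrier B. \<forall>y\<in>carrier B. c i (x \<oplus>\<^bsub>B\<^esub> y) = c i x \<oplus>\<^bsub>A\<^esub> c i y) \<and>
        (\<forall>a\<in>carrier A. \<forall>x\<in>carrier B. c i (\<phi> a \<otimes>\<^bsub>B\<^esub> x) = a \<otimes>\<^bsub>A\<^esub> c i x)) \<and>
     (\<forall>x\<in>carrier B. x = (\<Oplus>\<^bsub>B\<^esub>i\<in>{..<n}. \<phi> (c i x) \<otimes>\<^bsub>B\<^esub> e i))"

definition finite_projective ::
  "('a, 'm) ring_scheme \<Rightarrow> ('a \<Rightarrow> 'b) \<Rightarrow> ('b, 'n) ring_scheme \<Rightarrow> bool" where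
  "finite_projective A \<phi> B \<longleftrightarrow> (\<exists>n e c. dual_basis A \<phi> B n e c)"

text \<open>
  The module of Kaehler differentials of \<open>B\<close> over \<open>A\<close> is \<open>I/I\<^sup>2\<close>, where \<open>I\<close> is the kernel of the
  multiplication \<open>B \<otimes>\<^sub>A B \<rightarrow> B\<close>; an algebra is unramified if this module vanishes.
\<close>

definition diagonal_ideal ::
  "('a, 'm) ring_scheme \<Rightarrow> ('a \<Rightarrow> 'b) \<Rightarrow> ('b, 'n) ring_scheme \<Rightarrow> ('b \<times> 'b \<Rightarrow>\<^sub>0 int) set set" where
  "diagonal_ideal A \<phi> B =
     a_kernel (tensor_product A \<phi> B \<phi> B) B (tensor_lift B (\<lambda>x. x) (\<lambda>x. x))"

definition unramified ::
  "('a, 'm) ring_scheme \<Rightarrow> ('a \<Rightarrow> 'b) \<Rightarrow> ('b, 'n) ring_scheme \<Rightarrow> bool" where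
  "unramified A \<phi> B \<longleftrightarrow>
     ideal_prod (tensor_product A \<phi> B \<phi> B) (diagonal_ideal A \<phi> B) (diagonal_ideal A \<phi> B)
       = diagonal_ideal A \<phi> B"

definition finite_etale ::
  "('a, 'm) ring_scheme \<Rightarrow> ('a \<Rightarrow> 'b) \<Rightarrow> ('b, 'n) ring_scheme \<Rightarrow> bool" where
  "finite_etale A \<phi> B \<longleftrightarrow>
     cring A \<and> cring B \<and> \<phi> \<in> ring_hom A B \<and> finite_projective A \<phi> B \<and> unramified A \<phi> B"

text \<open>
  The trace of multiplication by \<open>b\<close> on the finite projective module \<open>B\<close>, i.e. the image of this
  endomorphism under \<open>End(B) \<cong> B\<^sup>* \<otimes> B \<rightarrow> A\<close>; it does not depend on the chosen coordinates.
\<close>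

definition alg_trace ::
  "('a, 'm) ring_scheme \<Rightarrow> ('a \<Rightarrow> 'b) \<Rightarrow> ('b, 'n) ring_scheme \<Rightarrow> 'b \<Rightarrow> 'a" where
  "alg_trace A \<phi> B b =
     (THE a. \<exists>n e c. dual_basis A \<phi> B n e c \<and> a = (\<Oplus>\<^bsub>A\<^esub>i\<in>{..<n}. c i (b \<otimes>\<^bsub>B\<^esub> e i)))"


section \<open>Adic completion and saturation\<close>

text \<open>
  The completion is the limit of the rings \<open>R/t\<^sup>nR\<close>. For cosets \<open>X\<close> of \<open>t\<^sup>n\<^sup>+\<^sup>1R\<close> and \<open>Y\<close> of \<open>t\<^sup>nR\<close>, the
  transition map sends \<open>X\<close> to \<open>Y\<close> iff \<open>X \<subseteq> Y\<close>.
\<close>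

definition adic_quot :: "('a, 'm) ring_scheme \<Rightarrow> 'a \<Rightarrow> nat \<Rightarrow> 'a set ring" where
  "adic_quot R t n = R Quot (PIdl\<^bsub>R\<^esub> (t [^]\<^bsub>R\<^esub> n))"

definition completion :: "('a, 'm) ring_scheme \<Rightarrow> 'a \<Rightarrow> (nat \<Rightarrow> 'a set) ring" where
  "completion R t =
    \<lparr>carrier = {x. \<forall>n. x n \<in> carrier (adic_quot R t n) \<and> x (Suc n) \<subseteq> x n},
     monoid.mult = (\<lambda>x y n. x n \<otimes>\<^bsub>adic_quot R t n\<^esub> y n),
     monoid.one = (\<lambda>n. \<one>\<^bsub>adic_quot R t n\<^esub>),
     ring.zero = (\<lambda>n. \<zero>\<^bsub>adic_quot R t n\<^esub>),
     ring.add = (\<lambda>x y n. x n \<oplus>\<^bsub>adic_quot R t n\<^esub> y n)\<rparr>"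

definition to_completion :: "('a, 'm) ring_scheme \<Rightarrow> 'a \<Rightarrow> 'a \<Rightarrow> nat \<Rightarrow> 'a set" where
  "to_completion R t a = (\<lambda>n. PIdl\<^bsub>R\<^esub> (t [^]\<^bsub>R\<^esub> n) +>\<^bsub>R\<^esub> a)"

text \<open>
  The map from the \<open>t\<close>-adic completion of \<open>R\<close> to the \<open>u\<close>-adic completion of \<open>S\<close> induced by
  \<open>f : R \<rightarrow> S\<close>, where \<open>u = f t\<close>: the coset of \<open>a\<close>
  modulo \<open>t\<^sup>n\<close> is sent to the coset \<open>u\<^sup>nS + f(a + t\<^sup>nR)\<close> of \<open>f a\<close>.
\<close>

definition completion_map ::
  "('b, 'n) ring_scheme \<Rightarrow> 'b \<Rightarrow> ('a \<Rightarrow> 'b) \<Rightarrow> (nat \<Rightarrow> 'a set) \<Rightarrow> nat \<Rightarrow> 'b set" where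
  "completion_map S u f x = (\<lambda>n. PIdl\<^bsub>S\<^esub> (u [^]\<^bsub>S\<^esub> n) <+>\<^bsub>S\<^esub> f ` x n)"

definition zero_saturation :: "('a, 'm) ring_scheme \<Rightarrow> 'a \<Rightarrow> 'a set" where
  "zero_saturation R t =
     {x \<in> carrier R. \<exists>n::nat. t [^]\<^bsub>R\<^esub> n \<otimes>\<^bsub>R\<^esub> x = \<zero>\<^bsub>R\<^esub>}"

end

theory Submission
  imports Defs
begin

text \<open>
  Fix a dual basis \<open>(e\<^sub>j, c\<^sub>j)\<close> of \<open>B\<close> over \<open>A\<close>. The kernel \<open>I\<close> of \<open>B \<otimes>\<^sub>A B \<rightarrow> B\<close> is finitely generated and
  idempotent, so Nakayama gives \<open>s = \<Sum> x\<^sub>i \<otimes> y\<^sub>i\<close> with \<open>s I = 0\<close> and \<open>\<Sum> x\<^sub>i y\<^sub>i = 1\<close>. Applying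
  \<open>x \<otimes> y \<mapsto> c\<^sub>j(x) y\<close> to \<open>(b e\<^sub>j \<otimes> 1) s = (1 \<otimes> b e\<^sub>j) s\<close> and summing over \<open>j\<close> yields
  \<open>b = \<Sum> Tr(b x\<^sub>i) y\<^sub>i\<close>. Clearing denominators, multiplication by some power \<open>t\<^sup>c\<close> on \<open>B\<^sub>0\<close> is a finite
  sum of maps \<open>b \<mapsto> \<lambda>(b) y\<close> with \<open>\<lambda> : B\<^sub>0 \<rightarrow> A\<^sub>0\<close> linear and \<open>y \<in> B\<^sub>0\<close>. Each \<open>\<lambda>\<close> extends to the
  completions, so \<open>x \<mapsto> \<Sum> y \<otimes> \<lambda>(x)\<close> is an additive map \<open>\<Theta>\<close> from the completion of \<open>B\<^sub>0\<close> to the tensor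
  product with both \<open>\<nu> \<circ> \<Theta>\<close> and \<open>\<Theta> \<circ> \<nu>\<close> equal to multiplication by \<open>t\<^sup>c\<close>. Hence the kernel of \<open>\<nu>\<close> is
  killed by \<open>t\<^sup>c\<close>, and it contains all \<open>t\<close>-power torsion because the completion of \<open>B\<^sub>0\<close> is
  \<open>t\<close>-torsion free; \<open>\<nu>\<close> is surjective because every element of that completion is an element of
  \<open>B\<^sub>0\<close> plus a multiple of \<open>t\<^sup>c\<close>.
\<close>

section \<open>Tensor products\<close>

text \<open>The obstacle is that \<open>B\<^sub>0\<close> is not assumed finite over
  \<open>A\<^sub>0\<close>, so nothing general makes its tensor product with the completion of
  \<open>A\<^sub>0\<close> complete, and there is no evident map from the completion of
  \<open>B\<^sub>0\<close> back to it. Such a map is at hand only for an endomorphism that factors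
  through \<open>A\<^sub>0\<close>: a linear functional \<lambda> passes to the completions, and
  tensoring its value with y lands in the tensor product. The trace formula says that the identity
  of B is a finite sum of maps of this shape; the power of t is the price for making them integral.
  In its exponent, l makes the traces integral, and further powers move the x_i and y_i into
  \<open>B\<^sub>0\<close>. Since t is a nonzero divisor, a trace in the image of
  \<open>A\<^sub>0\<close> can be read back as a unique element of \<open>A\<^sub>0\<close>. No
  expression of s as a sum of pure tensors is ever chosen: the maps that lift to completions
  (\<open>extendable\<close>) are closed under addition, so induction over tensors suffices,
  provided that every statement about exponents is made for all large m and thresholds can be
  merged.\<close>

definition tensor_eval :: "('c, 'k) ring_scheme \<Rightarrow> ('x \<Rightarrow> 'c) \<Rightarrow> ('x \<Rightarrow>\<^sub>0 int) \<Rightarrow> 'c" where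
  "tensor_eval U g p = (\<Oplus>\<^bsub>U\<^esub>x\<in>Poly_Mapping.keys p. [Poly_Mapping.lookup p x] \<cdot>\<^bsub>U\<^esub> g x)"

text \<open>Generalizes \<open>tensor_lift\<close> to functions of pairs that are merely additive in
  each argument: the trace argument needs maps out of a tensor product that are not multiplicative.
  One proof of well-definedness then serves both kinds.\<close>

definition tensor_map :: "('c, 'k) ring_scheme \<Rightarrow> ('x \<Rightarrow> 'c) \<Rightarrow> ('x \<Rightarrow>\<^sub>0 int) set \<Rightarrow> 'c" where
  "tensor_map U g C = the_elem (tensor_eval U g ` C)"

lemma tensor_lift_eq_tensor_map:
  "tensor_lift U f g = tensor_map U (\<lambda>x. f (fst x) \<otimes>\<^bsub>U\<^esub> g (snd x))"
  by (simp add: tensor_lift_def tensor_map_def tensor_eval_def fun_eq_iff)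

section \<open>Evaluation of formal integer combinations in an abelian group\<close>

context abelian_group
begin

lemma tensor_eval_closed:
  assumes "g \<in> K \<rightarrow> carrier G" "Poly_Mapping.keys p \<subseteq> K"
  shows "tensor_eval G g p \<in> carrier G"
  unfolding tensor_eval_def using assms by (intro finsum_closed) auto

text \<open>Points outside the support contribute zero multiples. Summing over a common finite
  superset is what allows evaluations with different supports to be added termwise.\<close>

lemma tensor_eval_superset:
  assumes "g \<in> K \<rightarrow> carrier G" "Poly_Mapping.keys p \<subseteq> F" "F \<subseteq> K" "finite F"
  shows "tensor_eval G g p = (\<Oplus>x\<in>F. [Poly_Mapping.lookup p x] \<cdot> g x)"
proof -
  have "add_pow G (0::int) y = \<zero>" for y
    by (simp add: add_pow_def int_pow_def)
  then show ?thesis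
    unfolding tensor_eval_def using assms
    by (intro add.finprod_mono_neutral_cong_left) (auto simp: in_keys_iff)
qed

lemma tensor_eval_zero [simp]: "tensor_eval G g 0 = \<zero>"
  by (simp add: tensor_eval_def)

lemma tensor_eval_frag_of:
  assumes "g x \<in> carrier G"
  shows "tensor_eval G g (frag_of x) = g x"
  using assms by (simp add: tensor_eval_def finsum_singleton)

lemma tensor_eval_add:
  assumes g: "g \<in> K \<rightarrow> carrier G" and "Poly_Mapping.keys p \<subseteq> K" "Poly_Mapping.keys q \<subseteq> K"
  shows "tensor_eval G g (p + q) = tensor_eval G g p \<oplus> tensor_eval G g q"
proof -
  let ?F = "Poly_Mapping.keys p \<union> Poly_Mapping.keys q"
  have F: "finite ?F" "?F \<subseteq> K" using assms by auto
  have "tensor_eval G g (p + q) = (\<Oplus>x\<in>?F. [Poly_Mapping.lookup (p + q) x] \<cdot> g x)"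
    using F g keys_add[of p q] by (intro tensor_eval_superset)
  also have "\<dots> = (\<Oplus>x\<in>?F. [Poly_Mapping.lookup p x] \<cdot> g x \<oplus> [Poly_Mapping.lookup q x] \<cdot> g x)"
    using F g by (intro finsum_cong') (auto simp: lookup_add add.int_pow_mult Pi_iff subset_iff)
  also have "\<dots> = (\<Oplus>x\<in>?F. [Poly_Mapping.lookup p x] \<cdot> g x) \<oplus> (\<Oplus>x\<in>?F. [Poly_Mapping.lookup q x] \<cdot> g x)"
    using F g by (intro finsum_addf) auto
  also have "\<dots> = tensor_eval G g p \<oplus> tensor_eval G g q"
    using tensor_eval_superset[OF g _ F(2,1)] by simp
  finally show ?thesis .
qed

lemma tensor_eval_diff:
  assumes g: "g \<in> K \<rightarrow> carrier G" and "Poly_Mapping.keys p \<subseteq> K" "Poly_Mapping.keys q \<subseteq> K"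
  shows "tensor_eval G g (p - q) = tensor_eval G g p \<ominus> tensor_eval G g q"
proof -
  have k: "Poly_Mapping.keys (p - q) \<subseteq> K"
    using keys_diff[of p q] assms by blast
  have "tensor_eval G g p = tensor_eval G g (p - q) \<oplus> tensor_eval G g q"
    using tensor_eval_add[OF g k assms(3)] by simp
  then show ?thesis
    using tensor_eval_closed[OF g] k assms(2,3) by (simp add: minus_eq a_assoc r_neg)
qed

end

section \<open>The monoid ring underlying the tensor product\<close>

lemma tensor_free_simps:
  "carrier (tensor_free S T) = {p. Poly_Mapping.keys p \<subseteq> carrier S \<times> carrier T}"
  "\<one>\<^bsub>tensor_free S T\<^esub> = frag_of (\<one>\<^bsub>S\<^esub>, \<one>\<^bsub>T\<^esub>)"
  "\<zero>\<^bsub>tensor_free S T\<^esub> = 0"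
  "p \<oplus>\<^bsub>tensor_free S T\<^esub> q = p + q"
  by (simp_all add: tensor_free_def)

lemma tensor_free_mult_frag_of:
  "frag_of (a, b) \<otimes>\<^bsub>tensor_free S T\<^esub> frag_of (c, d) = frag_of (a \<otimes>\<^bsub>S\<^esub> c, b \<otimes>\<^bsub>T\<^esub> d)"
  by (simp add: tensor_free_def)

lemma tensor_free_mult_diff_left:
  "(p - p') \<otimes>\<^bsub>tensor_free S T\<^esub> q = p \<otimes>\<^bsub>tensor_free S T\<^esub> q - p' \<otimes>\<^bsub>tensor_free S T\<^esub> q"
  by (simp add: tensor_free_def frag_extend_diff)

text \<open>Linearity in the function instead of the argument. The product of
  \<open>tensor_free\<close> nests one \<open>frag_extend\<close> inside another, so its right
  factor occurs inside the function of the outer one.\<close>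

lemma frag_extend_diff_fun:
  "frag_extend (\<lambda>x. f x - g x) p = frag_extend f p - frag_extend g p"
  by (simp add: frag_extend_def sum_subtractf[symmetric])
     (metis (no_types, lifting) add_uminus_conv_diff frag_cmul_distrib2 minus_frag_cmul mult_minus1_right frag_cmul_cmul frag_cmul_minus_one)

lemma tensor_free_mult_diff_right:
  "q \<otimes>\<^bsub>tensor_free S T\<^esub> (p - p') = q \<otimes>\<^bsub>tensor_free S T\<^esub> p - q \<otimes>\<^bsub>tensor_free S T\<^esub> p'"
  by (simp add: tensor_free_def frag_extend_diff frag_extend_diff_fun case_prod_beta')

lemma tensor_free_mult_zero:
  "0 \<otimes>\<^bsub>tensor_free S T\<^esub> q = 0"  "q \<otimes>\<^bsub>tensor_free S T\<^esub> 0 = 0"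
  by (simp_all add: tensor_free_def frag_extend_eq_0 case_prod_beta')

lemma tensor_free_mult_closed:
  assumes "monoid S" "monoid T" "p \<in> carrier (tensor_free S T)" "q \<in> carrier (tensor_free S T)"
  shows "p \<otimes>\<^bsub>tensor_free S T\<^esub> q \<in> carrier (tensor_free S T)"
proof -
  interpret S: monoid S + T: monoid T by fact+
  have sub: "Poly_Mapping.keys (u - v) \<subseteq> carrier S \<times> carrier T"
    if "Poly_Mapping.keys u \<subseteq> carrier S \<times> carrier T" "Poly_Mapping.keys v \<subseteq> carrier S \<times> carrier T"
    for u v :: "'a \<times> 'c \<Rightarrow>\<^sub>0 int"
    using that keys_diff[of u v] by blast
  have "Poly_Mapping.keys p \<subseteq> carrier S \<times> carrier T" "Poly_Mapping.keys q \<subseteq> carrier S \<times> carrier T"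
    using assms(3,4) by (auto simp: tensor_free_simps)
  then have "Poly_Mapping.keys (p \<otimes>\<^bsub>tensor_free S T\<^esub> q) \<subseteq> carrier S \<times> carrier T"
  proof (induction p rule: free_Abelian_group_induct[consumes 1])
    case (3 a)
    show ?case using \<open>Poly_Mapping.keys q \<subseteq> _\<close> 3
    proof (induction q rule: free_Abelian_group_induct[consumes 1])
      case (3 b)
      then show ?case by (cases a; cases b) (auto simp: tensor_free_mult_frag_of)
    qed (simp_all add: tensor_free_mult_zero tensor_free_mult_diff_right sub)
  qed (simp_all add: tensor_free_mult_zero tensor_free_mult_diff_left sub)
  then show ?thesis by (simp add: tensor_free_simps)
qed

text \<open>Basis elements generate the group under differences alone, so neither sums nor negatives
  need a case. Any identity that is additive in its arguments is thereby reduced to basis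
  elements.\<close>

lemma tensor_free_induct [consumes 1, case_names zero diff frag]:
  assumes "p \<in> carrier (tensor_free S T)"
    and "P 0"
    and "\<And>p q. \<lbrakk>p \<in> carrier (tensor_free S T); q \<in> carrier (tensor_free S T); P p; P q\<rbrakk> \<Longrightarrow> P (p - q)"
    and "\<And>a b. \<lbrakk>a \<in> carrier S; b \<in> carrier T\<rbrakk> \<Longrightarrow> P (frag_of (a, b))"
  shows "P p"
proof -
  have "Poly_Mapping.keys p \<subseteq> carrier S \<times> carrier T"
    using assms(1) by (simp add: tensor_free_simps)
  then show ?thesis
    by (induction p rule: free_Abelian_group_induct[consumes 1]) (use assms(2-4) in \<open>auto simp: tensor_free_simps\<close>)
qed

text \<open>Commutativity, associativity and the unit law are additive in every argument; nested
  inductions reduce them to basis elements, where they are the laws of S and T. Distributivity is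
  the additivity of \<open>frag_extend\<close>.\<close>

lemma cring_tensor_free:
  assumes "cring S" "cring T"
  shows "cring (tensor_free S T)" (is "cring ?F")
proof -
  interpret S: cring S + T: cring T by fact+
  have closed: "p \<otimes>\<^bsub>?F\<^esub> q \<in> carrier ?F" if "p \<in> carrier ?F" "q \<in> carrier ?F" for p q
    using that by (intro tensor_free_mult_closed) (auto intro: S.monoid_axioms T.monoid_axioms)
  have comm: "p \<otimes>\<^bsub>?F\<^esub> q = q \<otimes>\<^bsub>?F\<^esub> p" if "p \<in> carrier ?F" "q \<in> carrier ?F" for p q
    using that
  proof (induction p rule: tensor_free_induct)
    case (frag a b)
    from frag(3,1,2) show ?case
      by (induction q rule: tensor_free_induct)
         (simp_all add: tensor_free_mult_zero tensor_free_mult_diff_left tensor_free_mult_diff_right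
            tensor_free_mult_frag_of S.m_comm T.m_comm)
  qed (simp_all add: tensor_free_mult_zero tensor_free_mult_diff_left tensor_free_mult_diff_right)
  have assoc: "p \<otimes>\<^bsub>?F\<^esub> q \<otimes>\<^bsub>?F\<^esub> r = p \<otimes>\<^bsub>?F\<^esub> (q \<otimes>\<^bsub>?F\<^esub> r)"
    if "p \<in> carrier ?F" "q \<in> carrier ?F" "r \<in> carrier ?F" for p q r
    using that
  proof (induction p rule: tensor_free_induct)
    case (frag a b)
    from frag(3,4,1,2) show ?case
    proof (induction q rule: tensor_free_induct)
      case (frag c d)
      from frag(3,1,2,4,5) show ?case
        by (induction r rule: tensor_free_induct)
           (simp_all add: tensor_free_mult_zero tensor_free_mult_diff_left tensor_free_mult_diff_right
              tensor_free_mult_frag_of S.m_assoc T.m_assoc)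
    qed (simp_all add: tensor_free_mult_zero tensor_free_mult_diff_left tensor_free_mult_diff_right)
  qed (simp_all add: tensor_free_mult_zero tensor_free_mult_diff_left tensor_free_mult_diff_right)
  have one: "\<one>\<^bsub>?F\<^esub> \<otimes>\<^bsub>?F\<^esub> p = p" if "p \<in> carrier ?F" for p
    using that
    by (induction p rule: tensor_free_induct)
       (simp_all add: tensor_free_mult_zero tensor_free_mult_diff_right tensor_free_simps(2) tensor_free_mult_frag_of)
  have distr: "(p \<oplus>\<^bsub>?F\<^esub> q) \<otimes>\<^bsub>?F\<^esub> r = p \<otimes>\<^bsub>?F\<^esub> r \<oplus>\<^bsub>?F\<^esub> q \<otimes>\<^bsub>?F\<^esub> r" for p q r
    by (simp add: tensor_free_def frag_extend_add)
  show ?thesis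
  proof (rule cringI)
    show "abelian_group ?F"
    proof (rule abelian_groupI)
      show "\<exists>y\<in>carrier ?F. y \<oplus>\<^bsub>?F\<^esub> p = \<zero>\<^bsub>?F\<^esub>" if "p \<in> carrier ?F" for p
        using that by (intro bexI[of _ "-p"]) (auto simp: tensor_free_simps)
      show "p \<oplus>\<^bsub>?F\<^esub> q \<in> carrier ?F" if "p \<in> carrier ?F" "q \<in> carrier ?F" for p q
        using that keys_add[of p q] by (auto simp: tensor_free_simps)
    qed (auto simp: tensor_free_simps)
    show "comm_monoid ?F"
      by (rule comm_monoidI) (use closed comm assoc one in \<open>auto simp: tensor_free_simps(1,2)\<close>)
  qed (use distr in auto)
qed

section \<open>The tensor product as a quotient, and its universal property\<close>

locale tensor_pair = S: cring S + T: cring T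
  for R :: "('r, 'k) ring_scheme" and \<phi> and S :: "('a, 'm) ring_scheme"
    and \<psi> and T :: "('b, 'n) ring_scheme" +
  assumes \<phi>_closed: "\<phi> \<in> carrier R \<rightarrow> carrier S"
    and \<psi>_closed: "\<psi> \<in> carrier R \<rightarrow> carrier T"
begin

abbreviation "F \<equiv> tensor_free S T"
abbreviation "J \<equiv> tensor_ideal R \<phi> S \<psi> T"
abbreviation "ST \<equiv> tensor_product R \<phi> S \<psi> T"
abbreviation "pt \<equiv> pure_tensor R \<phi> S \<psi> T"

sublocale F: cring F
  by (rule cring_tensor_free) (rule S.is_cring T.is_cring)+

lemma frag_of_closed: "a \<in> carrier S \<Longrightarrow> b \<in> carrier T \<Longrightarrow> frag_of (a, b) \<in> carrier F"
  by (simp add: tensor_free_simps)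

lemma F_minus: "p \<in> carrier F \<Longrightarrow> q \<in> carrier F \<Longrightarrow> p \<ominus>\<^bsub>F\<^esub> q = p - q"
proof -
  assume p: "p \<in> carrier F" and q: "q \<in> carrier F"
  have "p - q \<in> carrier F"
    using p q keys_diff[of p q] by (auto simp: tensor_free_simps)
  moreover have "p = (p - q) \<oplus>\<^bsub>F\<^esub> q" by (simp add: tensor_free_simps)
  ultimately show ?thesis
    using p q F.r_neg by (metis F.a_assoc F.minus_eq F.r_zero F.a_inv_closed)
qed

lemma F_diff_closed: "p \<in> carrier F \<Longrightarrow> q \<in> carrier F \<Longrightarrow> p - q \<in> carrier F"
  using F_minus F.minus_closed by metis

lemma F_eval_closed:
  assumes "abelian_group U" "g \<in> carrier S \<times> carrier T \<rightarrow> carrier U" "p \<in> carrier F"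
  shows "tensor_eval U g p \<in> carrier U"
  using abelian_group.tensor_eval_closed[OF assms(1,2)] assms(3) by (simp add: tensor_free_simps)

lemma F_eval_diff:
  assumes "abelian_group U" "g \<in> carrier S \<times> carrier T \<rightarrow> carrier U" "p \<in> carrier F" "q \<in> carrier F"
  shows "tensor_eval U g (p - q) = tensor_eval U g p \<ominus>\<^bsub>U\<^esub> tensor_eval U g q"
  using abelian_group.tensor_eval_diff[OF assms(1,2)] assms(3,4) by (simp add: tensor_free_simps)

lemma F_eval_add:
  assumes "abelian_group U" "g \<in> carrier S \<times> carrier T \<rightarrow> carrier U" "p \<in> carrier F" "q \<in> carrier F"
  shows "tensor_eval U g (p \<oplus>\<^bsub>F\<^esub> q) = tensor_eval U g p \<oplus>\<^bsub>U\<^esub> tensor_eval U g q"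
  using abelian_group.tensor_eval_add[OF assms(1,2)] assms(3,4) by (simp add: tensor_free_simps)

lemma F_eval_frag:
  assumes "abelian_group U" "g \<in> carrier S \<times> carrier T \<rightarrow> carrier U" "a \<in> carrier S" "b \<in> carrier T"
  shows "tensor_eval U g (frag_of (a, b)) = g (a, b)"
  using abelian_group.tensor_eval_frag_of[OF assms(1), of g "(a, b)"] assms(2,3,4) by auto

text \<open>Bilinearity phrased without an R-module structure on U: scalars are only required to
  move from one argument to the other. The three clauses mirror the three families in
  \<open>tensor_rels\<close>.\<close>

definition balanced :: "('c, 'l) ring_scheme \<Rightarrow> ('a \<times> 'b \<Rightarrow> 'c) \<Rightarrow> bool" where
  "balanced U g \<longleftrightarrow> g \<in> carrier S \<times> carrier T \<rightarrow> carrier U \<and>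
     (\<forall>a\<in>carrier S. \<forall>a'\<in>carrier S. \<forall>b\<in>carrier T. g (a \<oplus>\<^bsub>S\<^esub> a', b) = g (a, b) \<oplus>\<^bsub>U\<^esub> g (a', b)) \<and>
     (\<forall>a\<in>carrier S. \<forall>b\<in>carrier T. \<forall>b'\<in>carrier T. g (a, b \<oplus>\<^bsub>T\<^esub> b') = g (a, b) \<oplus>\<^bsub>U\<^esub> g (a, b')) \<and>
     (\<forall>r\<in>carrier R. \<forall>a\<in>carrier S. \<forall>b\<in>carrier T. g (\<phi> r \<otimes>\<^bsub>S\<^esub> a, b) = g (a, \<psi> r \<otimes>\<^bsub>T\<^esub> b))"

lemma balancedD:
  assumes "balanced U g"
  shows "g \<in> carrier S \<times> carrier T \<rightarrow> carrier U"
  using assms by (auto simp: balanced_def)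

lemma balanced_translate:
  assumes "balanced U g" "c \<in> carrier S" "d \<in> carrier T"
  shows "balanced U (\<lambda>(a, b). g (c \<otimes>\<^bsub>S\<^esub> a, d \<otimes>\<^bsub>T\<^esub> b))"
proof -
  have r: "\<phi> r \<in> carrier S" "\<psi> r \<in> carrier T" if "r \<in> carrier R" for r
    using that \<phi>_closed \<psi>_closed by auto
  show ?thesis
    using assms(1) assms(2,3) unfolding balanced_def
    by (auto simp: Pi_iff S.r_distr T.r_distr r S.m_lcomm[of c] T.m_lcomm[of d])
qed

text \<open>Trades multiplication by a basis element for a change of the evaluated function, which
  is how additive evaluations can be controlled on an ideal instead of just a subgroup.\<close>

lemma tensor_eval_translate:
  assumes U: "abelian_group U" and g: "g \<in> carrier S \<times> carrier T \<rightarrow> carrier U"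
    and cd: "c \<in> carrier S" "d \<in> carrier T" and p: "p \<in> carrier F"
  shows "tensor_eval U g (frag_of (c, d) \<otimes>\<^bsub>F\<^esub> p) =
    tensor_eval U (\<lambda>(a, b). g (c \<otimes>\<^bsub>S\<^esub> a, d \<otimes>\<^bsub>T\<^esub> b)) p"
proof -
  interpret U: abelian_group U by fact
  have g': "(\<lambda>(a, b). g (c \<otimes>\<^bsub>S\<^esub> a, d \<otimes>\<^bsub>T\<^esub> b)) \<in> carrier S \<times> carrier T \<rightarrow> carrier U"
    using g cd by auto
  show ?thesis using p
  proof (induction p rule: tensor_free_induct)
    case (diff p q)
    then show ?case
      using frag_of_closed[OF cd]
      by (simp add: tensor_free_mult_diff_right F_eval_diff[OF U g] F_eval_diff[OF U g'])
  next
    case (frag a b)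
    then show ?case using cd
      by (simp add: tensor_free_mult_frag_of F_eval_frag[OF U g] F_eval_frag[OF U g'])
  qed (simp_all add: tensor_free_mult_zero)
qed

lemma tensor_rels_closed: "tensor_rels R \<phi> S \<psi> T \<subseteq> carrier F"
  using \<phi>_closed \<psi>_closed unfolding tensor_rels_def
  by (auto intro!: F_diff_closed frag_of_closed)

lemma ideal_J: "ideal J F"
  unfolding tensor_ideal_def by (intro F.genideal_ideal tensor_rels_closed)

sublocale J: ideal J F by (rule ideal_J)

lemma tensor_eval_rels:
  assumes U: "abelian_group U" and b: "balanced U g" and p: "p \<in> tensor_rels R \<phi> S \<psi> T"
  shows "tensor_eval U g p = \<zero>\<^bsub>U\<^esub>"
proof -
  interpret U: abelian_group U by fact
  note g = balancedD[OF b]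
  have gc: "g (a, b) \<in> carrier U" if "a \<in> carrier S" "b \<in> carrier T" for a b
    using g that by auto
  have r: "\<phi> r \<in> carrier S" "\<psi> r \<in> carrier T" if "r \<in> carrier R" for r
    using that \<phi>_closed \<psi>_closed by auto
  have cancel: "x \<oplus>\<^bsub>U\<^esub> y \<ominus>\<^bsub>U\<^esub> x \<ominus>\<^bsub>U\<^esub> y = \<zero>\<^bsub>U\<^esub>" if "x \<in> carrier U" "y \<in> carrier U" for x y
    using that by (metis U.a_comm U.minus_eq U.add.inv_closed U.add.m_assoc U.r_neg U.r_zero)
  have cancel': "x \<ominus>\<^bsub>U\<^esub> x = \<zero>\<^bsub>U\<^esub>" if "x \<in> carrier U" for x
    using that by (simp add: U.minus_eq U.r_neg)
  from p show ?thesis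
    using b unfolding tensor_rels_def balanced_def
    by (auto simp: F_eval_diff[OF U g] F_eval_frag[OF U g] frag_of_closed F_diff_closed r gc cancel cancel')
qed

text \<open>
  The elements of the monoid ring that are killed by all balanced maps form an ideal, because
  translates of balanced maps are balanced.
\<close>

lemma tensor_eval_J:
  assumes U: "abelian_group U" and b: "balanced U g" and p: "p \<in> J"
  shows "tensor_eval U g p = \<zero>\<^bsub>U\<^esub>"
proof -
  interpret U: abelian_group U by fact
  \<comment> \<open>The zeros of the given g alone would not be stable under multiplication, because
    a product with a basis element replaces g by a translate. Quantifying over all balanced maps
    repairs this.\<close>
  define N where "N = {p \<in> carrier F. \<forall>g. balanced U g \<longrightarrow> tensor_eval U g p = \<zero>\<^bsub>U\<^esub>}"
  have Nmult: "q \<otimes>\<^bsub>F\<^esub> p \<in> N" if p: "p \<in> N" and q: "q \<in> carrier F" for p q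
  proof -
    have pc: "p \<in> carrier F" using p by (simp add: N_def)
    have "tensor_eval U g (q \<otimes>\<^bsub>F\<^esub> p) = \<zero>\<^bsub>U\<^esub>" if b: "balanced U g" for g
      using q
    proof (induction q rule: tensor_free_induct)
      case (diff q q')
      then show ?case using pc
        by (simp add: tensor_free_mult_diff_left F_eval_diff[OF U balancedD[OF b]] U.minus_eq U.r_neg)
    next
      case (frag c d)
      then have "balanced U (\<lambda>(a, b). g (c \<otimes>\<^bsub>S\<^esub> a, d \<otimes>\<^bsub>T\<^esub> b))"
        by (intro balanced_translate b)
      then show ?case
        using p frag by (simp add: tensor_eval_translate[OF U balancedD[OF b]] N_def)
    qed (simp add: tensor_free_mult_zero)
    then show ?thesis using pc q by (simp add: N_def)
  qed
  have "ideal N F"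
  proof (rule idealI)
    show "ring F" by (rule F.ring_axioms)
    show "subgroup N (add_monoid F)"
    proof (rule F.add.subgroupI)
      show "N \<subseteq> carrier F" by (auto simp: N_def)
      have "0 \<in> N"
        by (auto simp: N_def tensor_free_simps)
      then show "N \<noteq> {}" by auto
      show "\<ominus>\<^bsub>F\<^esub> a \<in> N" if "a \<in> N" for a
        using Nmult[OF that, of "\<ominus>\<^bsub>F\<^esub> \<one>\<^bsub>F\<^esub>"] that
        by (simp add: N_def F.l_minus)
      show "a \<oplus>\<^bsub>F\<^esub> b \<in> N" if "a \<in> N" "b \<in> N" for a b
        using that by (auto simp: N_def F_eval_add[OF U balancedD])
    qed
    fix a x assume *: "a \<in> N" "x \<in> carrier F"
    show "x \<otimes>\<^bsub>F\<^esub> a \<in> N" by (rule Nmult[OF *])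
    then show "a \<otimes>\<^bsub>F\<^esub> x \<in> N" using * F.m_comm by (auto simp: N_def)
  qed
  moreover have "tensor_rels R \<phi> S \<psi> T \<subseteq> N"
    using tensor_rels_closed tensor_eval_rels[OF U] by (auto simp: N_def)
  ultimately have "J \<subseteq> N"
    unfolding tensor_ideal_def by (rule F.genideal_minimal)
  then show ?thesis using p b by (auto simp: N_def)
qed

sublocale ST: cring ST
  unfolding tensor_product_def by (rule J.quotient_is_cring) (rule F.is_cring)

lemma coset_hom: "(\<lambda>p. J +>\<^bsub>F\<^esub> p) \<in> ring_hom F ST"
  unfolding tensor_product_def by (rule J.rcos_ring_hom)

lemma pt_eq: "pt a b = J +>\<^bsub>F\<^esub> frag_of (a, b)"
  by (simp add: pure_tensor_def)

lemma pt_closed [simp]: "a \<in> carrier S \<Longrightarrow> b \<in> carrier T \<Longrightarrow> pt a b \<in> carrier ST"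
  using ring_hom_closed[OF coset_hom] frag_of_closed by (auto simp: pt_eq)

lemma coset_eqI:
  assumes "p \<in> carrier F" "q \<in> carrier F" "p - q \<in> J"
  shows "J +>\<^bsub>F\<^esub> p = J +>\<^bsub>F\<^esub> q"
  using F.quotient_eq_iff_same_a_r_cos[OF ideal_J assms(1,2)] assms F_minus by simp

lemma rels_in_J: "tensor_rels R \<phi> S \<psi> T \<subseteq> J"
  unfolding tensor_ideal_def by (intro F.genideal_self tensor_rels_closed)

lemma pt_add_left:
  assumes "a \<in> carrier S" "a' \<in> carrier S" "b \<in> carrier T"
  shows "pt (a \<oplus>\<^bsub>S\<^esub> a') b = pt a b \<oplus>\<^bsub>ST\<^esub> pt a' b"
proof -
  have "frag_of (a \<oplus>\<^bsub>S\<^esub> a', b) - (frag_of (a, b) \<oplus>\<^bsub>F\<^esub> frag_of (a', b)) \<in> J"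
    using assms rels_in_J by (auto simp: tensor_rels_def tensor_free_simps diff_diff_eq[symmetric] subset_iff)
  then have "pt (a \<oplus>\<^bsub>S\<^esub> a') b = J +>\<^bsub>F\<^esub> (frag_of (a, b) \<oplus>\<^bsub>F\<^esub> frag_of (a', b))"
    unfolding pt_eq using assms by (intro coset_eqI F.a_closed frag_of_closed) auto
  then show ?thesis
    using assms ring_hom_add[OF coset_hom] by (simp add: pt_eq frag_of_closed)
qed

lemma pt_add_right:
  assumes "a \<in> carrier S" "b \<in> carrier T" "b' \<in> carrier T"
  shows "pt a (b \<oplus>\<^bsub>T\<^esub> b') = pt a b \<oplus>\<^bsub>ST\<^esub> pt a b'"
proof -
  have "frag_of (a, b \<oplus>\<^bsub>T\<^esub> b') - (frag_of (a, b) \<oplus>\<^bsub>F\<^esub> frag_of (a, b')) \<in> J"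
    using assms rels_in_J by (auto simp: tensor_rels_def tensor_free_simps diff_diff_eq[symmetric] subset_iff)
  then have "pt a (b \<oplus>\<^bsub>T\<^esub> b') = J +>\<^bsub>F\<^esub> (frag_of (a, b) \<oplus>\<^bsub>F\<^esub> frag_of (a, b'))"
    unfolding pt_eq using assms by (intro coset_eqI F.a_closed frag_of_closed) auto
  then show ?thesis
    using assms ring_hom_add[OF coset_hom] by (simp add: pt_eq frag_of_closed)
qed

lemma pt_balance:
  assumes "r \<in> carrier R" "a \<in> carrier S" "b \<in> carrier T"
  shows "pt (\<phi> r \<otimes>\<^bsub>S\<^esub> a) b = pt a (\<psi> r \<otimes>\<^bsub>T\<^esub> b)"
proof -
  have "\<phi> r \<in> carrier S" "\<psi> r \<in> carrier T"
    using assms \<phi>_closed \<psi>_closed by auto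
  moreover have "frag_of (\<phi> r \<otimes>\<^bsub>S\<^esub> a, b) - frag_of (a, \<psi> r \<otimes>\<^bsub>T\<^esub> b) \<in> J"
    using assms rels_in_J by (auto simp: tensor_rels_def subset_iff)
  ultimately show ?thesis
    unfolding pt_eq using assms by (intro coset_eqI frag_of_closed) auto
qed

lemma pt_mult:
  assumes "a \<in> carrier S" "b \<in> carrier T" "c \<in> carrier S" "d \<in> carrier T"
  shows "pt a b \<otimes>\<^bsub>ST\<^esub> pt c d = pt (a \<otimes>\<^bsub>S\<^esub> c) (b \<otimes>\<^bsub>T\<^esub> d)"
  using ring_hom_mult[OF coset_hom frag_of_closed[OF assms(1,2)] frag_of_closed[OF assms(3,4)]]
  by (simp add: pt_eq tensor_free_mult_frag_of)

lemma pt_one: "\<one>\<^bsub>ST\<^esub> = pt \<one>\<^bsub>S\<^esub> \<one>\<^bsub>T\<^esub>"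
  using ring_hom_one[OF coset_hom] by (simp add: pt_eq tensor_free_simps)

lemma pt_zero_right: "a \<in> carrier S \<Longrightarrow> pt a \<zero>\<^bsub>T\<^esub> = \<zero>\<^bsub>ST\<^esub>"
  using pt_add_right[of a "\<zero>\<^bsub>T\<^esub>" "\<zero>\<^bsub>T\<^esub>"] by simp

lemma pt_zero_left: "b \<in> carrier T \<Longrightarrow> pt \<zero>\<^bsub>S\<^esub> b = \<zero>\<^bsub>ST\<^esub>"
  using pt_add_left[of "\<zero>\<^bsub>S\<^esub>" "\<zero>\<^bsub>S\<^esub>" b] by simp

lemma ST_elem:
  assumes "x \<in> carrier ST"
  obtains p where "p \<in> carrier F" "x = J +>\<^bsub>F\<^esub> p"
  using assms by (auto simp: tensor_product_def FactRing_def A_RCOSETS_def')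

text \<open>Zero and negatives need no case of their own: zero is the pure tensor of zeros, and a
  sign can be absorbed into the first factor, so every element is a sum of pure tensors.\<close>

lemma tensor_induct [consumes 1, case_names pure add]:
  assumes x: "x \<in> carrier ST"
    and pure: "\<And>a b. \<lbrakk>a \<in> carrier S; b \<in> carrier T\<rbrakk> \<Longrightarrow> P (pt a b)"
    and add: "\<And>x y. \<lbrakk>x \<in> carrier ST; y \<in> carrier ST; P x; P y\<rbrakk> \<Longrightarrow> P (x \<oplus>\<^bsub>ST\<^esub> y)"
  shows "P x"
proof -
  obtain p where p: "p \<in> carrier F" and xp: "x = J +>\<^bsub>F\<^esub> p"
    using x by (rule ST_elem)
  \<comment> \<open>The induction on the monoid ring has a difference case, while P is only known to
    respect sums. Carrying -p along allows p - q to be read as p + (-q).\<close>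
  have neg: "P (J +>\<^bsub>F\<^esub> p) \<and> P (J +>\<^bsub>F\<^esub> (- p))"
    using p
  proof (induction p rule: tensor_free_induct)
    case zero
    have "P (pt \<zero>\<^bsub>S\<^esub> \<zero>\<^bsub>T\<^esub>)" by (intro pure) auto
    moreover have "pt \<zero>\<^bsub>S\<^esub> \<zero>\<^bsub>T\<^esub> = J +>\<^bsub>F\<^esub> 0"
      using pt_zero_left[of "\<zero>\<^bsub>T\<^esub>"] F.a_rcos_zero[OF ideal_J J.zero_closed]
      by (simp add: tensor_product_def FactRing_def tensor_free_simps)
    ultimately show ?case by simp
  next
    case (diff p q)
    have m: "- q \<in> carrier F" "- p \<in> carrier F" using diff by (auto simp: tensor_free_simps)
    have "J +>\<^bsub>F\<^esub> (p - q) = (J +>\<^bsub>F\<^esub> p) \<oplus>\<^bsub>ST\<^esub> (J +>\<^bsub>F\<^esub> (- q))"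
      using ring_hom_add[OF coset_hom diff(1) m(1)] by (simp add: tensor_free_simps)
    moreover have "J +>\<^bsub>F\<^esub> (- (p - q)) = (J +>\<^bsub>F\<^esub> q) \<oplus>\<^bsub>ST\<^esub> (J +>\<^bsub>F\<^esub> (- p))"
      using ring_hom_add[OF coset_hom diff(2) m(2)] by (simp add: tensor_free_simps)
    ultimately show ?case
      using diff m by (auto intro!: add intro: ring_hom_closed[OF coset_hom])
  next
    case (frag a b)
    have "frag_of (\<ominus>\<^bsub>S\<^esub> a, b) + frag_of (a, b) \<in> J"
    proof -
      have "J +>\<^bsub>F\<^esub> (frag_of (\<ominus>\<^bsub>S\<^esub> a, b) \<oplus>\<^bsub>F\<^esub> frag_of (a, b)) = pt (\<ominus>\<^bsub>S\<^esub> a) b \<oplus>\<^bsub>ST\<^esub> pt a b"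
        using frag ring_hom_add[OF coset_hom] by (simp add: pt_eq frag_of_closed)
      also have "\<dots> = \<zero>\<^bsub>ST\<^esub>"
        using frag pt_add_left[of "\<ominus>\<^bsub>S\<^esub> a" a b] by (simp add: S.l_neg pt_zero_left)
      also have "\<dots> = J" by (simp add: tensor_product_def FactRing_def)
      finally have "frag_of (\<ominus>\<^bsub>S\<^esub> a, b) \<oplus>\<^bsub>F\<^esub> frag_of (a, b) \<in> J"
        using frag by (intro J.rcos_const_imp_mem F.a_closed frag_of_closed) auto
      then show ?thesis by (simp add: tensor_free_simps)
    qed
    then have "J +>\<^bsub>F\<^esub> frag_of (\<ominus>\<^bsub>S\<^esub> a, b) = J +>\<^bsub>F\<^esub> (- frag_of (a, b))"
      using frag by (intro coset_eqI) (auto simp: tensor_free_simps)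
    then show ?case
      using pure[OF frag] pure[of "\<ominus>\<^bsub>S\<^esub> a" b] frag by (simp add: pt_eq)
  qed
  then show ?thesis using xp by simp
qed

text \<open>Two representatives differ by an element of J, on which \<open>tensor_eval_J\<close>
  gives zero; the image of a coset is therefore a singleton, as \<open>the_elem\<close>
  requires.\<close>

lemma tensor_map_coset:
  assumes U: "abelian_group U" and b: "balanced U g" and p: "p \<in> carrier F"
  shows "tensor_map U g (J +>\<^bsub>F\<^esub> p) = tensor_eval U g p"
proof -
  interpret U: abelian_group U by fact
  have "tensor_eval U g q = tensor_eval U g p" if q: "q \<in> J +>\<^bsub>F\<^esub> p" for q
  proof -
    obtain j where j: "j \<in> J" "q = j \<oplus>\<^bsub>F\<^esub> p"
      using q by (auto simp: a_r_coset_def r_coset_def)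
    then show ?thesis
      using p tensor_eval_J[OF U b j(1)] F_eval_closed[OF U balancedD[OF b] p]
      by (simp add: F_eval_add[OF U balancedD[OF b]] J.a_Hcarr)
  qed
  moreover have "p \<in> J +>\<^bsub>F\<^esub> p" using p by (rule J.a_rcos_self)
  ultimately have "tensor_eval U g ` (J +>\<^bsub>F\<^esub> p) = {tensor_eval U g p}" by blast
  then show ?thesis by (simp add: tensor_map_def)
qed

lemma tensor_map_pt:
  assumes U: "abelian_group U" and b: "balanced U g" and "a \<in> carrier S" "b \<in> carrier T"
  shows "tensor_map U g (pt a b) = g (a, b)"
  unfolding pt_eq using assms frag_of_closed
  by (simp add: tensor_map_coset[OF U b] F_eval_frag[OF U balancedD[OF b]])

lemma tensor_map_closed:
  assumes U: "abelian_group U" and b: "balanced U g" and "x \<in> carrier ST"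
  shows "tensor_map U g x \<in> carrier U"
  using assms(3) by (elim ST_elem) (simp add: tensor_map_coset[OF U b] F_eval_closed[OF U balancedD[OF b]])

lemma tensor_map_add:
  assumes U: "abelian_group U" and b: "balanced U g" and "x \<in> carrier ST" "y \<in> carrier ST"
  shows "tensor_map U g (x \<oplus>\<^bsub>ST\<^esub> y) = tensor_map U g x \<oplus>\<^bsub>U\<^esub> tensor_map U g y"
proof -
  obtain p where p: "p \<in> carrier F" "x = J +>\<^bsub>F\<^esub> p"
    using assms(3) by (rule ST_elem)
  obtain q where q: "q \<in> carrier F" "y = J +>\<^bsub>F\<^esub> q"
    using assms(4) by (rule ST_elem)
  show ?thesis
    using p q ring_hom_add[OF coset_hom p(1) q(1), symmetric]
    by (simp add: tensor_map_coset[OF U b] F_eval_add[OF U balancedD[OF b]])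
qed

text \<open>Agreement of f and g on R is what makes f(a) g(b) balanced. Both sides of the product
  rule are additive in each factor, so it need only be checked on pure tensors.\<close>

lemma tensor_lift:
  assumes U: "cring U" and f: "f \<in> ring_hom S U" and g: "g \<in> ring_hom T U"
    and fg: "\<And>r. r \<in> carrier R \<Longrightarrow> f (\<phi> r) = g (\<psi> r)"
  shows tensor_lift_hom: "tensor_lift U f g \<in> ring_hom ST U"
    and tensor_lift_pt: "\<And>a b. \<lbrakk>a \<in> carrier S; b \<in> carrier T\<rbrakk> \<Longrightarrow> tensor_lift U f g (pt a b) = f a \<otimes>\<^bsub>U\<^esub> g b"
proof -
  interpret U: cring U by fact
  let ?g = "\<lambda>x. f (fst x) \<otimes>\<^bsub>U\<^esub> g (snd x)"
  have c: "f a \<in> carrier U" "g b \<in> carrier U" if "a \<in> carrier S" "b \<in> carrier T" for a b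
    using that f g by (auto intro: ring_hom_closed)
  have c': "f a \<in> carrier U" if "a \<in> carrier S" for a
    using that f by (auto intro: ring_hom_closed)
  have r: "\<phi> r \<in> carrier S" "\<psi> r \<in> carrier T" if "r \<in> carrier R" for r
    using that \<phi>_closed \<psi>_closed by auto
  have b: "balanced U ?g"
    using c c' unfolding balanced_def
    by (auto simp: ring_hom_add[OF f] ring_hom_add[OF g] ring_hom_mult[OF f] ring_hom_mult[OF g]
      U.l_distr U.r_distr r fg U.m_ac)
  note U' = U.abelian_group_axioms
  show pt: "tensor_lift U f g (pt a b) = f a \<otimes>\<^bsub>U\<^esub> g b" if "a \<in> carrier S" "b \<in> carrier T" for a b
    using tensor_map_pt[OF U' b that] by (simp add: tensor_lift_eq_tensor_map)
  have cl: "tensor_lift U f g x \<in> carrier U" if "x \<in> carrier ST" for x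
    using tensor_map_closed[OF U' b that] by (simp add: tensor_lift_eq_tensor_map)
  have ladd: "tensor_lift U f g (x \<oplus>\<^bsub>ST\<^esub> y) = tensor_lift U f g x \<oplus>\<^bsub>U\<^esub> tensor_lift U f g y"
    if "x \<in> carrier ST" "y \<in> carrier ST" for x y
    using tensor_map_add[OF U' b that] by (simp add: tensor_lift_eq_tensor_map)
  show "tensor_lift U f g \<in> ring_hom ST U"
  proof (rule ring_hom_memI)
    show "tensor_lift U f g (x \<otimes>\<^bsub>ST\<^esub> y) = tensor_lift U f g x \<otimes>\<^bsub>U\<^esub> tensor_lift U f g y"
      if "x \<in> carrier ST" "y \<in> carrier ST" for x y
      using that
    proof (induction x rule: tensor_induct)
      case (pure a b)
      from pure(3,1,2) show ?case
      proof (induction y rule: tensor_induct)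
        case (pure c d)
        then show ?case
          using c[of a b] c[of c d]
          by (simp add: pt_mult pt ring_hom_mult[OF f] ring_hom_mult[OF g] U.m_ac)
      next
        case (add y y')
        then show ?case by (simp add: ST.r_distr ladd cl U.r_distr)
      qed
    next
      case (add x x')
      then show ?case by (simp add: ST.l_distr ladd cl U.l_distr)
    qed
    show "tensor_lift U f g \<one>\<^bsub>ST\<^esub> = \<one>\<^bsub>U\<^esub>"
      by (simp add: pt_one pt ring_hom_one[OF f] ring_hom_one[OF g])
  qed (use cl ladd in auto)
qed

end

section \<open>Localizations\<close>

text \<open>The operations of \<open>localization\<close> are unions over all pairs of
  representatives. Once the result does not depend on the pair, the union collapses to that one
  class.\<close>

lemma UN_pairs_const:
  assumes "C \<noteq> {}" "D \<noteq> {}"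
    and "\<And>r m s n. (r, m) \<in> C \<Longrightarrow> (s, n) \<in> D \<Longrightarrow> h r m s n = Y"
  shows "(\<Union>(r, m)\<in>C. \<Union>(s, n)\<in>D. h r m s n) = Y"
proof -
  have "(\<Union>(r, m)\<in>C. \<Union>(s, n)\<in>D. h r m s n) = (\<Union>p\<in>C. \<Union>q\<in>D. Y)"
    using assms(3) by (intro SUP_cong) auto
  then show ?thesis using assms(1,2) by simp
qed

locale cring_elem = cring +
  fixes t
  assumes t_closed [simp]: "t \<in> carrier R"
begin

abbreviation "fr \<equiv> loc_frac R t"
abbreviation "L \<equiv> localization R t"

lemma pow_add: "t [^] (m + n :: nat) = t [^] m \<otimes> t [^] n"
  by (simp add: nat_pow_mult)

lemma mem_frac_iff:
  "r \<in> carrier R \<Longrightarrow> (s, n) \<in> fr r m \<longleftrightarrow>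
    s \<in> carrier R \<and> (\<exists>k::nat. t [^] k \<otimes> (t [^] n \<otimes> r) = t [^] k \<otimes> (t [^] m \<otimes> s))"
  by (auto simp: loc_frac_def loc_rel_def)

lemma mem_frac_self: "r \<in> carrier R \<Longrightarrow> (r, m) \<in> fr r m"
  by (simp add: mem_frac_iff)

text \<open>Transitivity of equality of fractions. The exponent collects both witnesses k and j and
  also the middle denominator n, which cannot be cancelled when s is eliminated.\<close>

lemma loc_rel_trans:
  fixes k j m n p :: nat
  assumes "r \<in> carrier R" "s \<in> carrier R" "q \<in> carrier R"
    and rs: "t [^] k \<otimes> (t [^] n \<otimes> r) = t [^] k \<otimes> (t [^] m \<otimes> s)"
    and sq: "t [^] j \<otimes> (t [^] p \<otimes> s) = t [^] j \<otimes> (t [^] n \<otimes> q)"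
  shows "t [^] (k + j + n) \<otimes> (t [^] p \<otimes> r) = t [^] (k + j + n) \<otimes> (t [^] m \<otimes> q)"
proof -
  have "t [^] (k + j + n) \<otimes> (t [^] p \<otimes> r) = t [^] j \<otimes> (t [^] p \<otimes> (t [^] k \<otimes> (t [^] n \<otimes> r)))"
    using assms(1-3) by (simp add: pow_add m_ac)
  also have "\<dots> = t [^] k \<otimes> (t [^] m \<otimes> (t [^] j \<otimes> (t [^] p \<otimes> s)))"
    unfolding rs using assms(1-3) by (simp add: m_ac)
  also have "\<dots> = t [^] (k + j + n) \<otimes> (t [^] m \<otimes> q)"
    unfolding sq using assms(1-3) by (simp add: pow_add m_ac)
  finally show ?thesis .
qed

lemma frac_eq_iff:
  assumes "r \<in> carrier R" "s \<in> carrier R"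
  shows "fr r m = fr s n \<longleftrightarrow> (\<exists>k::nat. t [^] k \<otimes> (t [^] n \<otimes> r) = t [^] k \<otimes> (t [^] m \<otimes> s))"
proof
  assume "fr r m = fr s n"
  then have "(s, n) \<in> fr r m" using mem_frac_self assms by simp
  then show "\<exists>k::nat. t [^] k \<otimes> (t [^] n \<otimes> r) = t [^] k \<otimes> (t [^] m \<otimes> s)"
    using assms by (simp add: mem_frac_iff)
next
  assume "\<exists>k::nat. t [^] k \<otimes> (t [^] n \<otimes> r) = t [^] k \<otimes> (t [^] m \<otimes> s)"
  then obtain k :: nat where k: "t [^] k \<otimes> (t [^] n \<otimes> r) = t [^] k \<otimes> (t [^] m \<otimes> s)" ..
  have "(q, p) \<in> fr r m \<longleftrightarrow> (q, p) \<in> fr s n" for q p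
    unfolding mem_frac_iff[OF assms(1)] mem_frac_iff[OF assms(2)]
    using loc_rel_trans[OF assms(2,1) _ k[symmetric]] loc_rel_trans[OF assms _ k] by blast
  then show "fr r m = fr s n" by auto
qed

lemma frac_ne: "r \<in> carrier R \<Longrightarrow> fr r m \<noteq> {}"
  using mem_frac_self by blast

lemma L_carrier: "carrier L = {fr r n | r n. r \<in> carrier R}"
  by (simp add: localization_def)

lemma frac_closed: "r \<in> carrier R \<Longrightarrow> fr r n \<in> carrier L"
  by (auto simp: L_carrier)

lemma frac_mult:
  assumes "r \<in> carrier R" "s \<in> carrier R"
  shows "fr r m \<otimes>\<^bsub>L\<^esub> fr s n = fr (r \<otimes> s) (m + n)"
proof -
  have "fr (r' \<otimes> s') (m' + n') = fr (r \<otimes> s) (m + n)"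
    if m: "(r', m') \<in> fr r m" "(s', n') \<in> fr s n" for r' m' s' n'
  proof -
    obtain k :: nat where r': "r' \<in> carrier R" and k: "t [^] k \<otimes> (t [^] m' \<otimes> r) = t [^] k \<otimes> (t [^] m \<otimes> r')"
      using m(1) assms by (auto simp: mem_frac_iff)
    obtain j :: nat where s': "s' \<in> carrier R" and j: "t [^] j \<otimes> (t [^] n' \<otimes> s) = t [^] j \<otimes> (t [^] n \<otimes> s')"
      using m(2) assms by (auto simp: mem_frac_iff)
    have "t [^] (k + j) \<otimes> (t [^] (m' + n') \<otimes> (r \<otimes> s)) =
      (t [^] k \<otimes> (t [^] m' \<otimes> r)) \<otimes> (t [^] j \<otimes> (t [^] n' \<otimes> s))"
      using assms by (simp add: pow_add m_ac)
    also have "\<dots> = t [^] (k + j) \<otimes> (t [^] (m + n) \<otimes> (r' \<otimes> s'))"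
      unfolding k j using r' s' by (simp add: pow_add m_ac)
    finally have *: "t [^] (k + j) \<otimes> (t [^] (m' + n') \<otimes> (r \<otimes> s)) = \<dots>" .
    show ?thesis
      using assms r' s' by (subst frac_eq_iff) (auto intro!: exI[of _ "k + j"] *[symmetric])
  qed
  then show ?thesis
    unfolding localization_def by (simp add: UN_pairs_const frac_ne assms)
qed

lemma frac_add:
  assumes "r \<in> carrier R" "s \<in> carrier R"
  shows "fr r m \<oplus>\<^bsub>L\<^esub> fr s n = fr (t [^] n \<otimes> r \<oplus> t [^] m \<otimes> s) (m + n)"
proof -
  have "fr (t [^] n' \<otimes> r' \<oplus> t [^] m' \<otimes> s') (m' + n') = fr (t [^] n \<otimes> r \<oplus> t [^] m \<otimes> s) (m + n)"
    if m: "(r', m') \<in> fr r m" "(s', n') \<in> fr s n" for r' m' s' n'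
  proof -
    obtain k :: nat where r': "r' \<in> carrier R" and k: "t [^] k \<otimes> (t [^] m' \<otimes> r) = t [^] k \<otimes> (t [^] m \<otimes> r')"
      using m(1) assms by (auto simp: mem_frac_iff)
    obtain j :: nat where s': "s' \<in> carrier R" and j: "t [^] j \<otimes> (t [^] n' \<otimes> s) = t [^] j \<otimes> (t [^] n \<otimes> s')"
      using m(2) assms by (auto simp: mem_frac_iff)
    have "t [^] (k + j) \<otimes> (t [^] (m' + n') \<otimes> (t [^] n \<otimes> r \<oplus> t [^] m \<otimes> s)) =
      t [^] (j + n' + n) \<otimes> (t [^] k \<otimes> (t [^] m' \<otimes> r)) \<oplus> t [^] (k + m' + m) \<otimes> (t [^] j \<otimes> (t [^] n' \<otimes> s))"
      using assms by (simp add: pow_add m_ac r_distr)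
    also have "\<dots> = t [^] (k + j) \<otimes> (t [^] (m + n) \<otimes> (t [^] n' \<otimes> r' \<oplus> t [^] m' \<otimes> s'))"
      unfolding k j using r' s' by (simp add: pow_add m_ac r_distr)
    finally have *: "t [^] (k + j) \<otimes> (t [^] (m' + n') \<otimes> (t [^] n \<otimes> r \<oplus> t [^] m \<otimes> s)) = \<dots>" .
    show ?thesis
      using assms r' s' by (subst frac_eq_iff) (auto intro!: exI[of _ "k + j"] *[symmetric])
  qed
  then show ?thesis
    unfolding localization_def by (simp add: UN_pairs_const frac_ne assms)
qed

lemma L_one: "\<one>\<^bsub>L\<^esub> = fr \<one> 0"
  by (simp add: localization_def)

lemma to_loc_hom: "to_loc R t \<in> ring_hom R L"
  by (rule ring_hom_memI) (simp_all add: to_loc_def frac_closed frac_mult frac_add L_one)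

text \<open>This is what later lets a trace that lies in the image of the base ring be treated as an
  element of that ring.\<close>

lemma to_loc_inj:
  assumes "nonzero_divisor R t" "r \<in> carrier R" "s \<in> carrier R" "to_loc R t r = to_loc R t s"
  shows "r = s"
proof -
  have zero: "x = \<zero>" if "x \<in> carrier R" "t [^] (k::nat) \<otimes> x = \<zero>" for x k
    using that(2)
  proof (induction k)
    case (Suc k)
    have "t \<otimes> (t [^] k \<otimes> x) = \<zero>"
      using Suc.prems that(1) by (simp add: m_ac)
    then have "t [^] k \<otimes> x = \<zero>"
      using assms(1) that(1) by (auto simp: nonzero_divisor_def)
    then show ?case by (rule Suc.IH)
  qed (use that in simp)
  obtain k :: nat where "t [^] k \<otimes> r = t [^] k \<otimes> s"
    using assms by (auto simp: to_loc_def frac_eq_iff)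
  then have "t [^] k \<otimes> (r \<ominus> s) = \<zero>"
    using assms(2,3) by (simp add: minus_eq r_distr r_minus r_neg)
  then show ?thesis
    using zero[of "r \<ominus> s"] assms(2,3) by simp
qed

lemma to_loc_mult_inverse: "to_loc R t t \<otimes>\<^bsub>L\<^esub> fr \<one> 1 = \<one>\<^bsub>L\<^esub>"
  by (simp add: to_loc_def L_one frac_mult frac_eq_iff)

end

lemma image_constantI: "(\<And>x. x \<in> A \<Longrightarrow> f x = c) \<Longrightarrow> A \<noteq> {} \<Longrightarrow> f ` A = {c}"
  by auto

section \<open>Homomorphisms compatible with the chosen elements, and their localizations\<close>

locale loc_hom = R: cring_elem R t + S: cring_elem S u
  for R (structure) and t and S (structure) and u +
  fixes f
  assumes f_hom: "f \<in> ring_hom R S" and f_t: "f t = u"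
begin

lemma f_pow: "f (t [^]\<^bsub>R\<^esub> (n::nat)) = u [^]\<^bsub>S\<^esub> n"
proof -
  interpret ring_hom_cring R S f
    using f_hom by unfold_locales
  show ?thesis by (simp add: hom_nat_pow f_t)
qed

lemma f_closed: "r \<in> carrier R \<Longrightarrow> f r \<in> carrier S"
  using f_hom by (rule ring_hom_closed)

lemma loc_map_frac:
  assumes r: "r \<in> carrier R"
  shows "loc_map S u f (loc_frac R t r n) = loc_frac S u (f r) n"
proof -
  have "loc_frac S u (f s) m = loc_frac S u (f r) n" if sm: "(s, m) \<in> loc_frac R t r n" for s m
  proof -
    obtain k :: nat where s: "s \<in> carrier R"
      and k: "t [^]\<^bsub>R\<^esub> k \<otimes>\<^bsub>R\<^esub> (t [^]\<^bsub>R\<^esub> m \<otimes>\<^bsub>R\<^esub> r) = t [^]\<^bsub>R\<^esub> k \<otimes>\<^bsub>R\<^esub> (t [^]\<^bsub>R\<^esub> n \<otimes>\<^bsub>R\<^esub> s)"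
      using sm r by (auto simp: R.mem_frac_iff)
    have "u [^]\<^bsub>S\<^esub> k \<otimes>\<^bsub>S\<^esub> (u [^]\<^bsub>S\<^esub> n \<otimes>\<^bsub>S\<^esub> f s) = u [^]\<^bsub>S\<^esub> k \<otimes>\<^bsub>S\<^esub> (u [^]\<^bsub>S\<^esub> m \<otimes>\<^bsub>S\<^esub> f r)"
      using arg_cong[OF k, of f, symmetric] r s by (simp add: ring_hom_mult[OF f_hom] f_pow)
    then have "\<exists>k::nat. u [^]\<^bsub>S\<^esub> k \<otimes>\<^bsub>S\<^esub> (u [^]\<^bsub>S\<^esub> n \<otimes>\<^bsub>S\<^esub> f s) = u [^]\<^bsub>S\<^esub> k \<otimes>\<^bsub>S\<^esub> (u [^]\<^bsub>S\<^esub> m \<otimes>\<^bsub>S\<^esub> f r)"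
      by (rule exI)
    then show ?thesis
      by (rule S.frac_eq_iff[OF f_closed[OF s] f_closed[OF r], THEN iffD2])
  qed
  then have "(\<lambda>(r, n). loc_frac S u (f r) n) p = loc_frac S u (f r) n" if "p \<in> loc_frac R t r n" for p
    using that by (cases p) simp
  then have "(\<lambda>(r, n). loc_frac S u (f r) n) ` loc_frac R t r n = {loc_frac S u (f r) n}"
    using R.frac_ne[OF r, of n] by (rule image_constantI)
  then show ?thesis by (simp add: loc_map_def)
qed

text \<open>Inverting t identifies elements that differ by t-power torsion, so a surjection whose
  kernel consists of such torsion becomes bijective.\<close>

lemma loc_map_iso:
  assumes surj: "f ` carrier R = carrier S"
    and ker: "\<And>x. x \<in> carrier R \<Longrightarrow> f x = \<zero>\<^bsub>S\<^esub> \<Longrightarrow> \<exists>k::nat. t [^]\<^bsub>R\<^esub> k \<otimes>\<^bsub>R\<^esub> x = \<zero>\<^bsub>R\<^esub>"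
  shows "loc_map S u f \<in> ring_iso R.L S.L"
proof (rule ring_iso_memI)
  show closed: "loc_map S u f x \<in> carrier S.L" if "x \<in> carrier R.L" for x
    using that by (auto simp: R.L_carrier loc_map_frac f_closed S.frac_closed)
  show "loc_map S u f (x \<otimes>\<^bsub>R.L\<^esub> y) = loc_map S u f x \<otimes>\<^bsub>S.L\<^esub> loc_map S u f y"
    if "x \<in> carrier R.L" "y \<in> carrier R.L" for x y
    using that by (auto simp: R.L_carrier loc_map_frac f_closed R.frac_mult S.frac_mult ring_hom_mult[OF f_hom])
  show "loc_map S u f (x \<oplus>\<^bsub>R.L\<^esub> y) = loc_map S u f x \<oplus>\<^bsub>S.L\<^esub> loc_map S u f y"
    if "x \<in> carrier R.L" "y \<in> carrier R.L" for x y
    using that by (auto simp: R.L_carrier loc_map_frac f_closed R.frac_add S.frac_add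
        ring_hom_mult[OF f_hom] ring_hom_add[OF f_hom] f_pow)
  show "loc_map S u f \<one>\<^bsub>R.L\<^esub> = \<one>\<^bsub>S.L\<^esub>"
    by (simp add: R.L_one S.L_one loc_map_frac ring_hom_one[OF f_hom])
  show "bij_betw (loc_map S u f) (carrier R.L) (carrier S.L)"
  proof (rule bij_betwI')
    show "loc_map S u f x \<in> carrier S.L" if "x \<in> carrier R.L" for x
      using that by (rule closed)
    show "\<exists>x\<in>carrier R.L. y = loc_map S u f x" if y: "y \<in> carrier S.L" for y
    proof -
      obtain s n where "s \<in> carrier S" "y = loc_frac S u s n"
        using y by (auto simp: S.L_carrier)
      moreover from this obtain r where "r \<in> carrier R" "s = f r"
        using surj by auto
      ultimately show ?thesis
        by (intro bexI[of _ "loc_frac R t r n"]) (simp_all add: loc_map_frac R.frac_closed)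
    qed
    show "loc_map S u f x = loc_map S u f y \<longleftrightarrow> x = y" if xy: "x \<in> carrier R.L" "y \<in> carrier R.L" for x y
    proof
      assume eq: "loc_map S u f x = loc_map S u f y"
      obtain r m s n where r: "r \<in> carrier R" "x = loc_frac R t r m" and s: "s \<in> carrier R" "y = loc_frac R t s n"
        using xy by (auto simp: R.L_carrier)
      \<comment> \<open>The defect of x = y in cross-multiplied form, with the auxiliary factor t^k
        of \<open>frac_eq_iff\<close>. Equality of the images makes f kill some d k; a torsion
        exponent j then gives d (j + k) = 0, which again has the form required for equality of
        fractions.\<close>
      define d where "d k = t [^]\<^bsub>R\<^esub> k \<otimes>\<^bsub>R\<^esub> (t [^]\<^bsub>R\<^esub> n \<otimes>\<^bsub>R\<^esub> r) \<ominus>\<^bsub>R\<^esub> t [^]\<^bsub>R\<^esub> k \<otimes>\<^bsub>R\<^esub> (t [^]\<^bsub>R\<^esub> m \<otimes>\<^bsub>R\<^esub> s)" for k :: nat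
      have dc: "d k \<in> carrier R" for k using r s by (simp add: d_def)
      have dm: "t [^]\<^bsub>R\<^esub> j \<otimes>\<^bsub>R\<^esub> d k = d (j + k)" for j k :: nat
        using r s by (simp add: d_def R.minus_eq R.r_distr R.r_minus R.pow_add R.m_assoc)
      interpret ring_hom_cring R S f
        using f_hom by unfold_locales
      obtain k :: nat where "u [^]\<^bsub>S\<^esub> k \<otimes>\<^bsub>S\<^esub> (u [^]\<^bsub>S\<^esub> n \<otimes>\<^bsub>S\<^esub> f r) = u [^]\<^bsub>S\<^esub> k \<otimes>\<^bsub>S\<^esub> (u [^]\<^bsub>S\<^esub> m \<otimes>\<^bsub>S\<^esub> f s)"
        using eq r s by (auto simp: loc_map_frac S.frac_eq_iff)
      then have "f (d k) = \<zero>\<^bsub>S\<^esub>"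
        using r s by (simp add: d_def R.minus_eq f_pow f_t S.r_neg)
      then obtain j :: nat where "t [^]\<^bsub>R\<^esub> j \<otimes>\<^bsub>R\<^esub> d k = \<zero>\<^bsub>R\<^esub>"
        using ker dc by blast
      then have "d (j + k) = \<zero>\<^bsub>R\<^esub>" by (simp add: dm)
      then show "x = y"
        using r s by (auto simp: d_def R.frac_eq_iff intro!: exI[of _ "j + k"])
    qed simp
  qed
qed

end

section \<open>Adic completions\<close>

context cring_elem
begin

abbreviation "I n \<equiv> PIdl (t [^] (n::nat))"
abbreviation "C \<equiv> completion R t"

text \<open>A choice of representatives for a point of the inverse limit. By
  \<open>completion_cases\<close> every point has one, so computations in the completion become
  termwise computations in R.\<close>

definition coherent :: "(nat \<Rightarrow> 'a) \<Rightarrow> bool" where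
  "coherent a \<longleftrightarrow> (\<forall>n. a n \<in> carrier R \<and> a (Suc n) \<ominus> a n \<in> I n)"

definition adic_lim :: "(nat \<Rightarrow> 'a) \<Rightarrow> nat \<Rightarrow> 'a set" where
  "adic_lim a n = I n +> a n"

lemma I_ideal: "ideal (I n) R"
  by (intro cgenideal_ideal) simp

lemma I_mem_iff: "x \<in> I n \<longleftrightarrow> (\<exists>r\<in>carrier R. x = t [^] n \<otimes> r)"
  by (auto simp: cgenideal_def m_comm)

lemma I_mono: "m \<le> n \<Longrightarrow> I n \<subseteq> I m"
proof
  fix x assume "m \<le> n" "x \<in> I n"
  then obtain r where r: "r \<in> carrier R" "x = t [^] (m + (n - m)) \<otimes> r"
    by (auto simp: I_mem_iff)
  then have "x = t [^] m \<otimes> (t [^] (n - m) \<otimes> r)"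
    by (simp only: pow_add) (simp add: m_assoc)
  then show "x \<in> I m"
    using r by (auto simp: I_mem_iff)
qed

lemma I_add: "x \<in> I n \<Longrightarrow> y \<in> I n \<Longrightarrow> x \<oplus> y \<in> I n"
  using I_ideal additive_subgroup.a_closed ideal.axioms(1) by metis

lemma I_minus: "x \<in> I n \<Longrightarrow> \<ominus> x \<in> I n"
  using I_ideal additive_subgroup.a_inv_closed ideal.axioms(1) by metis

lemma I_mult: "x \<in> I n \<Longrightarrow> r \<in> carrier R \<Longrightarrow> r \<otimes> x \<in> I n"
  using I_ideal by (rule ideal.I_l_closed)

lemma I_carrier: "x \<in> I n \<Longrightarrow> x \<in> carrier R"
  using I_ideal by (rule ideal.Icarr)

lemma I_zero: "\<zero> \<in> I n"
  using I_ideal additive_subgroup.zero_closed ideal.axioms(1) by metis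

lemma coset_eq_iff:
  "a \<in> carrier R \<Longrightarrow> b \<in> carrier R \<Longrightarrow> I n +> a = I n +> b \<longleftrightarrow> a \<ominus> b \<in> I n"
  using quotient_eq_iff_same_a_r_cos[OF I_ideal] by simp

text \<open>Translates the inclusion that encodes the transition maps into a congruence. The left
  coset is taken modulo t^(n+1), but the inclusion only sees the difference modulo t^n.\<close>

lemma coset_mono_iff:
  assumes "a \<in> carrier R" "b \<in> carrier R"
  shows "I (Suc n) +> a \<subseteq> I n +> b \<longleftrightarrow> a \<ominus> b \<in> I n"
proof
  have "a \<in> I (Suc n) +> a"
  proof -
    interpret ideal "I (Suc n)" R by (rule I_ideal)
    show ?thesis using assms(1) by (rule a_rcos_self)
  qed
  moreover assume "I (Suc n) +> a \<subseteq> I n +> b"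
  ultimately obtain i where "i \<in> I n" "a = i \<oplus> b"
    by (auto simp: a_r_coset_def')
  moreover from this have "a \<ominus> b = i"
    using assms by (simp add: I_carrier minus_eq a_assoc r_neg)
  ultimately show "a \<ominus> b \<in> I n" by simp
next
  assume "a \<ominus> b \<in> I n"
  then have "I n +> a = I n +> b"
    by (simp add: coset_eq_iff assms)
  moreover have "I (Suc n) +> a \<subseteq> I n +> a"
    using I_mono[of n "Suc n"] by (auto simp: a_r_coset_def')
  ultimately show "I (Suc n) +> a \<subseteq> I n +> b" by simp
qed

lemma adic_quot_carrier: "carrier (adic_quot R t n) = {I n +> a | a. a \<in> carrier R}"
  by (auto simp: adic_quot_def FactRing_def A_RCOSETS_def')

lemma adic_quot_ops:
  assumes "a \<in> carrier R" "b \<in> carrier R"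
  shows "(I n +> a) \<otimes>\<^bsub>adic_quot R t n\<^esub> (I n +> b) = I n +> (a \<otimes> b)"
    and "(I n +> a) \<oplus>\<^bsub>adic_quot R t n\<^esub> (I n +> b) = I n +> (a \<oplus> b)"
  using ring_hom_mult[OF ideal.rcos_ring_hom[OF I_ideal] assms] ring_hom_add[OF ideal.rcos_ring_hom[OF I_ideal] assms]
  by (simp_all add: adic_quot_def)

lemma coherentD: "coherent a \<Longrightarrow> a n \<in> carrier R" "coherent a \<Longrightarrow> a (Suc n) \<ominus> a n \<in> I n"
  by (simp_all add: coherent_def)

lemma adic_lim_closed: "coherent a \<Longrightarrow> adic_lim a \<in> carrier C"
proof -
  assume a: "coherent a"
  have "adic_lim a n \<in> carrier (adic_quot R t n)" for n
    using coherentD(1)[OF a] by (auto simp: adic_quot_carrier adic_lim_def)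
  moreover have "adic_lim a (Suc n) \<subseteq> adic_lim a n" for n
    unfolding adic_lim_def
    by (intro coset_mono_iff[THEN iffD2] coherentD[OF a])
  ultimately show ?thesis by (simp add: completion_def)
qed

lemma completion_cases:
  assumes "x \<in> carrier C"
  obtains a where "coherent a" "x = adic_lim a"
proof -
  have "\<forall>n. \<exists>a\<in>carrier R. x n = I n +> a"
  proof
    fix n
    have "x n \<in> carrier (adic_quot R t n)"
      using assms by (simp add: completion_def)
    then show "\<exists>a\<in>carrier R. x n = I n +> a"
      unfolding adic_quot_carrier by blast
  qed
  then obtain a where a: "\<And>n. a n \<in> carrier R" "\<And>n. x n = I n +> a n"
    by metis
  have "x (Suc n) \<subseteq> x n" for n
    using assms by (simp add: completion_def)
  then have "a (Suc n) \<ominus> a n \<in> I n" for n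
    unfolding a(2) by (rule coset_mono_iff[OF a(1) a(1), THEN iffD1])
  then have "coherent a"
    using a(1) by (simp add: coherent_def)
  moreover have "x = adic_lim a"
    using a by (simp add: adic_lim_def fun_eq_iff)
  ultimately show ?thesis by (rule that)
qed

lemma adic_lim_eq_iff:
  "coherent a \<Longrightarrow> coherent b \<Longrightarrow> adic_lim a = adic_lim b \<longleftrightarrow> (\<forall>n. a n \<ominus> b n \<in> I n)"
  by (simp add: adic_lim_def fun_eq_iff coset_eq_iff coherentD)

lemma adic_lim_ops:
  assumes "coherent a" "coherent b"
  shows "adic_lim a \<otimes>\<^bsub>C\<^esub> adic_lim b = adic_lim (\<lambda>n. a n \<otimes> b n)"
    and "adic_lim a \<oplus>\<^bsub>C\<^esub> adic_lim b = adic_lim (\<lambda>n. a n \<oplus> b n)"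
  using assms by (simp_all add: completion_def adic_lim_def fun_eq_iff adic_quot_ops coherentD)

lemma coherent_const: "r \<in> carrier R \<Longrightarrow> coherent (\<lambda>_. r)"
  by (simp add: coherent_def minus_eq r_neg I_zero)

lemma to_completion_eq: "to_completion R t r = adic_lim (\<lambda>_. r)"
  by (simp add: to_completion_def adic_lim_def fun_eq_iff)

lemma completion_one: "\<one>\<^bsub>C\<^esub> = adic_lim (\<lambda>_. \<one>)"
  by (simp add: completion_def adic_lim_def adic_quot_def FactRing_def fun_eq_iff)

lemma completion_zero: "\<zero>\<^bsub>C\<^esub> = adic_lim (\<lambda>_. \<zero>)"
  using a_rcos_zero[OF I_ideal I_zero]
  by (simp add: completion_def adic_lim_def adic_quot_def FactRing_def fun_eq_iff)

lemma coherent_add: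
  assumes "coherent a" "coherent b"
  shows "coherent (\<lambda>n. a n \<oplus> b n)"
proof -
  have "a (Suc n) \<oplus> b (Suc n) \<ominus> (a n \<oplus> b n) = (a (Suc n) \<ominus> a n) \<oplus> (b (Suc n) \<ominus> b n)" for n
    using coherentD(1)[OF assms(1)] coherentD(1)[OF assms(2)] by algebra
  then show ?thesis
    using assms by (auto simp: coherent_def I_add)
qed

lemma coherent_mult:
  assumes "coherent a" "coherent b"
  shows "coherent (\<lambda>n. a n \<otimes> b n)"
proof -
  have "a (Suc n) \<otimes> b (Suc n) \<ominus> (a n \<otimes> b n) =
    a (Suc n) \<otimes> (b (Suc n) \<ominus> b n) \<oplus> b n \<otimes> (a (Suc n) \<ominus> a n)" for n
    using coherentD(1)[OF assms(1)] coherentD(1)[OF assms(2)] by algebra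
  then show ?thesis
    using assms by (auto simp: coherent_def intro!: I_add I_mult)
qed

lemma coherent_minus:
  assumes "coherent a"
  shows "coherent (\<lambda>n. \<ominus> a n)"
proof -
  have "\<ominus> a (Suc n) \<ominus> (\<ominus> a n) = \<ominus> (a (Suc n) \<ominus> a n)" for n
    using coherentD(1)[OF assms(1)] by algebra
  then show ?thesis
    using assms by (auto simp: coherent_def I_minus)
qed

lemmas coherent_intros = coherent_const coherent_add coherent_mult coherent_minus

lemma cring_completion: "cring C"
proof (rule cringI)
  show "abelian_group C"
  proof (rule abelian_groupI)
    show "x \<oplus>\<^bsub>C\<^esub> y \<in> carrier C" if "x \<in> carrier C" "y \<in> carrier C" for x y
      using that by (auto elim!: completion_cases simp: adic_lim_ops intro!: adic_lim_closed coherent_intros)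
    show "\<zero>\<^bsub>C\<^esub> \<in> carrier C"
      by (simp add: completion_zero adic_lim_closed coherent_intros)
    show "x \<oplus>\<^bsub>C\<^esub> y \<oplus>\<^bsub>C\<^esub> z = x \<oplus>\<^bsub>C\<^esub> (y \<oplus>\<^bsub>C\<^esub> z)"
      if "x \<in> carrier C" "y \<in> carrier C" "z \<in> carrier C" for x y z
      using that by (auto elim!: completion_cases simp: adic_lim_ops coherent_intros a_assoc coherentD)
    show "x \<oplus>\<^bsub>C\<^esub> y = y \<oplus>\<^bsub>C\<^esub> x" if "x \<in> carrier C" "y \<in> carrier C" for x y
      using that by (auto elim!: completion_cases simp: adic_lim_ops coherent_intros a_comm coherentD)
    show "\<zero>\<^bsub>C\<^esub> \<oplus>\<^bsub>C\<^esub> x = x" if "x \<in> carrier C" for x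
      using that by (auto elim!: completion_cases simp: completion_zero adic_lim_ops coherent_intros coherentD)
    show "\<exists>y\<in>carrier C. y \<oplus>\<^bsub>C\<^esub> x = \<zero>\<^bsub>C\<^esub>" if x: "x \<in> carrier C" for x
    proof -
      obtain a where a: "coherent a" "x = adic_lim a"
        using x by (rule completion_cases)
      then have "adic_lim (\<lambda>n. \<ominus> a n) \<oplus>\<^bsub>C\<^esub> x = \<zero>\<^bsub>C\<^esub>"
        by (simp add: completion_zero adic_lim_ops coherent_intros coherentD l_neg)
      then show ?thesis
        using a by (auto intro!: adic_lim_closed coherent_intros)
    qed
  qed
  show "comm_monoid C"
  proof (rule comm_monoidI)
    show "x \<otimes>\<^bsub>C\<^esub> y \<in> carrier C" if "x \<in> carrier C" "y \<in> carrier C" for x y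
      using that by (auto elim!: completion_cases simp: adic_lim_ops intro!: adic_lim_closed coherent_intros)
    show "\<one>\<^bsub>C\<^esub> \<in> carrier C"
      by (simp add: completion_one adic_lim_closed coherent_intros)
    show "x \<otimes>\<^bsub>C\<^esub> y \<otimes>\<^bsub>C\<^esub> z = x \<otimes>\<^bsub>C\<^esub> (y \<otimes>\<^bsub>C\<^esub> z)"
      if "x \<in> carrier C" "y \<in> carrier C" "z \<in> carrier C" for x y z
      using that by (auto elim!: completion_cases simp: adic_lim_ops coherent_intros m_assoc coherentD)
    show "x \<otimes>\<^bsub>C\<^esub> y = y \<otimes>\<^bsub>C\<^esub> x" if "x \<in> carrier C" "y \<in> carrier C" for x y
      using that by (auto elim!: completion_cases simp: adic_lim_ops coherent_intros m_comm coherentD)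
    show "\<one>\<^bsub>C\<^esub> \<otimes>\<^bsub>C\<^esub> x = x" if "x \<in> carrier C" for x
      using that by (auto elim!: completion_cases simp: completion_one adic_lim_ops coherent_intros coherentD)
  qed
  show "(x \<oplus>\<^bsub>C\<^esub> y) \<otimes>\<^bsub>C\<^esub> z = x \<otimes>\<^bsub>C\<^esub> z \<oplus>\<^bsub>C\<^esub> y \<otimes>\<^bsub>C\<^esub> z"
    if "x \<in> carrier C" "y \<in> carrier C" "z \<in> carrier C" for x y z
    using that by (auto elim!: completion_cases simp: adic_lim_ops coherent_intros l_distr coherentD)
qed

sublocale C: cring C by (rule cring_completion)

lemma to_completion_hom: "to_completion R t \<in> ring_hom R C"
  by (rule ring_hom_memI)
     (auto simp: to_completion_eq adic_lim_ops completion_one coherent_intros intro!: adic_lim_closed)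

end

section \<open>Completion at an element that is not a zero divisor\<close>

locale regular_elem = cring_elem +
  assumes cancel: "\<And>x. x \<in> carrier R \<Longrightarrow> t \<otimes> x = \<zero> \<Longrightarrow> x = \<zero>"
begin

lemma cancel_pow: "x \<in> carrier R \<Longrightarrow> t [^] (k::nat) \<otimes> x = \<zero> \<Longrightarrow> x = \<zero>"
proof (induction k)
  case (Suc k)
  then show ?case
    using cancel[of "t [^] k \<otimes> x"] by (simp add: m_ac)
qed simp

lemma cancel_pow_eq:
  assumes "x \<in> carrier R" "y \<in> carrier R" "t [^] (k::nat) \<otimes> x = t [^] k \<otimes> y"
  shows "x = y"
proof -
  have "t [^] k \<otimes> (x \<ominus> y) = \<zero>"
    using assms by (simp add: minus_eq r_distr r_minus r_neg)
  then show ?thesis using cancel_pow[of "x \<ominus> y"] assms by simp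
qed

text \<open>Cancelling t costs one power of it, so the term of index n is controlled through the
  term of index n + 1, to which it is congruent modulo t^n.\<close>

lemma completion_cancel:
  assumes "x \<in> carrier C" "to_completion R t t \<otimes>\<^bsub>C\<^esub> x = \<zero>\<^bsub>C\<^esub>"
  shows "x = \<zero>\<^bsub>C\<^esub>"
proof -
  obtain a where a: "coherent a" "x = adic_lim a"
    using assms(1) by (rule completion_cases)
  have "t \<otimes> a n \<ominus> \<zero> \<in> I n" for n
    using assms(2) a
    by (simp add: to_completion_eq adic_lim_ops coherent_intros completion_zero adic_lim_eq_iff)
  then have ta: "t \<otimes> a n \<in> I n" for n
    using coherentD(1)[OF a(1)] by (simp add: minus_eq)
  have "a n \<ominus> \<zero> \<in> I n" for n
  proof -
    obtain r where r: "r \<in> carrier R" "t \<otimes> a (Suc n) = t [^] Suc n \<otimes> r"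
      by (rule I_mem_iff[THEN iffD1, OF ta[of "Suc n"], THEN bexE])
    have "t \<otimes> a (Suc n) = t \<otimes> (t [^] n \<otimes> r)"
      unfolding r(2) using r(1) by (simp add: m_ac)
    then have *: "t [^] (1::nat) \<otimes> a (Suc n) = t [^] (1::nat) \<otimes> (t [^] n \<otimes> r)"
      by simp
    have "a (Suc n) = t [^] n \<otimes> r"
      by (rule cancel_pow_eq[OF _ _ *]) (use r(1) coherentD(1)[OF a(1)] in auto)
    then have "a (Suc n) \<in> I n"
      by (rule I_mem_iff[THEN iffD2, OF bexI, OF _ r(1)])
    then have "a (Suc n) \<oplus> \<ominus> (a (Suc n) \<ominus> a n) \<in> I n"
      by (rule I_add[OF _ I_minus[OF coherentD(2)[OF a(1)]]])
    moreover have "a (Suc n) \<oplus> \<ominus> (a (Suc n) \<ominus> a n) = a n \<ominus> \<zero>"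
      using coherentD(1)[OF a(1)] by algebra
    ultimately show ?thesis by simp
  qed
  then have "adic_lim a = adic_lim (\<lambda>_. \<zero>)"
    using adic_lim_eq_iff[OF a(1) coherent_const[OF zero_closed]] by blast
  then show ?thesis
    by (simp only: a(2) completion_zero)
qed

text \<open>Density of R together with an explicit form of the remainder: the elements of the
  completion that vanish modulo t^c are multiples of t^c. Cancellation makes the termwise quotients
  by t^c coherent.\<close>

lemma completion_decompose:
  assumes x: "x \<in> carrier C"
  obtains r y where "r \<in> carrier R" "y \<in> carrier C"
    "x = to_completion R t r \<oplus>\<^bsub>C\<^esub> to_completion R t (t [^] (c::nat)) \<otimes>\<^bsub>C\<^esub> y"
proof -
  obtain a where a: "coherent a" "x = adic_lim a"
    using assms(1) by (rule completion_cases)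
  have ac: "a n \<in> carrier R" for n using a(1) by (rule coherentD)
  have diff: "a (m + n) \<ominus> a m \<in> I m" for m n
  proof (induction n)
    case (Suc n)
    have "a (m + Suc n) \<ominus> a m = (a (Suc (m + n)) \<ominus> a (m + n)) \<oplus> (a (m + n) \<ominus> a m)"
      using ac[of "Suc (m + n)"] ac[of "m + n"] ac[of m] unfolding add_Suc_right by algebra
    moreover have "a (Suc (m + n)) \<ominus> a (m + n) \<in> I m"
      using coherentD(2)[OF a(1), of "m + n"] I_mono[of m "m + n"] by auto
    ultimately show ?case using Suc by (simp add: I_add)
  qed (simp add: ac minus_eq r_neg I_zero)
  \<comment> \<open>The shift of the index by c compensates the c powers lost on division:
    consecutive terms a (c + n) agree modulo t^(c + n), hence their quotients agree modulo
    t^n.\<close>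
  have "\<forall>n. \<exists>g\<in>carrier R. a (c + n) \<ominus> a c = t [^] c \<otimes> g"
    using diff by (simp add: I_mem_iff)
  then obtain g where g: "\<And>n. g n \<in> carrier R" "\<And>n. a (c + n) \<ominus> a c = t [^] c \<otimes> g n"
    by metis
  have "coherent g"
    unfolding coherent_def
  proof (intro allI conjI g(1))
    fix n
    obtain r where r: "r \<in> carrier R" "a (Suc (c + n)) \<ominus> a (c + n) = t [^] (c + n) \<otimes> r"
      using coherentD(2)[OF a(1), of "c + n"] by (auto simp: I_mem_iff)
    have "t [^] c \<otimes> (g (Suc n) \<ominus> g n) = t [^] c \<otimes> g (Suc n) \<ominus> t [^] c \<otimes> g n"
      using g(1) by (simp add: minus_eq r_distr r_minus)
    also have "\<dots> = (a (c + Suc n) \<ominus> a c) \<ominus> (a (c + n) \<ominus> a c)"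
      by (simp only: g(2))
    also have "\<dots> = a (Suc (c + n)) \<ominus> a (c + n)"
      using ac[of "Suc (c + n)"] ac[of "c + n"] ac[of c] unfolding add_Suc_right by algebra
    also have "\<dots> = t [^] c \<otimes> (t [^] n \<otimes> r)"
      unfolding r(2) using r(1) by (simp add: pow_add m_assoc)
    finally have *: "t [^] c \<otimes> (g (Suc n) \<ominus> g n) = t [^] c \<otimes> (t [^] n \<otimes> r)" .
    have "g (Suc n) \<ominus> g n = t [^] n \<otimes> r"
      by (rule cancel_pow_eq[OF _ _ *]) (use g(1) r(1) in auto)
    then show "g (Suc n) \<ominus> g n \<in> I n"
      by (rule I_mem_iff[THEN iffD2, OF bexI, OF _ r(1)])
  qed
  moreover have "x = to_completion R t (a c) \<oplus>\<^bsub>C\<^esub> to_completion R t (t [^] c) \<otimes>\<^bsub>C\<^esub> adic_lim g"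
  proof -
    have "a n \<ominus> (a c \<oplus> t [^] c \<otimes> g n) \<in> I n" for n
    proof -
      \<comment> \<open>The bracket equals a (c + n) by the choice of g, so this is only a
        comparison of two terms of the original sequence.\<close>
      have "a n \<ominus> (a c \<oplus> t [^] c \<otimes> g n) = \<ominus> (a (n + c) \<ominus> a n)"
        unfolding g(2)[symmetric] add.commute[of n c]
        using ac[of n] ac[of "c + n"] ac[of c] by algebra
      then show ?thesis using diff[of n c] by (simp add: I_minus)
    qed
    moreover have "coherent (\<lambda>n. a c \<oplus> t [^] c \<otimes> g n)"
      by (intro coherent_intros \<open>coherent g\<close> ac nat_pow_closed t_closed)
    ultimately have "adic_lim a = adic_lim (\<lambda>n. a c \<oplus> t [^] c \<otimes> g n)"
      using adic_lim_eq_iff[OF a(1)] by blast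
    also have "\<dots> = to_completion R t (a c) \<oplus>\<^bsub>C\<^esub> to_completion R t (t [^] c) \<otimes>\<^bsub>C\<^esub> adic_lim g"
      unfolding to_completion_eq
      by (simp only: adic_lim_ops coherent_intros \<open>coherent g\<close> ac nat_pow_closed t_closed)
    finally show ?thesis using a(2) by simp
  qed
  ultimately show ?thesis
    using that ac adic_lim_closed by blast
qed

end

text \<open>Additivity and compatibility with t already carry t^n R into u^n S, which is enough to
  induce a map on completions. Multiplicativity is not built in because the locale must also cover
  the functionals obtained from the trace.\<close>

locale adic_additive = R: cring_elem R t + S: cring_elem S u
  for R (structure) and t and S (structure) and u +
  fixes f
  assumes f_closed: "x \<in> carrier R \<Longrightarrow> f x \<in> carrier S"
    and f_add: "x \<in> carrier R \<Longrightarrow> y \<in> carrier R \<Longrightarrow> f (x \<oplus>\<^bsub>R\<^esub> y) = f x \<oplus>\<^bsub>S\<^esub> f y"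
    and f_mult: "x \<in> carrier R \<Longrightarrow> f (t \<otimes>\<^bsub>R\<^esub> x) = u \<otimes>\<^bsub>S\<^esub> f x"
begin

lemma f_mult_pow: "x \<in> carrier R \<Longrightarrow> f (t [^]\<^bsub>R\<^esub> (n::nat) \<otimes>\<^bsub>R\<^esub> x) = u [^]\<^bsub>S\<^esub> n \<otimes>\<^bsub>S\<^esub> f x"
proof (induction n arbitrary: x)
  case (Suc n)
  have "t [^]\<^bsub>R\<^esub> Suc n \<otimes>\<^bsub>R\<^esub> x = t [^]\<^bsub>R\<^esub> n \<otimes>\<^bsub>R\<^esub> (t \<otimes>\<^bsub>R\<^esub> x)"
    using Suc.prems by (simp add: R.m_assoc)
  then show ?case
    using Suc by (simp add: f_mult f_closed S.m_assoc)
qed (simp add: f_closed)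

lemma f_I: "x \<in> R.I n \<Longrightarrow> f x \<in> S.I n"
  by (auto simp: R.I_mem_iff S.I_mem_iff f_mult_pow intro!: f_closed)

lemma f_zero: "f \<zero>\<^bsub>R\<^esub> = \<zero>\<^bsub>S\<^esub>"
  using f_add[of "\<zero>\<^bsub>R\<^esub>" "\<zero>\<^bsub>R\<^esub>"] f_closed[of "\<zero>\<^bsub>R\<^esub>"] by simp

lemma f_diff:
  assumes "x \<in> carrier R" "y \<in> carrier R"
  shows "f (x \<ominus>\<^bsub>R\<^esub> y) = f x \<ominus>\<^bsub>S\<^esub> f y"
proof -
  have "f x = f (x \<ominus>\<^bsub>R\<^esub> y) \<oplus>\<^bsub>S\<^esub> f y"
    using assms by (simp add: f_add[symmetric] R.minus_eq R.a_assoc R.l_neg)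
  then show ?thesis
    using assms by (simp add: f_closed S.minus_eq S.a_assoc S.r_neg)
qed

lemma f_coherent: "R.coherent a \<Longrightarrow> S.coherent (\<lambda>n. f (a n))"
  by (auto simp: R.coherent_def S.coherent_def f_closed f_diff[symmetric] f_I)

lemma completion_map_lim:
  assumes "R.coherent a"
  shows "completion_map S u f (R.adic_lim a) = S.adic_lim (\<lambda>n. f (a n))"
proof
  fix n
  have a: "a n \<in> carrier R" using assms by (rule R.coherentD)
  have "S.I n <+>\<^bsub>S\<^esub> f ` (R.I n +>\<^bsub>R\<^esub> a n) = S.I n +>\<^bsub>S\<^esub> f (a n)"
  proof (intro equalityI subsetI)
    fix y assume "y \<in> S.I n <+>\<^bsub>S\<^esub> f ` (R.I n +>\<^bsub>R\<^esub> a n)"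
    then obtain s i where "s \<in> S.I n" "i \<in> R.I n" "y = s \<oplus>\<^bsub>S\<^esub> f (i \<oplus>\<^bsub>R\<^esub> a n)"
      by (auto simp: set_add_def' a_r_coset_def')
    then show "y \<in> S.I n +>\<^bsub>S\<^esub> f (a n)"
      using a by (auto simp: a_r_coset_def' f_add R.I_carrier S.I_carrier f_closed S.a_assoc[symmetric]
          intro!: bexI[of _ "s \<oplus>\<^bsub>S\<^esub> f i"] S.I_add f_I)
  next
    fix y assume "y \<in> S.I n +>\<^bsub>S\<^esub> f (a n)"
    then obtain s where "s \<in> S.I n" "y = s \<oplus>\<^bsub>S\<^esub> f (\<zero>\<^bsub>R\<^esub> \<oplus>\<^bsub>R\<^esub> a n)"
      using a by (auto simp: a_r_coset_def')
    then show "y \<in> S.I n <+>\<^bsub>S\<^esub> f ` (R.I n +>\<^bsub>R\<^esub> a n)"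
      using R.I_zero[of n] by (auto simp: set_add_def' a_r_coset_def')
  qed
  then show "completion_map S u f (R.adic_lim a) n = S.adic_lim (\<lambda>n. f (a n)) n"
    by (simp add: completion_map_def R.adic_lim_def S.adic_lim_def)
qed

abbreviation "hat \<equiv> completion_map S u f"

lemma hat_closed: "x \<in> carrier R.C \<Longrightarrow> hat x \<in> carrier S.C"
  by (auto elim!: R.completion_cases simp: completion_map_lim intro!: S.adic_lim_closed f_coherent)

lemma hat_add: "x \<in> carrier R.C \<Longrightarrow> y \<in> carrier R.C \<Longrightarrow> hat (x \<oplus>\<^bsub>R.C\<^esub> y) = hat x \<oplus>\<^bsub>S.C\<^esub> hat y"
  by (auto elim!: R.completion_cases simp: completion_map_lim R.adic_lim_ops S.adic_lim_ops
      R.coherent_intros f_coherent f_add R.coherentD)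

lemma hat_to_completion: "r \<in> carrier R \<Longrightarrow> hat (to_completion R t r) = to_completion S u (f r)"
  by (simp add: R.to_completion_eq S.to_completion_eq completion_map_lim R.coherent_intros)

end

lemma adic_additive_of_loc_hom:
  assumes "loc_hom R t S u f"
  shows "adic_additive R t S u f"
proof -
  interpret loc_hom R t S u f by fact
  show ?thesis
    by unfold_locales (simp_all add: f_closed ring_hom_add[OF f_hom] ring_hom_mult[OF f_hom] f_t)
qed

sublocale loc_hom \<subseteq> adic_additive
  by (rule adic_additive_of_loc_hom) (rule loc_hom_axioms)

lemma (in loc_hom) hat_hom: "hat \<in> ring_hom R.C S.C"
proof (rule ring_hom_memI)
  show "hat (x \<otimes>\<^bsub>R.C\<^esub> y) = hat x \<otimes>\<^bsub>S.C\<^esub> hat y" if "x \<in> carrier R.C" "y \<in> carrier R.C" for x y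
    using that by (auto elim!: R.completion_cases simp: completion_map_lim R.adic_lim_ops S.adic_lim_ops
      R.coherent_intros f_coherent ring_hom_mult[OF f_hom] R.coherentD)
  show "hat \<one>\<^bsub>R.C\<^esub> = \<one>\<^bsub>S.C\<^esub>"
    by (simp add: R.completion_one S.completion_one completion_map_lim R.coherent_intros ring_hom_one[OF f_hom])
qed (auto simp: hat_closed hat_add)

section \<open>Separability and traces\<close>

text \<open>Combinations of the first k generators. The coefficient set M is a parameter so that
  coefficients can be moved from the ring into an ideal, and the recursion allows the last generator
  to be split off.\<close>

primrec lin_span :: "('a, 'm) ring_scheme \<Rightarrow> 'a set \<Rightarrow> (nat \<Rightarrow> 'a) \<Rightarrow> nat \<Rightarrow> 'a set" where
  "lin_span R M g 0 = {\<zero>\<^bsub>R\<^esub>}"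
| "lin_span R M g (Suc k) = {x \<oplus>\<^bsub>R\<^esub> a \<otimes>\<^bsub>R\<^esub> g k | x a. x \<in> lin_span R M g k \<and> a \<in> M}"

lemma lin_span_SucI:
  "x \<in> lin_span R M g k \<Longrightarrow> a \<in> M \<Longrightarrow> x \<oplus>\<^bsub>R\<^esub> a \<otimes>\<^bsub>R\<^esub> g k \<in> lin_span R M g (Suc k)"
  unfolding lin_span.simps by blast

lemma lin_span_SucE:
  assumes "x \<in> lin_span R M g (Suc k)"
  obtains y a where "x = y \<oplus>\<^bsub>R\<^esub> a \<otimes>\<^bsub>R\<^esub> g k" "y \<in> lin_span R M g k" "a \<in> M"
  using assms unfolding lin_span.simps by blast

declare lin_span.simps(2) [simp del]

section \<open>Nakayama's lemma for an idempotent ideal\<close>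

context cring
begin

lemma lin_span_closed:
  assumes "M \<subseteq> carrier R" "\<And>i. i < k \<Longrightarrow> g i \<in> carrier R" "x \<in> lin_span R M g k"
  shows "x \<in> carrier R"
  using assms(2,3)
proof (induction k arbitrary: x)
  case (Suc k)
  from Suc.prems(2) obtain y a where x: "x = y \<oplus> a \<otimes> g k" "y \<in> lin_span R M g k" "a \<in> M"
    by (rule lin_span_SucE)
  have "y \<in> carrier R" by (rule Suc.IH[OF _ x(2)]) (use Suc.prems(1) in simp)
  then show ?case using x(3) assms(1) Suc.prems(1)[of k] by (auto simp: x(1))
qed simp

lemma lin_span_add:
  assumes M: "ideal M R" and g: "\<And>i. i < k \<Longrightarrow> g i \<in> carrier R"
    and "x \<in> lin_span R M g k" "y \<in> lin_span R M g k"
  shows "x \<oplus> y \<in> lin_span R M g k"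
  using g assms(3,4)
proof (induction k arbitrary: x y)
  case (Suc k)
  interpret M: ideal M R by fact
  obtain x' a y' b where x: "x = x' \<oplus> a \<otimes> g k" "x' \<in> lin_span R M g k" "a \<in> M"
    and y: "y = y' \<oplus> b \<otimes> g k" "y' \<in> lin_span R M g k" "b \<in> M"
    using Suc.prems(2,3) by (meson lin_span_SucE)
  have c: "x' \<in> carrier R" "y' \<in> carrier R" "a \<in> carrier R" "b \<in> carrier R" "g k \<in> carrier R"
    using lin_span_closed[OF M.a_subset _ x(2)] lin_span_closed[OF M.a_subset _ y(2)]
      Suc.prems(1) x(3) y(3) M.Icarr by auto
  have "x \<oplus> y = (x' \<oplus> y') \<oplus> (a \<oplus> b) \<otimes> g k"
    unfolding x(1) y(1) using c by algebra
  moreover have "x' \<oplus> y' \<in> lin_span R M g k"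
    using Suc.IH Suc.prems(1) x(2) y(2) by auto
  moreover have "a \<oplus> b \<in> M" using x(3) y(3) by (rule M.a_closed)
  ultimately show ?case by (simp only: lin_span_SucI)
qed simp

text \<open>The target set M' may differ from M: multiplication by an element of an ideal turns
  arbitrary coefficients into coefficients in that ideal.\<close>

lemma lin_span_mult:
  assumes M: "M \<subseteq> carrier R" and u: "u \<in> carrier R" and uM: "\<And>a. a \<in> M \<Longrightarrow> u \<otimes> a \<in> M'"
    and g: "\<And>i. i < k \<Longrightarrow> g i \<in> carrier R"
    and "x \<in> lin_span R M g k"
  shows "u \<otimes> x \<in> lin_span R M' g k"
  using g assms(5)
proof (induction k arbitrary: x)
  case (Suc k)
  obtain x' a where x: "x = x' \<oplus> a \<otimes> g k" "x' \<in> lin_span R M g k" "a \<in> M"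
    using Suc.prems(2) by (rule lin_span_SucE)
  have c: "x' \<in> carrier R" "a \<in> carrier R" "g k \<in> carrier R"
    using lin_span_closed[OF M _ x(2)] Suc.prems(1) x(3) M by auto
  have "u \<otimes> x = u \<otimes> x' \<oplus> (u \<otimes> a) \<otimes> g k"
    unfolding x(1) using c u by algebra
  moreover have "u \<otimes> x' \<in> lin_span R M' g k"
    using Suc.IH Suc.prems(1) x(2) by auto
  ultimately show ?case using uM[OF x(3)] by (simp only: lin_span_SucI)
qed (use u in simp)

text \<open>
  Nakayama's lemma for \<open>I = I\<^sup>2\<close> without determinants: if \<open>s I\<close> lies in the span of the first \<open>k + 1\<close>
  generators, then \<open>s I = s I\<^sup>2\<close> lies in their span with coefficients in \<open>I\<close>; writing
  \<open>s g\<^sub>k = y + a g\<^sub>k\<close> with \<open>a \<in> I\<close>, the element \<open>s (s - a)\<close> gets rid of \<open>g\<^sub>k\<close>.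
\<close>

lemma idempotent_ideal_step:
  assumes I: "ideal I R" and idem: "ideal_prod R I I = I" and g: "\<And>i. i < Suc k \<Longrightarrow> g i \<in> I"
    and s: "s \<in> carrier R" "\<one> \<ominus> s \<in> I" "\<And>x. x \<in> I \<Longrightarrow> s \<otimes> x \<in> lin_span R (carrier R) g (Suc k)"
  shows "\<exists>s'\<in>carrier R. \<one> \<ominus> s' \<in> I \<and> (\<forall>x\<in>I. s' \<otimes> x \<in> lin_span R (carrier R) g k)"
proof -
  interpret I: ideal I R by fact
  have gc: "\<And>i. i < Suc k \<Longrightarrow> g i \<in> carrier R" using g I.Icarr by blast
  \<comment> \<open>By idempotency x is a sum of products i j with both factors in I; s j has
    coefficients in the ring, and the factor i pushes them into I.\<close>
  have sI: "s \<otimes> x \<in> lin_span R I g (Suc k)" if "x \<in> I" for x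
  proof -
    have "x \<in> ideal_prod R I I" using that idem by simp
    then show ?thesis
    proof (induction x)
      case (prod i j)
      have "i \<otimes> (s \<otimes> j) \<in> lin_span R I g (Suc k)"
        by (rule lin_span_mult[OF _ _ _ gc s(3)[OF prod(2)]]) (use prod I.Icarr I.I_r_closed in auto)
      then show ?case using prod s(1) I.Icarr by (simp add: m_lcomm)
    next
      case (sum x y)
      then have "x \<in> carrier R" "y \<in> carrier R" using idem I.Icarr by auto
      then show ?case
        using lin_span_add[OF I gc sum.IH] s(1) by (simp add: r_distr)
    qed
  qed
  obtain y a where y: "s \<otimes> g k = y \<oplus> a \<otimes> g k" "y \<in> lin_span R I g k" "a \<in> I"
    using lin_span_SucE[OF sI[OF g[OF lessI]]] by blast
  have gc': "\<And>i. i < k \<Longrightarrow> g i \<in> carrier R" using gc by auto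
  have c: "y \<in> carrier R" "a \<in> carrier R" "g k \<in> carrier R"
    using lin_span_closed[OF I.a_subset gc' y(2)] y(3) I.Icarr gc by auto
  let ?s = "s \<otimes> (s \<ominus> a)"
  have "?s \<in> carrier R" using s(1) c by simp
  moreover have "\<one> \<ominus> ?s \<in> I"
  proof -
    \<comment> \<open>This is 1 - s^2 + s a with 1 - s^2 factored, so both summands visibly lie in
      I.\<close>
    have "\<one> \<ominus> ?s = (\<one> \<oplus> s) \<otimes> (\<one> \<ominus> s) \<oplus> s \<otimes> a"
      using s(1) c by algebra
    then show ?thesis
      using s(1,2) y(3) by (simp add: I.I_l_closed I.a_closed)
  qed
  moreover have "?s \<otimes> x \<in> lin_span R (carrier R) g k" if x: "x \<in> I" for x
  proof -
    obtain z b where z: "s \<otimes> x = z \<oplus> b \<otimes> g k" "z \<in> lin_span R I g k" "b \<in> I"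
      using lin_span_SucE[OF sI[OF x]] by blast
    have c': "z \<in> carrier R" "b \<in> carrier R" "x \<in> carrier R"
      using lin_span_closed[OF I.a_subset gc' z(2)] z(3) x I.Icarr by auto
    have "?s \<otimes> x = (s \<ominus> a) \<otimes> (s \<otimes> x)"
      using s(1) c c' by algebra
    \<comment> \<open>The coefficient b multiplies (s - a) g_k, and this equals y by the choice of
      a; the generator g_k has thus disappeared.\<close>
    also have "\<dots> = (s \<ominus> a) \<otimes> z \<oplus> b \<otimes> (s \<otimes> g k \<ominus> a \<otimes> g k)"
      unfolding z(1) using s(1) c c' by algebra
    also have "s \<otimes> g k \<ominus> a \<otimes> g k = y"
      unfolding y(1) using c by algebra
    finally have eq: "?s \<otimes> x = (s \<ominus> a) \<otimes> z \<oplus> b \<otimes> y" .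
    have "(s \<ominus> a) \<otimes> z \<in> lin_span R (carrier R) g k"
      by (rule lin_span_mult[OF _ _ _ gc' z(2)]) (use s(1) c I.Icarr in auto)
    moreover have "b \<otimes> y \<in> lin_span R (carrier R) g k"
      by (rule lin_span_mult[OF _ _ _ gc' y(2)]) (use c' I.Icarr in auto)
    ultimately show ?thesis
      unfolding eq by (intro lin_span_add oneideal gc')
  qed
  ultimately show ?thesis by blast
qed

text \<open>Starts from s = 1 and removes the generators one by one; the span of no generators is
  zero.\<close>

lemma idempotent_ideal_annihilator:
  assumes I: "ideal I R" and idem: "ideal_prod R I I = I" and g: "\<And>i. i < n \<Longrightarrow> g i \<in> I"
    and span: "I \<subseteq> lin_span R (carrier R) g n"
  obtains s where "s \<in> carrier R" "\<one> \<ominus> s \<in> I" "\<forall>x\<in>I. s \<otimes> x = \<zero>"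
proof -
  interpret I: ideal I R by fact
  have "\<exists>s\<in>carrier R. \<one> \<ominus> s \<in> I \<and> (\<forall>x\<in>I. s \<otimes> x \<in> lin_span R (carrier R) g n)"
  proof (intro bexI conjI ballI)
    show "\<one> \<ominus> \<one> \<in> I" by (simp add: minus_eq r_neg)
    show "\<one> \<otimes> x \<in> lin_span R (carrier R) g n" if "x \<in> I" for x
      using that span I.Icarr by auto
  qed simp
  then have "\<exists>s\<in>carrier R. \<one> \<ominus> s \<in> I \<and> (\<forall>x\<in>I. s \<otimes> x \<in> lin_span R (carrier R) g 0)"
    using g
  proof (induction n)
    case (Suc n)
    obtain s where s: "s \<in> carrier R" "\<one> \<ominus> s \<in> I" "\<And>x. x \<in> I \<Longrightarrow> s \<otimes> x \<in> lin_span R (carrier R) g (Suc n)"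
      using Suc.prems(1) by blast
    show ?case
    proof (rule Suc.IH)
      show "\<exists>s\<in>carrier R. \<one> \<ominus> s \<in> I \<and> (\<forall>x\<in>I. s \<otimes> x \<in> lin_span R (carrier R) g n)"
        by (rule idempotent_ideal_step[OF I idem Suc.prems(2) s])
      show "g i \<in> I" if "i < n" for i
        using that Suc.prems(2) by simp
    qed
  qed
  then obtain s where "s \<in> carrier R" "\<one> \<ominus> s \<in> I" "\<forall>x\<in>I. s \<otimes> x = \<zero>"
    unfolding lin_span.simps(1) singleton_iff by blast
  then show ?thesis using that by blast
qed

end

lemma finsum_additive:
  assumes "abelian_monoid G" "abelian_group H"
    and f: "\<And>x. x \<in> carrier G \<Longrightarrow> f x \<in> carrier H"
    and add: "\<And>x y. x \<in> carrier G \<Longrightarrow> y \<in> carrier G \<Longrightarrow> f (x \<oplus>\<^bsub>G\<^esub> y) = f x \<oplus>\<^bsub>H\<^esub> f y"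
    and "finite F" "g \<in> F \<rightarrow> carrier G"
  shows "f (\<Oplus>\<^bsub>G\<^esub>i\<in>F. g i) = (\<Oplus>\<^bsub>H\<^esub>i\<in>F. f (g i))"
proof -
  interpret G: abelian_monoid G by fact
  interpret H: abelian_group H by fact
  have "f \<zero>\<^bsub>G\<^esub> = \<zero>\<^bsub>H\<^esub>"
    using add[of "\<zero>\<^bsub>G\<^esub>" "\<zero>\<^bsub>G\<^esub>"] f[of "\<zero>\<^bsub>G\<^esub>"] by simp
  with assms(5,6) show ?thesis
    by (induction F rule: finite_induct) (auto simp: Pi_iff f add)
qed

lemma (in abelian_monoid) finsum_swap:
  assumes "finite E" "finite F" "\<And>i j. i \<in> E \<Longrightarrow> j \<in> F \<Longrightarrow> g i j \<in> carrier G"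
  shows "(\<Oplus>i\<in>E. \<Oplus>j\<in>F. g i j) = (\<Oplus>j\<in>F. \<Oplus>i\<in>E. g i j)"
  using assms(1,3)
proof (induction E rule: finite_induct)
  case empty
  then show ?case by (simp add: finsum_zero)
next
  case (insert x E)
  then have "(\<Oplus>j\<in>F. \<Oplus>i\<in>insert x E. g i j) = (\<Oplus>j\<in>F. g x j \<oplus> (\<Oplus>i\<in>E. g i j))"
    by (intro finsum_cong') (auto intro!: finsum_closed)
  also have "\<dots> = (\<Oplus>j\<in>F. g x j) \<oplus> (\<Oplus>j\<in>F. \<Oplus>i\<in>E. g i j)"
    using insert by (intro finsum_addf) (auto intro!: finsum_closed)
  finally show ?case
    using insert by (simp add: Pi_iff)
qed

section \<open>The trace of a finite projective algebra in dual-basis coordinates\<close>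

locale algebra_dual_basis = A: cring A + B: cring B
  for A (structure) and \<phi> and B (structure) +
  fixes n :: nat and e :: "nat \<Rightarrow> 'c" and c :: "nat \<Rightarrow> 'c \<Rightarrow> 'a"
  assumes \<phi>_hom: "\<phi> \<in> ring_hom A B"
    and dual: "dual_basis A \<phi> B n e c"
begin

lemma \<phi>_closed [simp]: "a \<in> carrier A \<Longrightarrow> \<phi> a \<in> carrier B"
  using \<phi>_hom by (rule ring_hom_closed)

lemma e_closed [simp]: "i < n \<Longrightarrow> e i \<in> carrier B"
  and c_closed [simp]: "i < n \<Longrightarrow> x \<in> carrier B \<Longrightarrow> c i x \<in> carrier A"
  and c_add: "i < n \<Longrightarrow> x \<in> carrier B \<Longrightarrow> y \<in> carrier B \<Longrightarrow> c i (x \<oplus>\<^bsub>B\<^esub> y) = c i x \<oplus>\<^bsub>A\<^esub> c i y"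
  and c_mult: "i < n \<Longrightarrow> a \<in> carrier A \<Longrightarrow> x \<in> carrier B \<Longrightarrow> c i (\<phi> a \<otimes>\<^bsub>B\<^esub> x) = a \<otimes>\<^bsub>A\<^esub> c i x"
  and expand: "x \<in> carrier B \<Longrightarrow> (\<Oplus>\<^bsub>B\<^esub>i\<in>{..<n}. \<phi> (c i x) \<otimes>\<^bsub>B\<^esub> e i) = x"
  using dual unfolding dual_basis_def by (auto simp: Pi_iff)

definition tr :: "'c \<Rightarrow> 'a" where
  "tr b = (\<Oplus>\<^bsub>A\<^esub>i\<in>{..<n}. c i (b \<otimes>\<^bsub>B\<^esub> e i))"

lemma tr_closed [simp]: "b \<in> carrier B \<Longrightarrow> tr b \<in> carrier A"
  unfolding tr_def by (intro A.finsum_closed) auto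

lemma tr_add:
  assumes "x \<in> carrier B" "y \<in> carrier B"
  shows "tr (x \<oplus>\<^bsub>B\<^esub> y) = tr x \<oplus>\<^bsub>A\<^esub> tr y"
proof -
  have "tr (x \<oplus>\<^bsub>B\<^esub> y) = (\<Oplus>\<^bsub>A\<^esub>i\<in>{..<n}. c i (x \<otimes>\<^bsub>B\<^esub> e i) \<oplus>\<^bsub>A\<^esub> c i (y \<otimes>\<^bsub>B\<^esub> e i))"
    unfolding tr_def using assms by (intro A.finsum_cong') (auto simp: B.l_distr c_add)
  then show ?thesis
    unfolding tr_def using assms by (subst A.finsum_addf[symmetric]) auto
qed

lemma tr_mult:
  assumes "a \<in> carrier A" "x \<in> carrier B"
  shows "tr (\<phi> a \<otimes>\<^bsub>B\<^esub> x) = a \<otimes>\<^bsub>A\<^esub> tr x"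
proof -
  have "tr (\<phi> a \<otimes>\<^bsub>B\<^esub> x) = (\<Oplus>\<^bsub>A\<^esub>i\<in>{..<n}. a \<otimes>\<^bsub>A\<^esub> c i (x \<otimes>\<^bsub>B\<^esub> e i))"
    unfolding tr_def using assms by (intro A.finsum_cong') (auto simp: B.m_assoc c_mult)
  then show ?thesis
    unfolding tr_def using assms by (subst A.finsum_rdistr) auto
qed

text \<open>The usual tr(PQ) = tr(QP) argument: expand each b e_i in the second system, exchange the
  sums, and recombine with the first system.\<close>

lemma tr_independent:
  assumes "dual_basis A \<phi> B n' e' c'" and b: "b \<in> carrier B"
  shows "(\<Oplus>\<^bsub>A\<^esub>i\<in>{..<n'}. c' i (b \<otimes>\<^bsub>B\<^esub> e' i)) = tr b"
proof -
  interpret D: algebra_dual_basis A \<phi> B n' e' c'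
    by unfold_locales (fact \<phi>_hom assms(1))+
  have "tr b = (\<Oplus>\<^bsub>A\<^esub>i\<in>{..<n}. \<Oplus>\<^bsub>A\<^esub>j\<in>{..<n'}. c' j (b \<otimes>\<^bsub>B\<^esub> e i) \<otimes>\<^bsub>A\<^esub> c i (e' j))"
    unfolding tr_def
  proof (intro A.finsum_cong' refl)
    fix i assume i: "i \<in> {..<n}"
    have be: "b \<otimes>\<^bsub>B\<^esub> e i \<in> carrier B" using i b by simp
    have "c i (b \<otimes>\<^bsub>B\<^esub> e i) = c i (\<Oplus>\<^bsub>B\<^esub>j\<in>{..<n'}. \<phi> (c' j (b \<otimes>\<^bsub>B\<^esub> e i)) \<otimes>\<^bsub>B\<^esub> e' j)"
      by (simp only: D.expand[OF be])
    also have "\<dots> = (\<Oplus>\<^bsub>A\<^esub>j\<in>{..<n'}. c i (\<phi> (c' j (b \<otimes>\<^bsub>B\<^esub> e i)) \<otimes>\<^bsub>B\<^esub> e' j))"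
      using i be by (intro finsum_additive[OF B.abelian_monoid_axioms A.abelian_group_axioms]) (auto simp: c_add)
    also have "\<dots> = (\<Oplus>\<^bsub>A\<^esub>j\<in>{..<n'}. c' j (b \<otimes>\<^bsub>B\<^esub> e i) \<otimes>\<^bsub>A\<^esub> c i (e' j))"
      using i be by (intro A.finsum_cong') (auto simp: c_mult)
    finally show "c i (b \<otimes>\<^bsub>B\<^esub> e i) = (\<Oplus>\<^bsub>A\<^esub>j\<in>{..<n'}. c' j (b \<otimes>\<^bsub>B\<^esub> e i) \<otimes>\<^bsub>A\<^esub> c i (e' j))" .
  qed (use b in \<open>auto intro!: A.finsum_closed\<close>)
  also have "\<dots> = (\<Oplus>\<^bsub>A\<^esub>j\<in>{..<n'}. \<Oplus>\<^bsub>A\<^esub>i\<in>{..<n}. c' j (b \<otimes>\<^bsub>B\<^esub> e i) \<otimes>\<^bsub>A\<^esub> c i (e' j))"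
    using b by (intro A.finsum_swap) auto
  also have "\<dots> = (\<Oplus>\<^bsub>A\<^esub>j\<in>{..<n'}. c' j (b \<otimes>\<^bsub>B\<^esub> e' j))"
  proof (intro A.finsum_cong' refl)
    fix j assume j: "j \<in> {..<n'}"
    then have ej: "e' j \<in> carrier B" by simp
    have "(\<Oplus>\<^bsub>A\<^esub>i\<in>{..<n}. c' j (b \<otimes>\<^bsub>B\<^esub> e i) \<otimes>\<^bsub>A\<^esub> c i (e' j))
      = (\<Oplus>\<^bsub>A\<^esub>i\<in>{..<n}. c' j (b \<otimes>\<^bsub>B\<^esub> (\<phi> (c i (e' j)) \<otimes>\<^bsub>B\<^esub> e i)))"
      \<comment> \<open>The scalar c_i(e'_j) is pulled into the argument of c'_j, so that the sum
        over i there becomes the expansion of e'_j.\<close>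
      using b j ej by (intro A.finsum_cong') (auto simp: B.m_lcomm[of b] D.c_mult A.m_comm)
    also have "\<dots> = c' j (\<Oplus>\<^bsub>B\<^esub>i\<in>{..<n}. b \<otimes>\<^bsub>B\<^esub> (\<phi> (c i (e' j)) \<otimes>\<^bsub>B\<^esub> e i))"
      using b j ej
      by (intro finsum_additive[OF B.abelian_monoid_axioms A.abelian_group_axioms, symmetric]) (auto simp: D.c_add)
    also have "(\<Oplus>\<^bsub>B\<^esub>i\<in>{..<n}. b \<otimes>\<^bsub>B\<^esub> (\<phi> (c i (e' j)) \<otimes>\<^bsub>B\<^esub> e i)) = b \<otimes>\<^bsub>B\<^esub> e' j"
      using b ej by (subst B.finsum_rdistr[symmetric]) (auto simp: expand)
    finally show "(\<Oplus>\<^bsub>A\<^esub>i\<in>{..<n}. c' j (b \<otimes>\<^bsub>B\<^esub> e i) \<otimes>\<^bsub>A\<^esub> c i (e' j)) = c' j (b \<otimes>\<^bsub>B\<^esub> e' j)" .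
  qed (use b in auto)
  finally show ?thesis ..
qed

lemma alg_trace_eq:
  assumes "b \<in> carrier B"
  shows "alg_trace A \<phi> B b = tr b"
  unfolding alg_trace_def
proof (rule the_equality)
  show "\<exists>n e c. dual_basis A \<phi> B n e c \<and> tr b = (\<Oplus>\<^bsub>A\<^esub>i\<in>{..<n}. c i (b \<otimes>\<^bsub>B\<^esub> e i))"
    using dual tr_def by blast
qed (use tr_independent[OF _ assms] in auto)

section \<open>The tensor square of B over A and its diagonal ideal\<close>

sublocale tensor_pair A \<phi> B \<phi> B
  by unfold_locales auto

lemma mult_hom: "tensor_lift B (\<lambda>x. x) (\<lambda>x. x) \<in> ring_hom ST B"
  and mult_pt: "x \<in> carrier B \<Longrightarrow> y \<in> carrier B \<Longrightarrow> tensor_lift B (\<lambda>x. x) (\<lambda>x. x) (pt x y) = x \<otimes>\<^bsub>B\<^esub> y"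
proof -
  have id: "(\<lambda>x. x) \<in> ring_hom B B" by (rule ring_hom_memI) auto
  show "tensor_lift B (\<lambda>x. x) (\<lambda>x. x) \<in> ring_hom ST B"
    by (rule tensor_lift_hom[OF B.is_cring id id]) simp
  show "x \<in> carrier B \<Longrightarrow> y \<in> carrier B \<Longrightarrow> tensor_lift B (\<lambda>x. x) (\<lambda>x. x) (pt x y) = x \<otimes>\<^bsub>B\<^esub> y"
    by (rule tensor_lift_pt[OF B.is_cring id id]) simp_all
qed

text \<open>The contraction c_j \<otimes> id. With B acting through the second factor, these are the
  coordinate functions that go with the elements e_j \<otimes> 1 of the tensor square.\<close>

definition coeff_map :: "nat \<Rightarrow> ('c \<times> 'c \<Rightarrow>\<^sub>0 int) set \<Rightarrow> 'c" where
  "coeff_map j = tensor_map B (\<lambda>(x, y). \<phi> (c j x) \<otimes>\<^bsub>B\<^esub> y)"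

definition trace_map :: "('c \<times> 'c \<Rightarrow>\<^sub>0 int) set \<Rightarrow> 'c" where
  "trace_map = tensor_map B (\<lambda>(x, y). \<phi> (tr x) \<otimes>\<^bsub>B\<^esub> y)"

lemma coeff_map_balanced: "j < n \<Longrightarrow> balanced B (\<lambda>(x, y). \<phi> (c j x) \<otimes>\<^bsub>B\<^esub> y)"
  by (auto simp: balanced_def c_add c_mult ring_hom_add[OF \<phi>_hom] ring_hom_mult[OF \<phi>_hom] B.l_distr B.r_distr B.m_assoc B.m_lcomm)

lemma trace_map_balanced: "balanced B (\<lambda>(x, y). \<phi> (tr x) \<otimes>\<^bsub>B\<^esub> y)"
  by (auto simp: balanced_def tr_add tr_mult ring_hom_add[OF \<phi>_hom] ring_hom_mult[OF \<phi>_hom] B.l_distr B.r_distr B.m_assoc B.m_lcomm)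

lemmas coeff_map =
  tensor_map_closed[OF B.abelian_group_axioms coeff_map_balanced, folded coeff_map_def]
  tensor_map_add[OF B.abelian_group_axioms coeff_map_balanced, folded coeff_map_def]
  tensor_map_pt[OF B.abelian_group_axioms coeff_map_balanced, folded coeff_map_def, simplified]

lemmas trace_map =
  tensor_map_closed[OF B.abelian_group_axioms trace_map_balanced, folded trace_map_def]
  tensor_map_add[OF B.abelian_group_axioms trace_map_balanced, folded trace_map_def]
  tensor_map_pt[OF B.abelian_group_axioms trace_map_balanced, folded trace_map_def, simplified]

lemma coeff_map_mult_right:
  assumes "j < n" "z \<in> carrier ST" "y \<in> carrier B"
  shows "coeff_map j (z \<otimes>\<^bsub>ST\<^esub> pt \<one>\<^bsub>B\<^esub> y) = coeff_map j z \<otimes>\<^bsub>B\<^esub> y"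
  using assms(2,1,3)
  by (induction z rule: tensor_induct) (simp_all add: coeff_map pt_mult B.m_assoc ST.l_distr B.l_distr)

text \<open>Base change of the trace: the right-hand side is the trace of multiplication by z on the
  tensor square over its second factor, computed with the e_j \<otimes> 1, while the left-hand side
  applies Tr \<otimes> id.\<close>

lemma trace_map_eq:
  assumes "z \<in> carrier ST"
  shows "trace_map z = (\<Oplus>\<^bsub>B\<^esub>j\<in>{..<n}. coeff_map j (z \<otimes>\<^bsub>ST\<^esub> pt (e j) \<one>\<^bsub>B\<^esub>))"
  using assms
proof (induction z rule: tensor_induct)
  case (pure x y)
  have "\<phi> (tr x) = (\<Oplus>\<^bsub>B\<^esub>j\<in>{..<n}. \<phi> (c j (x \<otimes>\<^bsub>B\<^esub> e j)))"
    unfolding tr_def using pure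
    by (intro finsum_additive[OF A.abelian_monoid_axioms B.abelian_group_axioms])
       (auto simp: ring_hom_add[OF \<phi>_hom])
  then have "trace_map (pt x y) = (\<Oplus>\<^bsub>B\<^esub>j\<in>{..<n}. \<phi> (c j (x \<otimes>\<^bsub>B\<^esub> e j)) \<otimes>\<^bsub>B\<^esub> y)"
    using pure by (simp add: trace_map B.finsum_ldistr Pi_iff)
  also have "\<dots> = (\<Oplus>\<^bsub>B\<^esub>j\<in>{..<n}. coeff_map j (pt x y \<otimes>\<^bsub>ST\<^esub> pt (e j) \<one>\<^bsub>B\<^esub>))"
    using pure by (intro B.finsum_cong') (auto simp: pt_mult coeff_map)
  finally show ?case .
next
  case (add z w)
  have "(\<Oplus>\<^bsub>B\<^esub>j\<in>{..<n}. coeff_map j ((z \<oplus>\<^bsub>ST\<^esub> w) \<otimes>\<^bsub>ST\<^esub> pt (e j) \<one>\<^bsub>B\<^esub>)) =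
    (\<Oplus>\<^bsub>B\<^esub>j\<in>{..<n}. coeff_map j (z \<otimes>\<^bsub>ST\<^esub> pt (e j) \<one>\<^bsub>B\<^esub>) \<oplus>\<^bsub>B\<^esub> coeff_map j (w \<otimes>\<^bsub>ST\<^esub> pt (e j) \<one>\<^bsub>B\<^esub>))"
    using add(1,2) by (intro B.finsum_cong') (auto simp: coeff_map ST.l_distr)
  also have "\<dots> = trace_map z \<oplus>\<^bsub>B\<^esub> trace_map w"
    unfolding add(3,4) using add(1,2) by (intro B.finsum_addf) (auto simp: coeff_map)
  finally show ?case using add(1,2) by (simp add: trace_map)
qed

text \<open>The multiplication map applied to the expansion of z in the elements e_j \<otimes>
  1.\<close>

lemma mult_eq_coeff_map:
  assumes "z \<in> carrier ST"
  shows "tensor_lift B (\<lambda>x. x) (\<lambda>x. x) z = (\<Oplus>\<^bsub>B\<^esub>j\<in>{..<n}. coeff_map j z \<otimes>\<^bsub>B\<^esub> e j)"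
  using assms
proof (induction z rule: tensor_induct)
  case (pure x y)
  have "(\<Oplus>\<^bsub>B\<^esub>j\<in>{..<n}. coeff_map j (pt x y) \<otimes>\<^bsub>B\<^esub> e j) = (\<Oplus>\<^bsub>B\<^esub>j\<in>{..<n}. \<phi> (c j x) \<otimes>\<^bsub>B\<^esub> e j \<otimes>\<^bsub>B\<^esub> y)"
    using pure by (intro B.finsum_cong') (auto simp: coeff_map B.m_ac)
  also have "\<dots> = x \<otimes>\<^bsub>B\<^esub> y"
    using pure by (subst B.finsum_ldistr[symmetric]) (auto simp: expand)
  finally show ?case using pure by (simp add: mult_pt)
next
  case (add z w)
  have "(\<Oplus>\<^bsub>B\<^esub>j\<in>{..<n}. coeff_map j (z \<oplus>\<^bsub>ST\<^esub> w) \<otimes>\<^bsub>B\<^esub> e j) =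
    (\<Oplus>\<^bsub>B\<^esub>j\<in>{..<n}. coeff_map j z \<otimes>\<^bsub>B\<^esub> e j \<oplus>\<^bsub>B\<^esub> coeff_map j w \<otimes>\<^bsub>B\<^esub> e j)"
    using add(1,2) by (intro B.finsum_cong') (auto simp: coeff_map B.l_distr)
  also have "\<dots> = tensor_lift B (\<lambda>x. x) (\<lambda>x. x) z \<oplus>\<^bsub>B\<^esub> tensor_lift B (\<lambda>x. x) (\<lambda>x. x) w"
    unfolding add(3,4) using add(1,2) by (intro B.finsum_addf) (auto simp: coeff_map)
  finally show ?case using add(1,2) by (simp add: ring_hom_add[OF mult_hom])
qed

text \<open>Modulo the square of the diagonal ideal this is, up to sign, the universal differential
  of b.\<close>

definition diff_tensor :: "'c \<Rightarrow> ('c \<times> 'c \<Rightarrow>\<^sub>0 int) set" where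
  "diff_tensor b = pt b \<one>\<^bsub>B\<^esub> \<ominus>\<^bsub>ST\<^esub> pt \<one>\<^bsub>B\<^esub> b"

lemma diff_tensor_closed [simp]: "b \<in> carrier B \<Longrightarrow> diff_tensor b \<in> carrier ST"
  by (simp add: diff_tensor_def)

lemma diff_tensor_scale:
  assumes "a \<in> carrier A" "b \<in> carrier B"
  shows "diff_tensor (\<phi> a \<otimes>\<^bsub>B\<^esub> b) = pt (\<phi> a) \<one>\<^bsub>B\<^esub> \<otimes>\<^bsub>ST\<^esub> diff_tensor b"
proof -
  have "pt (\<phi> a) b = pt \<one>\<^bsub>B\<^esub> (\<phi> a \<otimes>\<^bsub>B\<^esub> b)"
    using pt_balance[of a "\<one>\<^bsub>B\<^esub>" b] assms by simp
  then show ?thesis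
    using assms by (simp add: diff_tensor_def ST.minus_eq ST.r_distr ST.r_minus pt_mult)
qed

lemma diff_tensor_add:
  assumes "a \<in> carrier B" "b \<in> carrier B"
  shows "diff_tensor (a \<oplus>\<^bsub>B\<^esub> b) = diff_tensor a \<oplus>\<^bsub>ST\<^esub> diff_tensor b"
proof -
  have "p \<oplus>\<^bsub>ST\<^esub> q \<ominus>\<^bsub>ST\<^esub> (p' \<oplus>\<^bsub>ST\<^esub> q') = (p \<ominus>\<^bsub>ST\<^esub> p') \<oplus>\<^bsub>ST\<^esub> (q \<ominus>\<^bsub>ST\<^esub> q')"
    if "p \<in> carrier ST" "q \<in> carrier ST" "p' \<in> carrier ST" "q' \<in> carrier ST" for p q p' q'
    using that by (simp add: ST.minus_eq ST.minus_add ST.a_ac)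
  then show ?thesis
    using assms by (simp add: diff_tensor_def pt_add_left pt_add_right)
qed

text \<open>The assignment b \<mapsto> b \<otimes> 1 - 1 \<otimes> b is A-linear, because scalars
  cross the tensor sign; expanding b in the e_i therefore suffices. Partial sums follow the
  recursion of \<open>lin_span\<close>.\<close>

lemma diff_tensor_span:
  assumes b: "b \<in> carrier B"
  shows "diff_tensor b \<in> lin_span ST (carrier ST) (\<lambda>i. diff_tensor (e i)) n"
proof -
  have "diff_tensor (\<Oplus>\<^bsub>B\<^esub>i\<in>{..<m}. \<phi> (c i b) \<otimes>\<^bsub>B\<^esub> e i) \<in> lin_span ST (carrier ST) (\<lambda>i. diff_tensor (e i)) m"
    if "m \<le> n" for m
    using that
  proof (induction m)
    case 0
    then show ?case by (simp add: diff_tensor_def pt_zero_left pt_zero_right ST.minus_eq)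
  next
    case (Suc m)
    have cl: "\<phi> (c i b) \<otimes>\<^bsub>B\<^esub> e i \<in> carrier B" if "i < Suc m" for i
      using that Suc.prems b by simp
    have "(\<Oplus>\<^bsub>B\<^esub>i\<in>{..<Suc m}. \<phi> (c i b) \<otimes>\<^bsub>B\<^esub> e i) =
      (\<Oplus>\<^bsub>B\<^esub>i\<in>{..<m}. \<phi> (c i b) \<otimes>\<^bsub>B\<^esub> e i) \<oplus>\<^bsub>B\<^esub> \<phi> (c m b) \<otimes>\<^bsub>B\<^esub> e m"
      using cl by (simp add: lessThan_Suc B.finsum_insert Pi_iff B.a_comm B.finsum_closed)
    moreover have "(\<Oplus>\<^bsub>B\<^esub>i\<in>{..<m}. \<phi> (c i b) \<otimes>\<^bsub>B\<^esub> e i) \<in> carrier B"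
      using cl by (intro B.finsum_closed) auto
    ultimately have "diff_tensor (\<Oplus>\<^bsub>B\<^esub>i\<in>{..<Suc m}. \<phi> (c i b) \<otimes>\<^bsub>B\<^esub> e i) =
      diff_tensor (\<Oplus>\<^bsub>B\<^esub>i\<in>{..<m}. \<phi> (c i b) \<otimes>\<^bsub>B\<^esub> e i) \<oplus>\<^bsub>ST\<^esub> pt (\<phi> (c m b)) \<one>\<^bsub>B\<^esub> \<otimes>\<^bsub>ST\<^esub> diff_tensor (e m)"
      using Suc.prems b by (simp add: diff_tensor_add diff_tensor_scale)
    moreover have "pt (\<phi> (c m b)) \<one>\<^bsub>B\<^esub> \<in> carrier ST"
      using Suc.prems b by simp
    ultimately show ?case
      using lin_span_SucI[of _ ST "carrier ST" "\<lambda>i. diff_tensor (e i)" m] Suc by simp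
  qed
  from this[of n] show ?thesis using expand[OF b] by simp
qed

text \<open>For a pure tensor the difference is (1 \<otimes> y)(x \<otimes> 1 - 1 \<otimes> x). On
  the diagonal ideal the subtracted term vanishes, so the lemma yields a finite set of
  generators.\<close>

lemma tensor_minus_mult_span:
  assumes "z \<in> carrier ST"
  shows "z \<ominus>\<^bsub>ST\<^esub> pt \<one>\<^bsub>B\<^esub> (tensor_lift B (\<lambda>x. x) (\<lambda>x. x) z) \<in> lin_span ST (carrier ST) (\<lambda>i. diff_tensor (e i)) n"
  using assms
proof (induction z rule: tensor_induct)
  case (pure x y)
  have "pt x y \<ominus>\<^bsub>ST\<^esub> pt \<one>\<^bsub>B\<^esub> (x \<otimes>\<^bsub>B\<^esub> y) = pt \<one>\<^bsub>B\<^esub> y \<otimes>\<^bsub>ST\<^esub> diff_tensor x"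
    using pure by (simp add: diff_tensor_def ST.minus_eq ST.r_distr ST.r_minus pt_mult B.m_comm)
  moreover have "pt \<one>\<^bsub>B\<^esub> y \<otimes>\<^bsub>ST\<^esub> diff_tensor x \<in> lin_span ST (carrier ST) (\<lambda>i. diff_tensor (e i)) n"
    by (rule ST.lin_span_mult[OF _ _ _ _ diff_tensor_span]) (use pure in auto)
  ultimately show ?case using pure by (simp add: mult_pt)
next
  case (add z w)
  let ?\<mu> = "tensor_lift B (\<lambda>x. x) (\<lambda>x. x)"
  have c: "?\<mu> z \<in> carrier B" "?\<mu> w \<in> carrier B"
    using add(1,2) ring_hom_closed[OF mult_hom] by auto
  then have "z \<oplus>\<^bsub>ST\<^esub> w \<ominus>\<^bsub>ST\<^esub> pt \<one>\<^bsub>B\<^esub> (?\<mu> (z \<oplus>\<^bsub>ST\<^esub> w)) =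
    (z \<ominus>\<^bsub>ST\<^esub> pt \<one>\<^bsub>B\<^esub> (?\<mu> z)) \<oplus>\<^bsub>ST\<^esub> (w \<ominus>\<^bsub>ST\<^esub> pt \<one>\<^bsub>B\<^esub> (?\<mu> w))"
    using add(1,2) by (simp add: ring_hom_add[OF mult_hom] pt_add_right ST.minus_eq ST.minus_add ST.a_ac)
  also have "\<dots> \<in> lin_span ST (carrier ST) (\<lambda>i. diff_tensor (e i)) n"
    by (rule ST.lin_span_add[OF ST.oneideal _ add(3,4)]) simp
  finally show ?case .
qed

lemma mult_diff:
  assumes "x \<in> carrier ST" "y \<in> carrier ST"
  shows "tensor_lift B (\<lambda>x. x) (\<lambda>x. x) (x \<ominus>\<^bsub>ST\<^esub> y) =
    tensor_lift B (\<lambda>x. x) (\<lambda>x. x) x \<ominus>\<^bsub>B\<^esub> tensor_lift B (\<lambda>x. x) (\<lambda>x. x) y"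
proof -
  interpret ring_hom_ring ST B "tensor_lift B (\<lambda>x. x) (\<lambda>x. x)"
    by (rule ring_hom_ringI2[OF ST.ring_axioms B.ring_axioms mult_hom])
  show ?thesis
    using assms by (simp only: ST.minus_eq B.minus_eq hom_add hom_a_inv ST.a_inv_closed)
qed

lemma diagonal_ideal_iff:
  "x \<in> diagonal_ideal A \<phi> B \<longleftrightarrow> x \<in> carrier ST \<and> tensor_lift B (\<lambda>x. x) (\<lambda>x. x) x = \<zero>\<^bsub>B\<^esub>"
  unfolding diagonal_ideal_def a_kernel_def' by blast

lemma diff_tensor_diagonal: "b \<in> carrier B \<Longrightarrow> diff_tensor b \<in> diagonal_ideal A \<phi> B"
  by (simp add: diagonal_ideal_iff diff_tensor_def mult_diff mult_pt)

text \<open>The element s is a separability element, and the formula says that its two legs are dual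
  for the trace form. Phrasing it through \<open>trace_map\<close> avoids an expansion of s into
  pure tensors.\<close>

lemma unramified_trace_dual:
  assumes "unramified A \<phi> B"
  obtains s where "s \<in> carrier ST" "\<forall>b\<in>carrier B. trace_map (s \<otimes>\<^bsub>ST\<^esub> pt b \<one>\<^bsub>B\<^esub>) = b"
proof -
  let ?\<mu> = "tensor_lift B (\<lambda>x. x) (\<lambda>x. x)"
  let ?I = "diagonal_ideal A \<phi> B"
  note I = diagonal_ideal_iff
  note dI = diff_tensor_diagonal
  have span: "?I \<subseteq> lin_span ST (carrier ST) (\<lambda>i. diff_tensor (e i)) n"
  proof
    fix z assume z: "z \<in> ?I"
    then have "z \<ominus>\<^bsub>ST\<^esub> pt \<one>\<^bsub>B\<^esub> (?\<mu> z) = z"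
      by (simp add: I pt_zero_right ST.minus_eq)
    moreover have "z \<in> carrier ST" using z I by blast
    ultimately show "z \<in> lin_span ST (carrier ST) (\<lambda>i. diff_tensor (e i)) n"
      using tensor_minus_mult_span[of z] by metis
  qed
  have ideal: "ideal ?I ST"
    unfolding diagonal_ideal_def
    by (rule ring_hom_ring.kernel_is_ideal[OF ring_hom_ringI2[OF ST.ring_axioms B.ring_axioms mult_hom]])
  have idem: "ideal_prod ST ?I ?I = ?I"
    using assms by (simp add: unramified_def)
  obtain s where s: "s \<in> carrier ST" "\<one>\<^bsub>ST\<^esub> \<ominus>\<^bsub>ST\<^esub> s \<in> ?I" "\<forall>x\<in>?I. s \<otimes>\<^bsub>ST\<^esub> x = \<zero>\<^bsub>ST\<^esub>"
    by (rule ST.idempotent_ideal_annihilator[OF ideal idem dI[OF e_closed] span])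
  have "?\<mu> \<one>\<^bsub>ST\<^esub> \<ominus>\<^bsub>B\<^esub> ?\<mu> s = \<zero>\<^bsub>B\<^esub>"
    using s(2) I mult_diff[OF ST.one_closed s(1)] by metis
  then have "\<one>\<^bsub>B\<^esub> \<ominus>\<^bsub>B\<^esub> ?\<mu> s = \<zero>\<^bsub>B\<^esub>"
    by (simp only: ring_hom_one[OF mult_hom])
  then have \<mu>s: "?\<mu> s = \<one>\<^bsub>B\<^esub>"
    using B.r_right_minus_eq[OF B.one_closed ring_hom_closed[OF mult_hom s(1)]] by metis
  have comm: "s \<otimes>\<^bsub>ST\<^esub> pt b \<one>\<^bsub>B\<^esub> = s \<otimes>\<^bsub>ST\<^esub> pt \<one>\<^bsub>B\<^esub> b" if b: "b \<in> carrier B" for b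
  proof -
    have c: "s \<otimes>\<^bsub>ST\<^esub> pt b \<one>\<^bsub>B\<^esub> \<in> carrier ST" "s \<otimes>\<^bsub>ST\<^esub> pt \<one>\<^bsub>B\<^esub> b \<in> carrier ST"
      using s(1) b by auto
    have "s \<otimes>\<^bsub>ST\<^esub> diff_tensor b = s \<otimes>\<^bsub>ST\<^esub> pt b \<one>\<^bsub>B\<^esub> \<ominus>\<^bsub>ST\<^esub> s \<otimes>\<^bsub>ST\<^esub> pt \<one>\<^bsub>B\<^esub> b"
      using s(1) b by (simp add: diff_tensor_def ST.minus_eq ST.r_distr ST.r_minus)
    then show ?thesis
      using bspec[OF s(3) dI[OF b]] ST.r_right_minus_eq[OF c] by metis
  qed
  have "trace_map (s \<otimes>\<^bsub>ST\<^esub> pt b \<one>\<^bsub>B\<^esub>) = b" if b: "b \<in> carrier B" for b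
  proof -
    have "trace_map (s \<otimes>\<^bsub>ST\<^esub> pt b \<one>\<^bsub>B\<^esub>) =
      (\<Oplus>\<^bsub>B\<^esub>j\<in>{..<n}. coeff_map j (s \<otimes>\<^bsub>ST\<^esub> pt b \<one>\<^bsub>B\<^esub> \<otimes>\<^bsub>ST\<^esub> pt (e j) \<one>\<^bsub>B\<^esub>))"
      using s(1) b by (simp add: trace_map_eq)
    also have "\<dots> = (\<Oplus>\<^bsub>B\<^esub>j\<in>{..<n}. b \<otimes>\<^bsub>B\<^esub> (coeff_map j s \<otimes>\<^bsub>B\<^esub> e j))"
    proof (intro B.finsum_cong' refl)
      fix j assume j: "j \<in> {..<n}"
      \<comment> \<open>All of b e_j is moved to the second factor, in which
        \<open>coeff_map\<close> is linear over B; what remains is the expansion of the product of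
        the legs of s.\<close>
      have "s \<otimes>\<^bsub>ST\<^esub> pt b \<one>\<^bsub>B\<^esub> \<otimes>\<^bsub>ST\<^esub> pt (e j) \<one>\<^bsub>B\<^esub> = s \<otimes>\<^bsub>ST\<^esub> pt (b \<otimes>\<^bsub>B\<^esub> e j) \<one>\<^bsub>B\<^esub>"
        using s(1) b j by (simp add: ST.m_assoc pt_mult)
      also have "\<dots> = s \<otimes>\<^bsub>ST\<^esub> pt \<one>\<^bsub>B\<^esub> (b \<otimes>\<^bsub>B\<^esub> e j)"
        using b j by (intro comm) auto
      finally show "coeff_map j (s \<otimes>\<^bsub>ST\<^esub> pt b \<one>\<^bsub>B\<^esub> \<otimes>\<^bsub>ST\<^esub> pt (e j) \<one>\<^bsub>B\<^esub>) = b \<otimes>\<^bsub>B\<^esub> (coeff_map j s \<otimes>\<^bsub>B\<^esub> e j)"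
        using s(1) b j by (simp add: coeff_map_mult_right coeff_map B.m_lcomm)
    qed (use s(1) b in \<open>auto simp: coeff_map\<close>)
    also have "\<dots> = b \<otimes>\<^bsub>B\<^esub> ?\<mu> s"
      using s(1) b by (subst B.finsum_rdistr[symmetric]) (auto simp: coeff_map mult_eq_coeff_map)
    finally show ?thesis using b by (simp add: \<mu>s)
  qed
  then have "\<forall>b\<in>carrier B. trace_map (s \<otimes>\<^bsub>ST\<^esub> pt b \<one>\<^bsub>B\<^esub>) = b" by (rule ballI)
  with s(1) show ?thesis by (rule that)
qed

end

section \<open>The comparison map of a completed algebra\<close>

text \<open>Here S stands for the later \<open>B\<^sub>0\<close>. The etale algebra is absent; what
  the trace contributes enters only through the assumption that some multiplication is
  \<open>extendable\<close>.\<close>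

locale completed_algebra = loc_hom R t S u f + S: regular_elem S u
  for R (structure) and t and S (structure) and u and f
begin

abbreviation "\<alpha> \<equiv> to_completion R t"
abbreviation "\<beta> \<equiv> to_completion S u"

lemma \<alpha>_closed: "r \<in> carrier R \<Longrightarrow> \<alpha> r \<in> carrier R.C"
  by (rule ring_hom_closed[OF R.to_completion_hom])

lemma \<beta>_closed: "b \<in> carrier S \<Longrightarrow> \<beta> b \<in> carrier S.C"
  by (rule ring_hom_closed[OF S.to_completion_hom])

sublocale tp: tensor_pair R f S "to_completion R t" "completion R t"
  by (unfold_locales) (auto intro: f_closed \<alpha>_closed)

abbreviation "T \<equiv> tensor_product R f S (to_completion R t) (completion R t)"
abbreviation "\<tau> \<equiv> tensor_struct R f S (to_completion R t) (completion R t)"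

definition \<nu> where "\<nu> = tensor_lift S.C \<beta> hat"

lemma \<nu>_hom: "\<nu> \<in> ring_hom T S.C"
  unfolding \<nu>_def
  by (rule tp.tensor_lift_hom[OF S.cring_completion S.to_completion_hom hat_hom]) (simp add: hat_to_completion)

lemma \<nu>_pt:
  assumes "b \<in> carrier S" "a \<in> carrier R.C"
  shows "\<nu> (tp.pt b a) = \<beta> b \<otimes>\<^bsub>S.C\<^esub> hat a"
  unfolding \<nu>_def
  by (rule tp.tensor_lift_pt[OF S.cring_completion S.to_completion_hom hat_hom _ assms]) (simp add: hat_to_completion)

lemma \<tau>_eq: "\<tau> r = tp.pt (f r) \<one>\<^bsub>R.C\<^esub>"
  by (simp add: tensor_struct_def)

lemma \<tau>_hom: "\<tau> \<in> ring_hom R T"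
proof (rule ring_hom_memI)
  fix x y assume xy: "x \<in> carrier R" "y \<in> carrier R"
  show "\<tau> x \<in> carrier T" using xy by (simp add: \<tau>_eq f_closed)
  show "\<tau> (x \<otimes>\<^bsub>R\<^esub> y) = \<tau> x \<otimes>\<^bsub>T\<^esub> \<tau> y"
    using xy by (simp add: \<tau>_eq tp.pt_mult f_closed ring_hom_mult[OF f_hom])
  show "\<tau> (x \<oplus>\<^bsub>R\<^esub> y) = \<tau> x \<oplus>\<^bsub>T\<^esub> \<tau> y"
    using xy by (simp add: \<tau>_eq tp.pt_add_left f_closed f_add)
next
  show "\<tau> \<one>\<^bsub>R\<^esub> = \<one>\<^bsub>T\<^esub>"
    by (simp add: \<tau>_eq tp.pt_one ring_hom_one[OF f_hom])
qed

lemma \<tau>_closed: "r \<in> carrier R \<Longrightarrow> \<tau> r \<in> carrier T"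
  by (rule ring_hom_closed[OF \<tau>_hom])

lemma \<nu>_\<tau>: "r \<in> carrier R \<Longrightarrow> \<nu> (\<tau> r) = \<beta> (f r)"
  using ring_hom_one[OF hat_hom] by (simp add: \<tau>_eq \<nu>_pt f_closed \<beta>_closed)

sublocale T_elem: cring_elem T "\<tau> t"
  by unfold_locales (simp add: \<tau>_closed)

sublocale S_hat: cring_elem S.C "\<beta> u"
  by unfold_locales (simp add: \<beta>_closed)

sublocale \<tau>: loc_hom R t T "\<tau> t" \<tau>
  by unfold_locales (auto simp: \<tau>_hom)

sublocale \<nu>: loc_hom T "\<tau> t" S.C "\<beta> u" \<nu>
  by unfold_locales (auto simp: \<nu>_hom \<nu>_\<tau> f_t)

sublocale S_hat: regular_elem S.C "\<beta> u"
  by unfold_locales (rule S.completion_cancel)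

text \<open>
  On completions \<open>\<theta>\<close> induces a map which is \<open>\<nu> \<circ> \<Theta>\<close>, and \<open>\<Theta> \<circ> \<nu>\<close> is \<open>\<theta> \<otimes> id\<close>.
\<close>

definition extension :: "('c \<Rightarrow> 'c) \<Rightarrow> ((nat \<Rightarrow> 'c set) \<Rightarrow> ('c \<times> (nat \<Rightarrow> 'a set) \<Rightarrow>\<^sub>0 int) set) \<Rightarrow> bool" where
  "extension \<theta> \<Theta> \<longleftrightarrow>
    (\<forall>x\<in>carrier S.C. \<Theta> x \<in> carrier T) \<and>
    (\<forall>x\<in>carrier S.C. \<forall>y\<in>carrier S.C. \<Theta> (x \<oplus>\<^bsub>S.C\<^esub> y) = \<Theta> x \<oplus>\<^bsub>T\<^esub> \<Theta> y) \<and>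
    (\<forall>b. S.coherent b \<longrightarrow> \<nu> (\<Theta> (S.adic_lim b)) = S.adic_lim (\<lambda>n. \<theta> (b n))) \<and>
    (\<forall>b\<in>carrier S. \<forall>a\<in>carrier R.C. \<Theta> (\<beta> b \<otimes>\<^bsub>S.C\<^esub> hat a) = tp.pt (\<theta> b) a)"

lemma extensionI:
  assumes "\<And>x. x \<in> carrier S.C \<Longrightarrow> \<Theta> x \<in> carrier T"
    and "\<And>x y. x \<in> carrier S.C \<Longrightarrow> y \<in> carrier S.C \<Longrightarrow> \<Theta> (x \<oplus>\<^bsub>S.C\<^esub> y) = \<Theta> x \<oplus>\<^bsub>T\<^esub> \<Theta> y"
    and "\<And>b. S.coherent b \<Longrightarrow> \<nu> (\<Theta> (S.adic_lim b)) = S.adic_lim (\<lambda>n. \<theta> (b n))"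
    and "\<And>b a. b \<in> carrier S \<Longrightarrow> a \<in> carrier R.C \<Longrightarrow> \<Theta> (\<beta> b \<otimes>\<^bsub>S.C\<^esub> hat a) = tp.pt (\<theta> b) a"
  shows "extension \<theta> \<Theta>"
  unfolding extension_def using assms by (intro conjI ballI allI impI) assumption+

lemma extensionD:
  assumes "extension \<theta> \<Theta>"
  shows "x \<in> carrier S.C \<Longrightarrow> \<Theta> x \<in> carrier T"
    and "x \<in> carrier S.C \<Longrightarrow> y \<in> carrier S.C \<Longrightarrow> \<Theta> (x \<oplus>\<^bsub>S.C\<^esub> y) = \<Theta> x \<oplus>\<^bsub>T\<^esub> \<Theta> y"
    and "S.coherent b \<Longrightarrow> \<nu> (\<Theta> (S.adic_lim b)) = S.adic_lim (\<lambda>n. \<theta> (b n))"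
    and "r \<in> carrier S \<Longrightarrow> a \<in> carrier R.C \<Longrightarrow> \<Theta> (\<beta> r \<otimes>\<^bsub>S.C\<^esub> hat a) = tp.pt (\<theta> r) a"
  using assms[unfolded extension_def, THEN conjunct1]
    assms[unfolded extension_def, THEN conjunct2, THEN conjunct1]
    assms[unfolded extension_def, THEN conjunct2, THEN conjunct2, THEN conjunct1]
    assms[unfolded extension_def, THEN conjunct2, THEN conjunct2, THEN conjunct2]
  by simp_all

text \<open>Closure and coherence are bundled with the existence of \<Theta> because they are needed
  to add two such maps: sums of limits and of pure tensors can be formed only when the terms are
  coherent and lie in S.\<close>

definition extendable :: "('c \<Rightarrow> 'c) \<Rightarrow> bool" where
  "extendable \<theta> \<longleftrightarrow>
    (\<forall>b. S.coherent b \<longrightarrow> S.coherent (\<lambda>n. \<theta> (b n))) \<and>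
    (\<forall>b\<in>carrier S. \<theta> b \<in> carrier S) \<and> (\<exists>\<Theta>. extension \<theta> \<Theta>)"

lemma extendable_cong:
  assumes eq: "\<And>b. b \<in> carrier S \<Longrightarrow> \<theta> b = \<theta>' b" and ext: "extendable \<theta>"
  shows "extendable \<theta>'"
proof -
  have c: "(\<lambda>n. \<theta>' (b n)) = (\<lambda>n. \<theta> (b n))" if "S.coherent b" for b
    using eq S.coherentD(1)[OF that] by simp
  have e: "\<theta>' b = \<theta> b" if "b \<in> carrier S" for b using eq[OF that] by simp
  show ?thesis
    using ext unfolding extendable_def extension_def by (simp only: c e simp_thms ball_triv cong: conj_cong imp_cong ball_cong)
qed

text \<open>The lift sends x to y \<otimes> l(x), with l extended to completions. Its values on
  products of b with elements of the completed base follow from linearity of l and the balancing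
  relation.\<close>

lemma extendable_rank_one:
  assumes l: "\<And>x. x \<in> carrier S \<Longrightarrow> l x \<in> carrier R"
    and l_add: "\<And>x y. x \<in> carrier S \<Longrightarrow> y \<in> carrier S \<Longrightarrow> l (x \<oplus>\<^bsub>S\<^esub> y) = l x \<oplus>\<^bsub>R\<^esub> l y"
    and l_mult: "\<And>r x. r \<in> carrier R \<Longrightarrow> x \<in> carrier S \<Longrightarrow> l (f r \<otimes>\<^bsub>S\<^esub> x) = r \<otimes>\<^bsub>R\<^esub> l x"
    and y: "y \<in> carrier S"
  shows "extendable (\<lambda>b. f (l b) \<otimes>\<^bsub>S\<^esub> y)"
proof -
  interpret l: adic_additive S u R t l
    by unfold_locales (use l l_add l_mult[of t] f_t in auto)
  have coh: "S.coherent (\<lambda>n. f (l (b n)) \<otimes>\<^bsub>S\<^esub> y)" if "S.coherent b" for b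
    by (intro S.coherent_mult f_coherent l.f_coherent that S.coherent_const y)
  have eq: "\<nu> (tp.pt y (l.hat (S.adic_lim b))) = S.adic_lim (\<lambda>n. f (l (b n)) \<otimes>\<^bsub>S\<^esub> y)"
    if b: "S.coherent b" for b
  proof -
    have lb: "R.coherent (\<lambda>n. l (b n))" by (rule l.f_coherent[OF b])
    have "\<nu> (tp.pt y (l.hat (S.adic_lim b))) = \<beta> y \<otimes>\<^bsub>S.C\<^esub> hat (R.adic_lim (\<lambda>n. l (b n)))"
      using y by (simp add: l.completion_map_lim[OF b] \<nu>_pt R.adic_lim_closed[OF lb])
    also have "\<dots> = S.adic_lim (\<lambda>n. y \<otimes>\<^bsub>S\<^esub> f (l (b n)))"
      unfolding completion_map_lim[OF lb] S.to_completion_eq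
      by (rule S.adic_lim_ops[OF S.coherent_const[OF y] f_coherent[OF lb]])
    also have "(\<lambda>n. y \<otimes>\<^bsub>S\<^esub> f (l (b n))) = (\<lambda>n. f (l (b n)) \<otimes>\<^bsub>S\<^esub> y)"
      using y S.coherentD(1)[OF b] by (simp add: S.m_comm f_closed l)
    finally show ?thesis .
  qed
  have pure: "tp.pt y (l.hat (\<beta> b \<otimes>\<^bsub>S.C\<^esub> hat a)) = tp.pt (f (l b) \<otimes>\<^bsub>S\<^esub> y) a"
    if b: "b \<in> carrier S" and a: "a \<in> carrier R.C" for a b
  proof -
    obtain s where s: "R.coherent s" "a = R.adic_lim s"
      using a by (rule R.completion_cases)
    have sc: "s n \<in> carrier R" for n using s(1) by (rule R.coherentD)
    have "\<beta> b \<otimes>\<^bsub>S.C\<^esub> hat a = S.adic_lim (\<lambda>n. b \<otimes>\<^bsub>S\<^esub> f (s n))"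
      unfolding s(2) completion_map_lim[OF s(1)] S.to_completion_eq
      by (rule S.adic_lim_ops[OF S.coherent_const[OF b] f_coherent[OF s(1)]])
    moreover have "S.coherent (\<lambda>n. b \<otimes>\<^bsub>S\<^esub> f (s n))"
      by (intro S.coherent_mult S.coherent_const b f_coherent s(1))
    ultimately have "l.hat (\<beta> b \<otimes>\<^bsub>S.C\<^esub> hat a) = R.adic_lim (\<lambda>n. l (b \<otimes>\<^bsub>S\<^esub> f (s n)))"
      by (simp only: l.completion_map_lim)
    \<comment> \<open>Linearity of l over R, used termwise, becomes linearity over the completion of
      R.\<close>
    also have "(\<lambda>n. l (b \<otimes>\<^bsub>S\<^esub> f (s n))) = (\<lambda>n. l b \<otimes>\<^bsub>R\<^esub> s n)"
      using b sc by (simp add: S.m_comm[OF b f_closed] l_mult R.m_comm l)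
    also have "R.adic_lim (\<lambda>n. l b \<otimes>\<^bsub>R\<^esub> s n) = \<alpha> (l b) \<otimes>\<^bsub>R.C\<^esub> a"
      unfolding s(2) R.to_completion_eq
      by (rule R.adic_lim_ops[OF R.coherent_const[OF l[OF b]] s(1), symmetric])
    finally show ?thesis
      \<comment> \<open>The factor l b lies in R itself, not just in its completion, so it may cross
        the tensor sign and join y.\<close>
      using tp.pt_balance[OF l[OF b] y a] by simp
  qed
  show ?thesis
    unfolding extendable_def
    by (intro conjI allI impI ballI exI[of _ "\<lambda>x. tp.pt y (l.hat x)"] extensionI coh eq pure)
       (simp_all add: y l f_closed l.hat_closed l.hat_add tp.pt_add_right)
qed

lemma extendable_add:
  assumes "extendable \<theta>" "extendable \<theta>'"
  shows "extendable (\<lambda>b. \<theta> b \<oplus>\<^bsub>S\<^esub> \<theta>' b)"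
proof -
  obtain \<Theta> where \<theta>: "\<And>b. S.coherent b \<Longrightarrow> S.coherent (\<lambda>n. \<theta> (b n))" "\<And>b. b \<in> carrier S \<Longrightarrow> \<theta> b \<in> carrier S"
    and "extension \<theta> \<Theta>"
    using assms(1) unfolding extendable_def by blast
  note \<Theta> = extensionD[OF this(3)]
  obtain \<Theta>' where \<theta>': "\<And>b. S.coherent b \<Longrightarrow> S.coherent (\<lambda>n. \<theta>' (b n))" "\<And>b. b \<in> carrier S \<Longrightarrow> \<theta>' b \<in> carrier S"
    and "extension \<theta>' \<Theta>'"
    using assms(2) unfolding extendable_def by blast
  note \<Theta>' = extensionD[OF this(3)]
  let ?\<Omega> = "\<lambda>x. \<Theta> x \<oplus>\<^bsub>T\<^esub> \<Theta>' x"
  have lim: "\<nu> (?\<Omega> (S.adic_lim b)) = S.adic_lim (\<lambda>n. \<theta> (b n) \<oplus>\<^bsub>S\<^esub> \<theta>' (b n))"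
    if b: "S.coherent b" for b
    unfolding ring_hom_add[OF \<nu>_hom \<Theta>(1)[OF S.adic_lim_closed[OF b]] \<Theta>'(1)[OF S.adic_lim_closed[OF b]]]
      \<Theta>(3)[OF b] \<Theta>'(3)[OF b]
    by (rule S.adic_lim_ops(2)[OF \<theta>(1)[OF b] \<theta>'(1)[OF b]])
  have add: "?\<Omega> (x \<oplus>\<^bsub>S.C\<^esub> y) = ?\<Omega> x \<oplus>\<^bsub>T\<^esub> ?\<Omega> y"
    if "x \<in> carrier S.C" "y \<in> carrier S.C" for x y
    unfolding \<Theta>(2)[OF that] \<Theta>'(2)[OF that]
    using \<Theta>(1)[OF that(1)] \<Theta>(1)[OF that(2)] \<Theta>'(1)[OF that(1)] \<Theta>'(1)[OF that(2)]
    by (simp only: tp.ST.a_ac tp.ST.a_closed)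
  have pure: "?\<Omega> (\<beta> b \<otimes>\<^bsub>S.C\<^esub> hat a) = tp.pt (\<theta> b \<oplus>\<^bsub>S\<^esub> \<theta>' b) a"
    if "b \<in> carrier S" "a \<in> carrier R.C" for a b
    unfolding \<Theta>(4)[OF that] \<Theta>'(4)[OF that]
    by (rule tp.pt_add_left[OF \<theta>(2)[OF that(1)] \<theta>'(2)[OF that(1)] that(2), symmetric])
  have "extension (\<lambda>b. \<theta> b \<oplus>\<^bsub>S\<^esub> \<theta>' b) ?\<Omega>"
    by (rule extensionI[OF _ add lim pure]) (simp_all only: \<Theta>(1) \<Theta>'(1) tp.ST.a_closed)
  moreover have "\<forall>b\<in>carrier S. \<theta> b \<oplus>\<^bsub>S\<^esub> \<theta>' b \<in> carrier S"
    using \<theta>(2) \<theta>'(2) by simp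
  ultimately show ?thesis
    unfolding extendable_def using S.coherent_add[OF \<theta>(1) \<theta>'(1)] by blast
qed

section \<open>Consequences of extending multiplication by a power of u\<close>

context
  fixes c :: nat
  assumes ext: "extendable (\<lambda>b. u [^]\<^bsub>S\<^esub> c \<otimes>\<^bsub>S\<^esub> b)"
begin

text \<open>For \<Theta> after \<nu>, both sides are additive, so pure tensors suffice; there the
  last clause of \<open>extension\<close> applies. The value at zero is recorded because it turns
  the third property into a bound on the torsion of the kernel.\<close>

lemma quasi_inverse:
  obtains \<Theta> where "\<And>x. x \<in> carrier S.C \<Longrightarrow> \<Theta> x \<in> carrier T"
    "\<And>x. x \<in> carrier S.C \<Longrightarrow> \<nu> (\<Theta> x) = \<beta> (u [^]\<^bsub>S\<^esub> c) \<otimes>\<^bsub>S.C\<^esub> x"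
    "\<And>x. x \<in> carrier T \<Longrightarrow> \<Theta> (\<nu> x) = \<tau> t [^]\<^bsub>T\<^esub> c \<otimes>\<^bsub>T\<^esub> x"
    "\<Theta> \<zero>\<^bsub>S.C\<^esub> = \<zero>\<^bsub>T\<^esub>"
proof -
  obtain \<Theta> where "extension (\<lambda>b. u [^]\<^bsub>S\<^esub> c \<otimes>\<^bsub>S\<^esub> b) \<Theta>"
    using ext unfolding extendable_def by blast
  note \<Theta> = extensionD[OF this]
  have 1: "\<nu> (\<Theta> x) = \<beta> (u [^]\<^bsub>S\<^esub> c) \<otimes>\<^bsub>S.C\<^esub> x" if x: "x \<in> carrier S.C" for x
  proof -
    obtain b where b: "S.coherent b" "x = S.adic_lim b"
      using x by (rule S.completion_cases)
    show ?thesis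
      unfolding b(2) \<Theta>(3)[OF b(1)] S.to_completion_eq
      by (rule S.adic_lim_ops[OF S.coherent_const b(1), symmetric]) simp
  qed
  have \<tau>c: "\<tau> t [^]\<^bsub>T\<^esub> c = tp.pt (u [^]\<^bsub>S\<^esub> c) \<one>\<^bsub>R.C\<^esub>"
    using \<tau>.f_pow[of c, symmetric] f_pow[of c] by (simp only: \<tau>_eq)
  have 2: "\<Theta> (\<nu> x) = \<tau> t [^]\<^bsub>T\<^esub> c \<otimes>\<^bsub>T\<^esub> x" if "x \<in> carrier T" for x
    using that
  proof (induction x rule: tp.tensor_induct)
    case (pure a b)
    then show ?case by (simp only: \<nu>_pt \<Theta>(4) \<tau>c) (simp add: tp.pt_mult)
  next
    case (add x y)
    then show ?case
      by (simp add: ring_hom_add[OF \<nu>_hom] \<Theta>(2) \<nu>.f_closed tp.ST.r_distr)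
  qed
  have 3: "\<Theta> \<zero>\<^bsub>S.C\<^esub> = \<zero>\<^bsub>T\<^esub>"
    using \<Theta>(2)[of "\<zero>\<^bsub>S.C\<^esub>" "\<zero>\<^bsub>S.C\<^esub>"] \<Theta>(1)[of "\<zero>\<^bsub>S.C\<^esub>"] by simp
  show ?thesis using \<Theta>(1) 1 2 3 by (rule that)
qed

lemma \<nu>_surj: "\<nu> ` carrier T = carrier S.C"
proof
  show "\<nu> ` carrier T \<subseteq> carrier S.C" using \<nu>.f_closed by blast
  show "carrier S.C \<subseteq> \<nu> ` carrier T"
  proof
    fix x assume "x \<in> carrier S.C"
    then obtain r y where r: "r \<in> carrier S" and y: "y \<in> carrier S.C"
      and x: "x = \<beta> r \<oplus>\<^bsub>S.C\<^esub> \<beta> (u [^]\<^bsub>S\<^esub> c) \<otimes>\<^bsub>S.C\<^esub> y"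
      by (rule S.completion_decompose)
    obtain \<Theta> where \<Theta>: "\<Theta> y \<in> carrier T" "\<nu> (\<Theta> y) = \<beta> (u [^]\<^bsub>S\<^esub> c) \<otimes>\<^bsub>S.C\<^esub> y"
      using quasi_inverse y by metis
    have "\<nu> (tp.pt r \<one>\<^bsub>R.C\<^esub>) = \<beta> r"
      using r ring_hom_one[OF hat_hom] by (simp add: \<nu>_pt \<beta>_closed)
    then have "\<nu> (tp.pt r \<one>\<^bsub>R.C\<^esub> \<oplus>\<^bsub>T\<^esub> \<Theta> y) = x"
      using r \<Theta> by (simp add: ring_hom_add[OF \<nu>_hom] x)
    moreover have "tp.pt r \<one>\<^bsub>R.C\<^esub> \<oplus>\<^bsub>T\<^esub> \<Theta> y \<in> carrier T"
      using r \<Theta>(1) by simp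
    ultimately show "x \<in> \<nu> ` carrier T" by blast
  qed
qed

lemma \<nu>_zero_torsion:
  assumes "x \<in> carrier T" "\<nu> x = \<zero>\<^bsub>S.C\<^esub>"
  shows "\<tau> t [^]\<^bsub>T\<^esub> c \<otimes>\<^bsub>T\<^esub> x = \<zero>\<^bsub>T\<^esub>"
  using quasi_inverse assms by metis

lemma kernel_eq_saturation: "a_kernel T S.C \<nu> = zero_saturation T (\<tau> t)"
proof -
  have "\<nu> x = \<zero>\<^bsub>S.C\<^esub>" if x: "x \<in> carrier T" "\<tau> t [^]\<^bsub>T\<^esub> k \<otimes>\<^bsub>T\<^esub> x = \<zero>\<^bsub>T\<^esub>" for x and k :: nat
  proof -
    have "\<beta> u [^]\<^bsub>S.C\<^esub> k \<otimes>\<^bsub>S.C\<^esub> \<nu> x = \<nu> (\<tau> t [^]\<^bsub>T\<^esub> k \<otimes>\<^bsub>T\<^esub> x)"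
      by (rule \<nu>.f_mult_pow[OF x(1), symmetric])
    also have "\<dots> = \<zero>\<^bsub>S.C\<^esub>" unfolding x(2) by (rule \<nu>.f_zero)
    finally show ?thesis
      by (rule S_hat.cancel_pow[OF \<nu>.f_closed[OF x(1)]])
  qed
  then show ?thesis
    using \<nu>_zero_torsion unfolding a_kernel_def' zero_saturation_def by blast
qed

lemma quotient_iso:
  "(\<lambda>C. the_elem (\<nu> ` C)) \<in> algebra_iso R (\<lambda>a. zero_saturation T (\<tau> t) +>\<^bsub>T\<^esub> \<tau> a)
     (T Quot zero_saturation T (\<tau> t)) (\<beta> \<circ> f) S.C"
proof -
  have h: "ring_hom_ring T S.C \<nu>"
    by (rule ring_hom_ringI2[OF tp.ST.ring_axioms S.C.ring_axioms \<nu>_hom])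
  have "the_elem (\<nu> ` (zero_saturation T (\<tau> t) +>\<^bsub>T\<^esub> \<tau> r)) = (\<beta> \<circ> f) r" if r: "r \<in> carrier R" for r
    using ring_hom_ring.the_elem_simp[OF h \<tau>_closed[OF r]] \<nu>_\<tau>[OF r] by (simp only: kernel_eq_saturation o_apply)
  moreover have "(\<lambda>C. the_elem (\<nu> ` C)) \<in> ring_iso (T Quot zero_saturation T (\<tau> t)) S.C"
    using ring_hom_ring.FactRing_iso_set[OF h \<nu>_surj] by (simp only: kernel_eq_saturation)
  ultimately show ?thesis by (simp add: algebra_iso_def)
qed

text \<open>Obtained from \<nu> itself, not from the quotient: surjectivity and a kernel killed by
  one power of t are exactly what \<open>loc_map_iso\<close> asks for.\<close>

lemma localization_iso:
  "loc_map S.C (\<beta> u) \<nu> \<in> algebra_iso (localization R t) (loc_map T (\<tau> t) \<tau>) (localization T (\<tau> t))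
     (loc_map S.C (\<beta> u) (\<beta> \<circ> f)) (localization S.C (\<beta> u))"
proof -
  interpret \<beta>f: loc_hom R t S.C "\<beta> u" "\<beta> \<circ> f"
    by unfold_locales (use ring_hom_trans[OF f_hom S.to_completion_hom] f_t in auto)
  have "loc_map S.C (\<beta> u) \<nu> (loc_map T (\<tau> t) \<tau> x) = loc_map S.C (\<beta> u) (\<beta> \<circ> f) x"
    if x: "x \<in> carrier R.L" for x
  proof -
    obtain r n where r: "r \<in> carrier R" and x: "x = loc_frac R t r n"
      using x unfolding R.L_carrier by blast
    show ?thesis
      unfolding x \<tau>.loc_map_frac[OF r] \<nu>.loc_map_frac[OF \<tau>_closed[OF r]] \<beta>f.loc_map_frac[OF r] \<nu>_\<tau>[OF r]
      by (simp only: o_apply)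
  qed
  moreover have "loc_map S.C (\<beta> u) \<nu> \<in> ring_iso (localization T (\<tau> t)) (localization S.C (\<beta> u))"
    using \<nu>_zero_torsion by (intro \<nu>.loc_map_iso \<nu>_surj) blast
  ultimately show ?thesis by (simp add: algebra_iso_def)
qed

end

end

section \<open>Clearing denominators\<close>

text \<open>The subalgebra is carried as a subset H of B, so that denominators and traces can be
  computed in B, where t is invertible, and only membership in H needs to be tracked.\<close>

locale integral_trace = A\<^sub>0: cring_elem A\<^sub>0 t + algebra_dual_basis "localization A\<^sub>0 t" \<phi> B n e c
  for A\<^sub>0 (structure) and t and \<phi> and B (structure) and n and e and c +
  fixes H :: "'c set" and l :: nat
  assumes nonzero_divisor: "nonzero_divisor A\<^sub>0 t"
    and subring: "subring H B"
    and contains: "\<And>a. a \<in> carrier A\<^sub>0 \<Longrightarrow> \<phi> (to_loc A\<^sub>0 t a) \<in> H"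
    and fractions: "\<And>x. x \<in> carrier B \<Longrightarrow> \<exists>b\<in>H. \<exists>k::nat. x = b \<otimes>\<^bsub>B\<^esub> inv\<^bsub>B\<^esub> (\<phi> (to_loc A\<^sub>0 t t) [^]\<^bsub>B\<^esub> k)"
    and integral: "\<And>b. b \<in> H \<Longrightarrow>
      alg_trace (localization A\<^sub>0 t) \<phi> B (\<phi> (to_loc A\<^sub>0 t t) [^]\<^bsub>B\<^esub> l \<otimes>\<^bsub>B\<^esub> b) \<in> to_loc A\<^sub>0 t ` carrier A\<^sub>0"
begin

abbreviation "loc \<equiv> to_loc A\<^sub>0 t"
abbreviation "u \<equiv> \<phi> (to_loc A\<^sub>0 t t)"
abbreviation "B\<^sub>0 \<equiv> B\<lparr>carrier := H\<rparr>"

lemma loc_closed [simp]: "a \<in> carrier A\<^sub>0 \<Longrightarrow> loc a \<in> carrier (localization A\<^sub>0 t)"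
  by (rule ring_hom_closed[OF A\<^sub>0.to_loc_hom])

lemma u_closed [simp]: "u \<in> carrier B" by simp

lemma H_closed [simp]: "b \<in> H \<Longrightarrow> b \<in> carrier B"
  using subringE(1)[OF subring] by blast

lemma u_pow_unit: "u [^]\<^bsub>B\<^esub> (k::nat) \<in> Units B"
proof -
  have "u \<otimes>\<^bsub>B\<^esub> \<phi> (loc_frac A\<^sub>0 t \<one>\<^bsub>A\<^sub>0\<^esub> 1) = \<one>\<^bsub>B\<^esub>"
    using ring_hom_mult[OF \<phi>_hom loc_closed[OF A\<^sub>0.t_closed] A\<^sub>0.frac_closed[OF A\<^sub>0.one_closed, of 1]]
    by (simp only: A\<^sub>0.to_loc_mult_inverse ring_hom_one[OF \<phi>_hom])
  moreover have "\<phi> (loc_frac A\<^sub>0 t \<one>\<^bsub>A\<^sub>0\<^esub> 1) \<in> carrier B"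
    by (intro \<phi>_closed A\<^sub>0.frac_closed A\<^sub>0.one_closed)
  ultimately have "u \<in> Units B"
    unfolding Units_def using B.m_comm[OF u_closed] u_closed by auto
  then show ?thesis by (rule B.Units_pow_closed)
qed

lemma u_pow_H: "u [^]\<^bsub>B\<^esub> (k::nat) \<in> H"
proof (induction k)
  case (Suc k)
  then show ?case
    using subringE(6)[OF subring] contains[OF A\<^sub>0.t_closed] by simp
qed (use subringE(3)[OF subring] in simp)

text \<open>Stated for all large exponents so that surplus powers of t can be spent on this element
  after other exponents have been fixed.\<close>

lemma denominator:
  assumes x: "x \<in> carrier B"
  obtains N :: nat where "\<forall>m\<ge>N. u [^]\<^bsub>B\<^esub> m \<otimes>\<^bsub>B\<^esub> x \<in> H"
proof -
  obtain b k where b: "b \<in> H" "x = b \<otimes>\<^bsub>B\<^esub> inv\<^bsub>B\<^esub> (u [^]\<^bsub>B\<^esub> (k::nat))"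
    using fractions[OF x] by blast
  have "u [^]\<^bsub>B\<^esub> m \<otimes>\<^bsub>B\<^esub> x \<in> H" if "m \<ge> k" for m
  proof -
    have "u [^]\<^bsub>B\<^esub> m = u [^]\<^bsub>B\<^esub> (m - k) \<otimes>\<^bsub>B\<^esub> u [^]\<^bsub>B\<^esub> k"
      using that by (simp add: B.nat_pow_mult)
    moreover have "p \<otimes>\<^bsub>B\<^esub> q \<otimes>\<^bsub>B\<^esub> (b \<otimes>\<^bsub>B\<^esub> i) = p \<otimes>\<^bsub>B\<^esub> (b \<otimes>\<^bsub>B\<^esub> (q \<otimes>\<^bsub>B\<^esub> i))"
      if "p \<in> carrier B" "q \<in> carrier B" "i \<in> carrier B" for p q i
      using that b(1) by (simp add: B.m_ac)
    ultimately have "u [^]\<^bsub>B\<^esub> m \<otimes>\<^bsub>B\<^esub> x = u [^]\<^bsub>B\<^esub> (m - k) \<otimes>\<^bsub>B\<^esub> (b \<otimes>\<^bsub>B\<^esub> (u [^]\<^bsub>B\<^esub> k \<otimes>\<^bsub>B\<^esub> inv\<^bsub>B\<^esub> (u [^]\<^bsub>B\<^esub> k)))"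
      using u_pow_unit[of k] by (simp only: b(2) B.nat_pow_closed u_closed B.Units_inv_closed)
    also have "\<dots> = u [^]\<^bsub>B\<^esub> (m - k) \<otimes>\<^bsub>B\<^esub> b"
      using b(1) u_pow_unit[of k] by (simp add: B.Units_r_inv)
    finally show ?thesis
      using subringE(6)[OF subring u_pow_H b(1)] by simp
  qed
  then show ?thesis using that by blast
qed

lemma cring_B\<^sub>0: "cring B\<^sub>0"
  using B.subcring_iff[OF subringE(1)[OF subring]] B.subcringI'[OF subring] by blast

lemma B\<^sub>0_pow: "x [^]\<^bsub>B\<^sub>0\<^esub> (k::nat) = x [^]\<^bsub>B\<^esub> k"
  by (rule B.nat_pow_consistent[symmetric])

lemma \<phi>_loc_hom: "(\<lambda>a. \<phi> (loc a)) \<in> ring_hom A\<^sub>0 B"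
  using ring_hom_trans[OF A\<^sub>0.to_loc_hom \<phi>_hom] by (simp add: comp_def)

lemma completed: "completed_algebra A\<^sub>0 t B\<^sub>0 u (\<lambda>a. \<phi> (loc a))"
proof -
  interpret B\<^sub>0: cring B\<^sub>0 by (rule cring_B\<^sub>0)
  show ?thesis
  proof unfold_locales
    show "u \<in> carrier B\<^sub>0" using contains by simp
    show "(\<lambda>a. \<phi> (loc a)) \<in> ring_hom A\<^sub>0 B\<^sub>0"
      using \<phi>_loc_hom contains by (simp add: ring_hom_def Pi_iff)
    show "x = \<zero>\<^bsub>B\<^sub>0\<^esub>" if x: "x \<in> carrier B\<^sub>0" "u \<otimes>\<^bsub>B\<^sub>0\<^esub> x = \<zero>\<^bsub>B\<^sub>0\<^esub>" for x
    proof -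
      \<comment> \<open>Cancellation in the subring comes from the ambient ring, where the image of
        t is invertible.\<close>
      have u: "u \<in> Units B" using u_pow_unit[of 1] by simp
      have "u \<otimes>\<^bsub>B\<^esub> x = u \<otimes>\<^bsub>B\<^esub> \<zero>\<^bsub>B\<^esub>" "x \<in> carrier B" using x by simp_all
      then have "x = \<zero>\<^bsub>B\<^esub>" using B.Units_l_cancel[OF u] by blast
      then show ?thesis by simp
    qed
  qed simp
qed

sublocale cp: completed_algebra A\<^sub>0 t B\<^sub>0 u "\<lambda>a. \<phi> (loc a)"
  by (rule completed)

text \<open>On the image of \<open>A\<^sub>0\<close> this is a genuine inverse, by
  \<open>to_loc_inj\<close>; uniqueness of preimages is what makes the functionals built from it
  additive and linear.\<close>

definition unloc :: "('a \<times> nat) set \<Rightarrow> 'a" where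
  "unloc = inv_into (carrier A\<^sub>0) loc"

lemma unloc:
  assumes "x \<in> loc ` carrier A\<^sub>0"
  shows "unloc x \<in> carrier A\<^sub>0" "loc (unloc x) = x"
  using assms by (simp_all add: unloc_def inv_into_into f_inv_into_f)

lemma unlocI: "a \<in> carrier A\<^sub>0 \<Longrightarrow> loc a = x \<Longrightarrow> unloc x = a"
  using A\<^sub>0.to_loc_inj[OF nonzero_divisor] unloc[of x] by blast

lemma tr_integral: "b \<in> H \<Longrightarrow> tr (u [^]\<^bsub>B\<^esub> l \<otimes>\<^bsub>B\<^esub> b) \<in> loc ` carrier A\<^sub>0"
  using integral[of b] by (simp add: alg_trace_eq)

lemma tr_u_pow: "b \<in> carrier B \<Longrightarrow> \<phi> (tr (u [^]\<^bsub>B\<^esub> (k::nat) \<otimes>\<^bsub>B\<^esub> b)) = u [^]\<^bsub>B\<^esub> k \<otimes>\<^bsub>B\<^esub> \<phi> (tr b)"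
proof (induction k)
  case (Suc k)
  have "u [^]\<^bsub>B\<^esub> Suc k \<otimes>\<^bsub>B\<^esub> b = u \<otimes>\<^bsub>B\<^esub> (u [^]\<^bsub>B\<^esub> k \<otimes>\<^bsub>B\<^esub> b)"
    using Suc.prems by (simp add: B.m_ac)
  also have "\<phi> (tr \<dots>) = u \<otimes>\<^bsub>B\<^esub> \<phi> (tr (u [^]\<^bsub>B\<^esub> k \<otimes>\<^bsub>B\<^esub> b))"
    using Suc.prems by (subst tr_mult) (simp_all add: ring_hom_mult[OF \<phi>_hom])
  also have "\<dots> = u [^]\<^bsub>B\<^esub> Suc k \<otimes>\<^bsub>B\<^esub> \<phi> (tr b)"
    unfolding Suc.IH[OF Suc.prems] using Suc.prems by (simp add: B.m_ac)
  finally show ?case .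
qed simp

text \<open>The map b \<mapsto> Tr(xb) y becomes rank one over \<open>A\<^sub>0\<close> after
  clearing three denominators: N for x, l for the trace, M for y. Any m at least l + N + M
  works.\<close>

lemma extendable_trace_pure:
  assumes x: "x \<in> carrier B" and y: "y \<in> carrier B"
  shows "\<exists>N::nat. \<forall>m\<ge>N. cp.extendable (\<lambda>b. u [^]\<^bsub>B\<^esub> m \<otimes>\<^bsub>B\<^esub> trace_map (pt x y \<otimes>\<^bsub>ST\<^esub> pt b \<one>\<^bsub>B\<^esub>))"
proof -
  obtain N :: nat where "\<forall>m\<ge>N. u [^]\<^bsub>B\<^esub> m \<otimes>\<^bsub>B\<^esub> x \<in> H"
    using x by (rule denominator)
  then have x': "u [^]\<^bsub>B\<^esub> N \<otimes>\<^bsub>B\<^esub> x \<in> H" by simp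
  obtain M :: nat where y': "\<forall>m\<ge>M. u [^]\<^bsub>B\<^esub> m \<otimes>\<^bsub>B\<^esub> y \<in> H"
    using y by (rule denominator)
  \<comment> \<open>The power N puts x b into H for b in H, and only then does the factor u^l
    guarantee a trace in \<open>A\<^sub>0\<close>.\<close>
  define w where "w b = u [^]\<^bsub>B\<^esub> l \<otimes>\<^bsub>B\<^esub> (u [^]\<^bsub>B\<^esub> N \<otimes>\<^bsub>B\<^esub> x \<otimes>\<^bsub>B\<^esub> b)" for b
  define f where "f b = unloc (tr (w b))" for b
  have wc: "w b \<in> carrier B" if "b \<in> H" for b
    using that x by (simp add: w_def)
  have img: "tr (w b) \<in> loc ` carrier A\<^sub>0" if "b \<in> H" for b
    unfolding w_def by (rule tr_integral[OF subringE(6)[OF subring x' that]])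
  have fc: "f b \<in> carrier A\<^sub>0" and lf: "loc (f b) = tr (w b)" if "b \<in> H" for b
    using unloc[OF img[OF that]] by (simp_all add: f_def)
  have f_add: "f (a \<oplus>\<^bsub>B\<^esub> b) = f a \<oplus>\<^bsub>A\<^sub>0\<^esub> f b" if ab: "a \<in> H" "b \<in> H" for a b
    unfolding f_def[of "a \<oplus>\<^bsub>B\<^esub> b"]
  proof (rule unlocI)
    have "w (a \<oplus>\<^bsub>B\<^esub> b) = w a \<oplus>\<^bsub>B\<^esub> w b"
      using ab x by (simp add: w_def B.r_distr)
    then show "loc (f a \<oplus>\<^bsub>A\<^sub>0\<^esub> f b) = tr (w (a \<oplus>\<^bsub>B\<^esub> b))"
      using ab by (simp add: ring_hom_add[OF A\<^sub>0.to_loc_hom] fc lf tr_add wc)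
  qed (use fc ab in simp)
  have f_mult: "f (\<phi> (loc r) \<otimes>\<^bsub>B\<^esub> b) = r \<otimes>\<^bsub>A\<^sub>0\<^esub> f b" if r: "r \<in> carrier A\<^sub>0" and b: "b \<in> H" for r b
    unfolding f_def[of "\<phi> (loc r) \<otimes>\<^bsub>B\<^esub> b"]
  proof (rule unlocI)
    have "w (\<phi> (loc r) \<otimes>\<^bsub>B\<^esub> b) = \<phi> (loc r) \<otimes>\<^bsub>B\<^esub> w b"
      using b x r by (simp add: w_def B.m_lcomm)
    then show "loc (r \<otimes>\<^bsub>A\<^sub>0\<^esub> f b) = tr (w (\<phi> (loc r) \<otimes>\<^bsub>B\<^esub> b))"
      using r b by (simp add: ring_hom_mult[OF A\<^sub>0.to_loc_hom] fc lf tr_mult wc)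
  qed (use fc r b in simp)
  have "cp.extendable (\<lambda>b. u [^]\<^bsub>B\<^esub> m \<otimes>\<^bsub>B\<^esub> trace_map (pt x y \<otimes>\<^bsub>ST\<^esub> pt b \<one>\<^bsub>B\<^esub>))"
    if m: "m \<ge> l + N + M" for m
  proof (rule cp.extendable_cong)
    \<comment> \<open>All powers of u beyond those consumed by the functional are given to y, and k
      is at least M.\<close>
    define k where "k = m - (l + N)"
    have k: "M \<le> k" "m = l + N + k" using m by (simp_all add: k_def)
    show "cp.extendable (\<lambda>b. \<phi> (loc (f b)) \<otimes>\<^bsub>B\<^sub>0\<^esub> (u [^]\<^bsub>B\<^esub> k \<otimes>\<^bsub>B\<^esub> y))"
      by (rule cp.extendable_rank_one) (simp_all add: fc f_add f_mult y'[rule_format, OF k(1)])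
    fix b assume "b \<in> carrier B\<^sub>0"
    then have b: "b \<in> H" by simp
    have "w b = u [^]\<^bsub>B\<^esub> (l + N) \<otimes>\<^bsub>B\<^esub> (x \<otimes>\<^bsub>B\<^esub> b)"
      using b x by (simp add: w_def B.nat_pow_mult[symmetric] B.m_assoc)
    then have "\<phi> (loc (f b)) = u [^]\<^bsub>B\<^esub> (l + N) \<otimes>\<^bsub>B\<^esub> \<phi> (tr (x \<otimes>\<^bsub>B\<^esub> b))"
      using b x by (simp only: lf tr_u_pow B.m_closed H_closed)
    moreover have "u [^]\<^bsub>B\<^esub> m = u [^]\<^bsub>B\<^esub> (l + N) \<otimes>\<^bsub>B\<^esub> u [^]\<^bsub>B\<^esub> k"
      unfolding k(2) by (rule B.nat_pow_mult[symmetric]) simp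
    moreover have "trace_map (pt x y \<otimes>\<^bsub>ST\<^esub> pt b \<one>\<^bsub>B\<^esub>) = \<phi> (tr (x \<otimes>\<^bsub>B\<^esub> b)) \<otimes>\<^bsub>B\<^esub> y"
      using x y b by (simp add: pt_mult trace_map)
    ultimately show "\<phi> (loc (f b)) \<otimes>\<^bsub>B\<^sub>0\<^esub> (u [^]\<^bsub>B\<^esub> k \<otimes>\<^bsub>B\<^esub> y) =
        u [^]\<^bsub>B\<^esub> m \<otimes>\<^bsub>B\<^esub> trace_map (pt x y \<otimes>\<^bsub>ST\<^esub> pt b \<one>\<^bsub>B\<^esub>)"
      using x y b by (simp add: B.m_assoc B.m_lcomm)
  qed
  then show ?thesis by blast
qed

text \<open>The statement for all large m is what survives addition: two thresholds are replaced by
  their maximum, and the same power of u then serves both summands.\<close>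

lemma extendable_trace:
  assumes "z \<in> carrier ST"
  shows "\<exists>N::nat. \<forall>m\<ge>N. cp.extendable (\<lambda>b. u [^]\<^bsub>B\<^esub> m \<otimes>\<^bsub>B\<^esub> trace_map (z \<otimes>\<^bsub>ST\<^esub> pt b \<one>\<^bsub>B\<^esub>))"
  using assms
proof (induction z rule: tensor_induct)
  case (pure a b)
  then show ?case by (rule extendable_trace_pure)
next
  case (add z w)
  obtain N :: nat where N: "\<forall>m\<ge>N. cp.extendable (\<lambda>b. u [^]\<^bsub>B\<^esub> m \<otimes>\<^bsub>B\<^esub> trace_map (z \<otimes>\<^bsub>ST\<^esub> pt b \<one>\<^bsub>B\<^esub>))"
    using add(3) ..
  obtain N' :: nat where N': "\<forall>m\<ge>N'. cp.extendable (\<lambda>b. u [^]\<^bsub>B\<^esub> m \<otimes>\<^bsub>B\<^esub> trace_map (w \<otimes>\<^bsub>ST\<^esub> pt b \<one>\<^bsub>B\<^esub>))"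
    using add(4) ..
  have "cp.extendable (\<lambda>b. u [^]\<^bsub>B\<^esub> m \<otimes>\<^bsub>B\<^esub> trace_map ((z \<oplus>\<^bsub>ST\<^esub> w) \<otimes>\<^bsub>ST\<^esub> pt b \<one>\<^bsub>B\<^esub>))"
    if m: "m \<ge> max N N'" for m
  proof (rule cp.extendable_cong)
    have "N \<le> m" "N' \<le> m" using m by simp_all
    then show "cp.extendable (\<lambda>b. u [^]\<^bsub>B\<^esub> m \<otimes>\<^bsub>B\<^esub> trace_map (z \<otimes>\<^bsub>ST\<^esub> pt b \<one>\<^bsub>B\<^esub>) \<oplus>\<^bsub>B\<^sub>0\<^esub>
        u [^]\<^bsub>B\<^esub> m \<otimes>\<^bsub>B\<^esub> trace_map (w \<otimes>\<^bsub>ST\<^esub> pt b \<one>\<^bsub>B\<^esub>))"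
      by (rule cp.extendable_add[OF N[rule_format] N'[rule_format]])
    show "u [^]\<^bsub>B\<^esub> m \<otimes>\<^bsub>B\<^esub> trace_map (z \<otimes>\<^bsub>ST\<^esub> pt b \<one>\<^bsub>B\<^esub>) \<oplus>\<^bsub>B\<^sub>0\<^esub>
        u [^]\<^bsub>B\<^esub> m \<otimes>\<^bsub>B\<^esub> trace_map (w \<otimes>\<^bsub>ST\<^esub> pt b \<one>\<^bsub>B\<^esub>) =
        u [^]\<^bsub>B\<^esub> m \<otimes>\<^bsub>B\<^esub> trace_map ((z \<oplus>\<^bsub>ST\<^esub> w) \<otimes>\<^bsub>ST\<^esub> pt b \<one>\<^bsub>B\<^esub>)" if "b \<in> carrier B\<^sub>0" for b
      using that add(1,2) by (simp add: ST.l_distr trace_map B.r_distr)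
  qed
  then show ?case by blast
qed

text \<open>For the element s dual to the trace, the trace expression is b itself, so what has been
  extended is plain multiplication by a power of u.\<close>

lemma extendable_u_pow:
  assumes "unramified (localization A\<^sub>0 t) \<phi> B"
  obtains k :: nat where "cp.extendable (\<lambda>b. u [^]\<^bsub>B\<^sub>0\<^esub> k \<otimes>\<^bsub>B\<^sub>0\<^esub> b)"
proof -
  obtain s where s: "s \<in> carrier ST" "\<forall>b\<in>carrier B. trace_map (s \<otimes>\<^bsub>ST\<^esub> pt b \<one>\<^bsub>B\<^esub>) = b"
    by (rule unramified_trace_dual[OF assms])
  obtain k :: nat where "\<forall>m\<ge>k. cp.extendable (\<lambda>b. u [^]\<^bsub>B\<^esub> m \<otimes>\<^bsub>B\<^esub> trace_map (s \<otimes>\<^bsub>ST\<^esub> pt b \<one>\<^bsub>B\<^esub>))"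
    using extendable_trace[OF s(1)] ..
  note k = this[rule_format, OF order_refl]
  have "cp.extendable (\<lambda>b. u [^]\<^bsub>B\<^sub>0\<^esub> k \<otimes>\<^bsub>B\<^sub>0\<^esub> b)"
    by (rule cp.extendable_cong[OF _ k]) (simp add: s(2) B\<^sub>0_pow)
  then show ?thesis by (rule that)
qed

end

theorem proposition4p2:
  fixes A\<^sub>0 :: "('a, 'm) ring_scheme" and t :: 'a
    and B :: "('b, 'n) ring_scheme" and \<phi> :: "('a \<times> nat) set \<Rightarrow> 'b" and S :: "'b set"
  assumes "cring A\<^sub>0"
    and "nonzero_divisor A\<^sub>0 t"
    and A: "A = localization A\<^sub>0 t"
    and "finite_etale A \<phi> B"
    and \<phi>\<^sub>0: "\<phi>\<^sub>0 = (\<lambda>a. \<phi> (to_loc A\<^sub>0 t a))"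
    and t\<^sub>B: "t\<^sub>B = \<phi>\<^sub>0 t"
    and "subring S B"
    and "\<phi>\<^sub>0 ` carrier A\<^sub>0 \<subseteq> S"
    and B\<^sub>0: "B\<^sub>0 = B\<lparr>carrier := S\<rparr>"
    and "carrier B = {b \<otimes>\<^bsub>B\<^esub> inv\<^bsub>B\<^esub> (t\<^sub>B [^]\<^bsub>B\<^esub> n) | b (n::nat). b \<in> carrier B\<^sub>0}"
    and "\<exists>l::nat. l > 0 \<and>
           (\<forall>b\<in>carrier B\<^sub>0. alg_trace A \<phi> B (t\<^sub>B [^]\<^bsub>B\<^esub> l \<otimes>\<^bsub>B\<^esub> b) \<in> to_loc A\<^sub>0 t ` carrier A\<^sub>0)"
    and A\<^sub>0_hat: "A\<^sub>0_hat = completion A\<^sub>0 t" "\<alpha> = to_completion A\<^sub>0 t"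
    and B\<^sub>0_hat: "B\<^sub>0_hat = completion B\<^sub>0 t\<^sub>B" "\<beta> = to_completion B\<^sub>0 t\<^sub>B"
    and T: "T = tensor_product A\<^sub>0 \<phi>\<^sub>0 B\<^sub>0 \<alpha> A\<^sub>0_hat" "\<tau> = tensor_struct A\<^sub>0 \<phi>\<^sub>0 B\<^sub>0 \<alpha> A\<^sub>0_hat"
    and \<nu>: "\<nu> = tensor_lift B\<^sub>0_hat \<beta> (completion_map B\<^sub>0 t\<^sub>B \<phi>\<^sub>0)"
    and sat: "sat = zero_saturation T (\<tau> t)"
  shows "(\<lambda>C. the_elem (\<nu> ` C)) \<in>
           algebra_iso A\<^sub>0 (\<lambda>a. sat +>\<^bsub>T\<^esub> \<tau> a) (T Quot sat) (\<beta> \<circ> \<phi>\<^sub>0) B\<^sub>0_hat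
       \<and> loc_map B\<^sub>0_hat (\<beta> t\<^sub>B) \<nu> \<in>
           algebra_iso A (loc_map T (\<tau> t) \<tau>) (localization T (\<tau> t))
             (loc_map B\<^sub>0_hat (\<beta> t\<^sub>B) (\<beta> \<circ> \<phi>\<^sub>0)) (localization B\<^sub>0_hat (\<beta> t\<^sub>B))"
proof -
  have etale: "cring (localization A\<^sub>0 t)" "cring B" "\<phi> \<in> ring_hom (localization A\<^sub>0 t) B"
    "finite_projective (localization A\<^sub>0 t) \<phi> B" "unramified (localization A\<^sub>0 t) \<phi> B"
    using assms(4) unfolding finite_etale_def A by simp_all
  \<comment> \<open>Any dual basis will do: \<open>alg_trace_eq\<close> identifies the
    coordinate-free trace of the hypothesis with the one computed from this choice.\<close>
  obtain n e c where dual: "dual_basis (localization A\<^sub>0 t) \<phi> B n e c"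
    using etale(4) unfolding finite_projective_def by blast
  obtain l :: nat where l: "\<forall>b\<in>S. alg_trace (localization A\<^sub>0 t) \<phi> B (\<phi> (to_loc A\<^sub>0 t t) [^]\<^bsub>B\<^esub> l \<otimes>\<^bsub>B\<^esub> b)
      \<in> to_loc A\<^sub>0 t ` carrier A\<^sub>0"
    using assms(11) unfolding A B\<^sub>0 t\<^sub>B \<phi>\<^sub>0 by simp blast
  interpret A\<^sub>0: cring A\<^sub>0 by fact
  interpret A: cring "localization A\<^sub>0 t" by fact
  interpret B: cring B by fact
  interpret integral_trace A\<^sub>0 t \<phi> B n e c S l
  proof (intro integral_trace.intro integral_trace_axioms.intro)
    show "cring_elem A\<^sub>0 t"
      using assms(2) by unfold_locales (simp add: nonzero_divisor_def)
    show "algebra_dual_basis (localization A\<^sub>0 t) \<phi> B n e c"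
      by unfold_locales (fact etale(3) dual)+
    show "nonzero_divisor A\<^sub>0 t" "subring S B" by fact+
    show "\<phi> (to_loc A\<^sub>0 t a) \<in> S" if "a \<in> carrier A\<^sub>0" for a
      using assms(8) that by (auto simp: \<phi>\<^sub>0)
    show "\<exists>b\<in>S. \<exists>k::nat. x = b \<otimes>\<^bsub>B\<^esub> inv\<^bsub>B\<^esub> (\<phi> (to_loc A\<^sub>0 t t) [^]\<^bsub>B\<^esub> k)" if "x \<in> carrier B" for x
      using that unfolding assms(10) unfolding B\<^sub>0 t\<^sub>B \<phi>\<^sub>0 by simp blast
    show "alg_trace (localization A\<^sub>0 t) \<phi> B (\<phi> (to_loc A\<^sub>0 t t) [^]\<^bsub>B\<^esub> l \<otimes>\<^bsub>B\<^esub> b) \<in> to_loc A\<^sub>0 t ` carrier A\<^sub>0"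
      if "b \<in> S" for b
      using l that by blast
  qed
  obtain k :: nat where k: "cp.extendable (\<lambda>b. u [^]\<^bsub>B\<lparr>carrier := S\<rparr>\<^esub> k \<otimes>\<^bsub>B\<lparr>carrier := S\<rparr>\<^esub> b)"
    by (rule extendable_u_pow[OF etale(5)])
  show ?thesis
    using cp.quotient_iso[OF k] cp.localization_iso[OF k]
    unfolding cp.\<nu>_def sat \<nu> T A\<^sub>0_hat B\<^sub>0_hat A B\<^sub>0 t\<^sub>B \<phi>\<^sub>0 by (rule conjI)
qed

end
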